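(* Let $N\ge 3$. Every tracial central state on $\mathrm{Pol}(O_N^+)$ can be written in a unique way as a convex combination of the counit $\varepsilon$, the character $\varepsilon_{alt}$ and the Haar state $h$.
   Context: For a compact quantum group $\mathbb{G}$ with Hopf $*$-algebra $\mathrm{Pol}(\mathbb{G})$ and unitary irreducible representatives $U^\alpha=(U^\alpha_{ij})_{i,j=1}^{d_\alpha}$, $\alpha\in\mathrm{Irr}(\mathbb{G})$: a linear functional $\phi:\mathrm{Pol}(\mathbb{G})\to\mathbb{C}$ is tracial if $\phi(ab)=\phi(ba)$ for all $a,b$, and central if for each $\alpha$ there is $c_\alpha\in\mathbb{C}$ with $\phi(U^\alpha_{ij})=c_\alpha\delta_{ij}$ for all $i,j$. A state is a functional with $\phi(1)=1$ and $\phi(x^*x)\ge0$ for all $x$; a tracial central state is a state that is both tracial and central. The counit satisfies $\varepsilon(U^\alpha_{ij})=\delta_{ij}$; the Haar state $h$ satisfies $h(1)=1$ and $h(U^\alpha_{ij})=0$ for all nontrivial $\alpha$. $\mathrm{Pol}(O_N^+)$ is the universal unital $*$-algebra generated by self-adjoint elements $u_{ij}$, $1\le i,j\le N$, with $\sum_k u_{ik}u_{jk}=\delta_{ij}=\sum_k u_{ki}u_{kj}$, with coproduct $\Delta(u_{ij})=\sum_k u_{ik}\otimes u_{kj}$. The character $\varepsilon_{alt}:\mathrm{Pol}(O_N^+)\to\mathbb{C}$ is the unique unital $*$-homomorphism with $\varepsilon_{alt}(u_{ij})=-\delta_{ij}$. *)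

theory Defs
  imports
    "HOL-Library.Poly_Mapping"
    "HOL-Library.Nonpos_Ints"
    "Jordan_Normal_Form.Matrix"
    Complex_Main
begin

section \<open>Unital complex star-algebras\<close>

text \<open>The zero algebra is allowed here (there is no axiom \<open>0 \<noteq> 1\<close>), so that the class is
  closed under quotients and tensor products.\<close>

class complex_star_algebra = ring + monoid_mult +
  fixes scaleC :: "complex \<Rightarrow> 'a \<Rightarrow> 'a" (infixr "*\<^sub>C" 75)
    and star :: "'a \<Rightarrow> 'a"
  assumes scaleC_add_right: "c *\<^sub>C (x + y) = c *\<^sub>C x + c *\<^sub>C y"
    and scaleC_add_left: "(c + d) *\<^sub>C x = c *\<^sub>C x + d *\<^sub>C x"
    and scaleC_scaleC: "c *\<^sub>C d *\<^sub>C x = (c * d) *\<^sub>C x"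
    and scaleC_one: "1 *\<^sub>C x = x"
    and scaleC_mult_left: "(c *\<^sub>C x) * y = c *\<^sub>C (x * y)"
    and scaleC_mult_right: "x * (c *\<^sub>C y) = c *\<^sub>C (x * y)"
    and star_star: "star (star x) = x"
    and star_add: "star (x + y) = star x + star y"
    and star_mult: "star (x * y) = star y * star x"
    and star_scaleC: "star (c *\<^sub>C x) = cnj c *\<^sub>C star x"
begin

lemma scaleC_zero_left: "0 *\<^sub>C x = 0"
  using scaleC_add_left[of 0 0 x] by simp

lemma scaleC_zero_right: "c *\<^sub>C 0 = 0"
  using scaleC_add_right[of c 0 0] by simp

lemma scaleC_minus_left: "(- c) *\<^sub>C x = - (c *\<^sub>C x)"
  using scaleC_add_left[of c "- c" x] scaleC_zero_left[of x]
  by (simp add: eq_neg_iff_add_eq_0 add.commute)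

lemma star_zero: "star 0 = 0"
  using star_add[of 0 0] by simp

lemma star_one: "star 1 = 1"
  by (metis mult_1_left mult_1_right star_mult star_star)

lemma scaleC_sum_right: "c *\<^sub>C (\<Sum>i\<in>A. f i) = (\<Sum>i\<in>A. c *\<^sub>C f i)"
  by (induction A rule: infinite_finite_induct) (auto simp: scaleC_zero_right scaleC_add_right)

lemma star_sum: "star (\<Sum>i\<in>A. f i) = (\<Sum>i\<in>A. star (f i))"
  by (induction A rule: infinite_finite_induct) (auto simp: star_zero star_add)

end

instantiation complex :: complex_star_algebra
begin

definition scaleC_complex :: "complex \<Rightarrow> complex \<Rightarrow> complex" where "scaleC_complex c x = c * x"
definition star_complex :: "complex \<Rightarrow> complex" where "star_complex x = cnj x"

instance
  by standard (auto simp: scaleC_complex_def star_complex_def algebra_simps)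

end

definition clinear_map :: "('a::complex_star_algebra \<Rightarrow> 'b::complex_star_algebra) \<Rightarrow> bool" where
  "clinear_map f \<longleftrightarrow> (\<forall>x y. f (x + y) = f x + f y) \<and> (\<forall>c x. f (c *\<^sub>C x) = c *\<^sub>C f x)"

definition unital_star_hom :: "('a::complex_star_algebra \<Rightarrow> 'b::complex_star_algebra) \<Rightarrow> bool" where
  "unital_star_hom f \<longleftrightarrow> clinear_map f \<and> f 1 = 1 \<and> (\<forall>x y. f (x * y) = f x * f y)
     \<and> (\<forall>x. f (star x) = star (f x))"

section \<open>Monoid star-algebras and their quotients\<close>

text \<open>The ring \<open>'m \<Rightarrow>\<^sub>0 complex\<close> is the complex monoid algebra of the (additively written, in general
  noncommutative) monoid \<open>'m\<close>. An involution of \<open>'m\<close> extends to a star operation.\<close>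

class involutive_monoid_add = monoid_add +
  fixes minv :: "'a \<Rightarrow> 'a"
  assumes minv_add: "minv (a + b) = minv b + minv a"
    and minv_minv: "minv (minv a) = a"

lemma minv_zero: "minv (0::'a::involutive_monoid_add) = 0"
  by (metis add_0_left add_0_right minv_add minv_minv)

lemma inj_minv: "inj (minv :: 'a::involutive_monoid_add \<Rightarrow> 'a)"
  by (metis injI minv_minv)

lift_definition malg_star :: "('m::involutive_monoid_add \<Rightarrow>\<^sub>0 complex) \<Rightarrow> ('m \<Rightarrow>\<^sub>0 complex)"
  is "\<lambda>f m. cnj (f (minv m))"
proof -
  fix f :: "'m \<Rightarrow> complex"
  assume "finite {k. f k \<noteq> 0}"
  then have "finite (minv -` {k. f k \<noteq> 0})"
    by (rule finite_vimageI) (rule inj_minv)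
  then show "finite {m. cnj (f (minv m)) \<noteq> 0}" by simp
qed

lemma pm_induct [case_names zero add]:
  assumes "P 0" and "\<And>x k (v::complex). P x \<Longrightarrow> P (x + Poly_Mapping.single k v)"
  shows "P x"
proof (induction x rule: update_induct)
  case (const)
  show ?case by (rule assms(1))
next
  case (update f a b)
  have "Poly_Mapping.update a b f = f + Poly_Mapping.single a b"
    using update(1)
    by (intro poly_mapping_eqI)
       (auto simp: lookup_update lookup_add lookup_single when_def not_in_keys_iff_lookup_eq_zero)
  then show ?case using assms(2)[OF update(3)] by simp
qed

lemma malg_star_add: "malg_star (x + y) = malg_star x + malg_star y"
  by transfer auto

lemma malg_star_zero: "malg_star 0 = 0"
  by transfer auto

lemma malg_star_minus: "malg_star (x - y) = malg_star x - malg_star y"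
  by transfer auto

lemma malg_star_sum: "malg_star (\<Sum>i\<in>A. f i) = (\<Sum>i\<in>A. malg_star (f i))"
  by (induction A rule: infinite_finite_induct) (auto simp: malg_star_zero malg_star_add)

lemma malg_star_star: "malg_star (malg_star x) = x"
  by transfer (auto simp: minv_minv)

lemma malg_star_single: "malg_star (Poly_Mapping.single m c) = Poly_Mapping.single (minv m) (cnj c)"
  by transfer (auto simp: fun_eq_iff when_def minv_minv)

lemma malg_star_mult: "malg_star (x * y) = malg_star y * malg_star x"
proof (induction x rule: pm_induct)
  case zero
  show ?case by (simp add: malg_star_zero)
next
  case (add x k v)
  have "malg_star (Poly_Mapping.single k v * y) = malg_star y * malg_star (Poly_Mapping.single k v)"
    by (induction y rule: pm_induct)
       (simp_all add: malg_star_zero malg_star_add malg_star_single mult_single minv_add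
          distrib_left distrib_right mult.commute)
  then show ?case using add by (simp add: malg_star_add distrib_left distrib_right)
qed

lemma malg_star_one: "malg_star 1 = 1"
  by (simp add: malg_star_single minv_zero flip: single_one)

abbreviation malg_scale :: "complex \<Rightarrow> ('m \<Rightarrow>\<^sub>0 complex) \<Rightarrow> ('m \<Rightarrow>\<^sub>0 complex)" where
  "malg_scale c x \<equiv> Poly_Mapping.map ((*) c) x"

lemma lookup_malg_scale: "Poly_Mapping.lookup (malg_scale c x) m = c * Poly_Mapping.lookup x m"
  by (simp add: map.rep_eq when_def)

lemma malg_scale_add: "malg_scale c (x + y) = malg_scale c x + malg_scale c y"
  by (rule poly_mapping_eqI) (simp add: lookup_malg_scale lookup_add distrib_left)

lemma malg_scale_minus: "malg_scale c (x - y) = malg_scale c x - malg_scale c y"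
  by (rule poly_mapping_eqI) (simp add: lookup_malg_scale lookup_minus right_diff_distrib)

lemma malg_scale_add_left: "malg_scale (c + d) x = malg_scale c x + malg_scale d x"
  by (rule poly_mapping_eqI) (simp add: lookup_malg_scale lookup_add distrib_right)

lemma malg_scale_scale: "malg_scale c (malg_scale d x) = malg_scale (c * d) x"
  by (rule poly_mapping_eqI) (simp add: lookup_malg_scale)

lemma malg_scale_one: "malg_scale 1 x = x"
  by (rule poly_mapping_eqI) (simp add: lookup_malg_scale)

lemma malg_scale_zero: "malg_scale c 0 = 0"
  by (rule poly_mapping_eqI) (simp add: lookup_malg_scale)

lemma malg_scale_zero_left: "malg_scale 0 x = 0"
  by (rule poly_mapping_eqI) (simp add: lookup_malg_scale)

lemma malg_scale_single: "malg_scale c (Poly_Mapping.single m d) = Poly_Mapping.single m (c * d)"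
  by (rule poly_mapping_eqI) (simp add: lookup_malg_scale lookup_single when_def)

lemma malg_scale_conv_mult:
  "malg_scale c (x :: 'm::monoid_add \<Rightarrow>\<^sub>0 complex) = Poly_Mapping.single 0 c * x"
  by (rule mult_map_scale_conv_mult)

lemma malg_scale_mult_left:
  "malg_scale c x * y = malg_scale c (x * (y :: 'm::monoid_add \<Rightarrow>\<^sub>0 complex))"
  by (simp add: malg_scale_conv_mult mult.assoc)

lemma malg_scale_mult_right:
  "x * malg_scale c y = malg_scale c (x * (y :: 'm::monoid_add \<Rightarrow>\<^sub>0 complex))"
proof (induction x rule: pm_induct)
  case (add x k v)
  have "Poly_Mapping.single k v * malg_scale c y = malg_scale c (Poly_Mapping.single k v * y)"
    by (simp add: malg_scale_conv_mult mult_single mult.commute flip: mult.assoc)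
  with add show ?case by (simp add: distrib_right malg_scale_add)
qed (simp add: malg_scale_zero)

lemma malg_star_scale: "malg_star (malg_scale c x) = malg_scale (cnj c) (malg_star x)"
  by (rule poly_mapping_eqI) (simp add: lookup_malg_scale malg_star.rep_eq)

definition star_ideal :: "('m::involutive_monoid_add \<Rightarrow>\<^sub>0 complex) set \<Rightarrow> bool" where
  "star_ideal I \<longleftrightarrow> 0 \<in> I \<and> (\<forall>x\<in>I. \<forall>y\<in>I. x + y \<in> I)
     \<and> (\<forall>a. \<forall>x\<in>I. a * x \<in> I) \<and> (\<forall>a. \<forall>x\<in>I. x * a \<in> I) \<and> (\<forall>x\<in>I. malg_star x \<in> I)"

lemma star_idealD:
  assumes "star_ideal I"
  shows "0 \<in> I" "x \<in> I \<Longrightarrow> y \<in> I \<Longrightarrow> x + y \<in> I" "x \<in> I \<Longrightarrow> a * x \<in> I" "x \<in> I \<Longrightarrow> x * a \<in> I"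
    "x \<in> I \<Longrightarrow> malg_star x \<in> I"
  using assms unfolding star_ideal_def by auto

lemma star_ideal_scale: "star_ideal I \<Longrightarrow> x \<in> I \<Longrightarrow> malg_scale c x \<in> I"
  by (simp add: malg_scale_conv_mult star_idealD)

lemma star_ideal_uminus: "star_ideal I \<Longrightarrow> x \<in> I \<Longrightarrow> - x \<in> I"
  using star_idealD(3)[of I x "- 1"] by simp

lemma star_ideal_equivp:
  assumes I: "star_ideal I"
  shows "equivp (\<lambda>x y. x - y \<in> I)"
proof (rule equivpI)
  show "reflp (\<lambda>x y. x - y \<in> I)" by (simp add: reflp_def star_idealD[OF I])
  show "symp (\<lambda>x y. x - y \<in> I)"
  proof (rule sympI)
    fix x y assume "x - y \<in> I"
    then show "y - x \<in> I" using star_ideal_uminus[OF I, of "x - y"] by simp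
  qed
  show "transp (\<lambda>x y. x - y \<in> I)"
  proof (rule transpI)
    fix x y z assume "x - y \<in> I" "y - z \<in> I"
    then show "x - z \<in> I" using star_idealD(2)[OF I, of "x - y" "y - z"] by simp
  qed
qed

lemma star_ideal_cong:
  assumes I: "star_ideal I" and x: "x - x' \<in> I" and y: "y - y' \<in> I"
  shows "(x + y) - (x' + y') \<in> I" "(x - y) - (x' - y') \<in> I" "- x - (- x') \<in> I"
    "x * y - x' * y' \<in> I" "malg_scale c x - malg_scale c x' \<in> I" "malg_star x - malg_star x' \<in> I"
proof -
  show "(x + y) - (x' + y') \<in> I"
    using star_idealD(2)[OF I x y] by (simp add: algebra_simps)
  show "(x - y) - (x' - y') \<in> I"
    using star_idealD(2)[OF I x star_ideal_uminus[OF I y]] by (simp add: algebra_simps)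
  show "- x - (- x') \<in> I"
    using star_ideal_uminus[OF I x] by (simp add: algebra_simps)
  show "x * y - x' * y' \<in> I"
    using star_idealD(2)[OF I star_idealD(4)[OF I x, of y] star_idealD(3)[OF I y, of x']]
    by (simp add: algebra_simps)
  show "malg_scale c x - malg_scale c x' \<in> I"
    using star_ideal_scale[OF I x] by (simp add: malg_scale_minus)
  show "malg_star x - malg_star x' \<in> I"
    using star_idealD(5)[OF I x] by (simp add: malg_star_minus)
qed

lemma star_ideal_eqI: "star_ideal I \<Longrightarrow> x = y \<Longrightarrow> x - y \<in> I"
  by (simp add: star_idealD(1))

lemmas malg_star_algebra_laws =
  mult.assoc add.assoc add.commute add_0_left left_minus diff_conv_add_uminus distrib_left
  distrib_right mult_1_left mult_1_right malg_scale_add malg_scale_add_left malg_scale_scale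
  malg_scale_one malg_scale_mult_left malg_scale_mult_right malg_star_star malg_star_add
  malg_star_mult malg_star_scale

text \<open>Linear extension of a map defined on the monoid.\<close>

definition malg_extend :: "('m \<Rightarrow> 'b::complex_star_algebra) \<Rightarrow> ('m \<Rightarrow>\<^sub>0 complex) \<Rightarrow> 'b" where
  "malg_extend h x = (\<Sum>m\<in>Poly_Mapping.keys x. Poly_Mapping.lookup x m *\<^sub>C h m)"

lemma malg_extend_superset:
  assumes "finite S" "Poly_Mapping.keys x \<subseteq> S"
  shows "malg_extend h x = (\<Sum>m\<in>S. Poly_Mapping.lookup x m *\<^sub>C h m)"
  unfolding malg_extend_def using assms
  by (intro sum.mono_neutral_left) (auto simp: in_keys_iff scaleC_zero_left)

lemma malg_extend_add: "malg_extend h (x + y) = malg_extend h x + malg_extend h y"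
proof -
  let ?S = "Poly_Mapping.keys x \<union> Poly_Mapping.keys y"
  have "malg_extend h (x + y) = (\<Sum>m\<in>?S. Poly_Mapping.lookup (x + y) m *\<^sub>C h m)"
    by (rule malg_extend_superset) (auto dest: subsetD[OF keys_add])
  also have "\<dots> = malg_extend h x + malg_extend h y"
    by (simp add: malg_extend_superset[of ?S x] malg_extend_superset[of ?S y] lookup_add
        scaleC_add_left sum.distrib)
  finally show ?thesis .
qed

lemma malg_extend_single: "malg_extend h (Poly_Mapping.single m c) = c *\<^sub>C h m"
  by (simp add: malg_extend_superset[of "{m}"])

lemma malg_extend_zero: "malg_extend h 0 = 0"
  by (simp add: malg_extend_def)

lemma malg_extend_scale: "malg_extend h (malg_scale c x) = c *\<^sub>C malg_extend h x"
  by (induction x rule: pm_induct)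
     (simp_all add: malg_scale_zero malg_extend_zero scaleC_zero_right malg_scale_add
        malg_extend_add malg_scale_single malg_extend_single scaleC_add_right scaleC_scaleC)

lemma malg_extend_minus: "malg_extend h (x - y) = malg_extend h x - malg_extend h y"
  by (metis add_diff_cancel_right' diff_add_cancel malg_extend_add)

lemma malg_extend_sum: "malg_extend h (\<Sum>i\<in>A. f i) = (\<Sum>i\<in>A. malg_extend h (f i))"
  by (induction A rule: infinite_finite_induct) (auto simp: malg_extend_zero malg_extend_add)

lemma malg_extend_one: "malg_extend h 1 = h 0"
  by (simp add: malg_extend_single scaleC_one flip: single_one)

lemma malg_extend_mult:
  assumes "\<And>m n. h (m + n) = h m * h n"
  shows "malg_extend h (x * y) = malg_extend h x * malg_extend h y"
proof (induction x rule: pm_induct)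
  case (add x k v)
  have "malg_extend h (Poly_Mapping.single k v * y)
      = malg_extend h (Poly_Mapping.single k v) * malg_extend h y"
    by (induction y rule: pm_induct)
       (simp_all add: malg_extend_zero malg_extend_add malg_extend_single mult_single assms
          distrib_left scaleC_mult_left scaleC_mult_right scaleC_scaleC mult.commute)
  with add show ?case by (simp add: malg_extend_add distrib_right)
qed (simp add: malg_extend_zero)

lemma malg_extend_star:
  assumes "\<And>m. h (minv m) = star (h m)"
  shows "malg_extend h (malg_star x) = star (malg_extend h x)"
  by (induction x rule: pm_induct)
     (simp_all add: malg_star_zero malg_extend_zero star_zero malg_star_add malg_extend_add
        malg_star_single malg_extend_single star_add star_scaleC assms)

section \<open>The algebraic tensor product\<close>

text \<open>\<open>A \<otimes> B\<close> is the free vector space on \<open>A \<times> B\<close> modulo the span of the bilinearity relations.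
  The monoid structure on the symbols is the componentwise multiplication of the two algebras, so
  that the monoid algebra multiplication induces \<open>(a \<otimes> b) (c \<otimes> d) = ac \<otimes> bd\<close>.\<close>

datatype ('a, 'b) elem_tensor = ElemTensor 'a 'b

instantiation elem_tensor :: (complex_star_algebra, complex_star_algebra) involutive_monoid_add
begin

definition zero_elem_tensor :: "('a, 'b) elem_tensor" where "0 = ElemTensor 1 1"

fun plus_elem_tensor ::
  "('a, 'b) elem_tensor \<Rightarrow> ('a, 'b) elem_tensor \<Rightarrow> ('a, 'b) elem_tensor" where
  "ElemTensor a b + ElemTensor c d = ElemTensor (a * c) (b * d)"

fun minv_elem_tensor :: "('a, 'b) elem_tensor \<Rightarrow> ('a, 'b) elem_tensor" where
  "minv (ElemTensor a b) = ElemTensor (star a) (star b)"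

instance
proof
  fix x y z :: "('a, 'b) elem_tensor"
  show "x + y + z = x + (y + z)" by (cases x; cases y; cases z) (simp add: mult.assoc)
  show "0 + x = x" "x + 0 = x" by (cases x; simp add: zero_elem_tensor_def)+
  show "minv (x + y) = minv y + minv x" by (cases x; cases y) (simp add: star_mult)
  show "minv (minv x) = x" by (cases x) (simp add: star_star)
qed

end

abbreviation elem_tensor_symbol ::
  "'a \<Rightarrow> 'b \<Rightarrow> ('a, 'b) elem_tensor \<Rightarrow>\<^sub>0 complex" where
  "elem_tensor_symbol a b \<equiv> Poly_Mapping.single (ElemTensor a b) 1"

inductive_set bilinear_relations ::
  "(('a::complex_star_algebra, 'b::complex_star_algebra) elem_tensor \<Rightarrow>\<^sub>0 complex) set" where
  add_left: "elem_tensor_symbol (a + a') b - (elem_tensor_symbol a b + elem_tensor_symbol a' b)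
     \<in> bilinear_relations"
| add_right: "elem_tensor_symbol a (b + b') - (elem_tensor_symbol a b + elem_tensor_symbol a b')
     \<in> bilinear_relations"
| scale_left: "elem_tensor_symbol (c *\<^sub>C a) b - malg_scale c (elem_tensor_symbol a b)
     \<in> bilinear_relations"
| scale_right: "elem_tensor_symbol a (c *\<^sub>C b) - malg_scale c (elem_tensor_symbol a b)
     \<in> bilinear_relations"

inductive_set bilinear_span ::
  "(('a::complex_star_algebra, 'b::complex_star_algebra) elem_tensor \<Rightarrow>\<^sub>0 complex) set" where
  zero: "0 \<in> bilinear_span"
| step: "x \<in> bilinear_span \<Longrightarrow> r \<in> bilinear_relations \<Longrightarrow> x + malg_scale c r \<in> bilinear_span"

lemma bilinear_span_add:
  assumes "x \<in> bilinear_span" "y \<in> bilinear_span"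
  shows "x + y \<in> bilinear_span"
  using assms(2,1)
proof (induction y rule: bilinear_span.induct)
  case (step y r c)
  then show ?case using bilinear_span.step[of "x + y" r c] by (simp add: add.assoc)
qed simp

lemma bilinear_span_scale: "x \<in> bilinear_span \<Longrightarrow> malg_scale c x \<in> bilinear_span"
proof (induction x rule: bilinear_span.induct)
  case (step y r d)
  then show ?case using bilinear_span.step[of "malg_scale c y" r "c * d"]
    by (simp add: malg_scale_add malg_scale_scale)
qed (simp add: malg_scale_zero bilinear_span.zero)

lemma bilinear_span_relation: "r \<in> bilinear_relations \<Longrightarrow> r \<in> bilinear_span"
  using bilinear_span.step[OF bilinear_span.zero, of r 1] by (simp add: malg_scale_one)

lemmas bilinear_relations_intros' =
  bilinear_relations.add_left bilinear_relations.add_right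
  bilinear_relations.scale_left[unfolded malg_scale_single mult_1_right]
  bilinear_relations.scale_right[unfolded malg_scale_single mult_1_right]

lemma bilinear_relations_mult_left:
  assumes "r \<in> bilinear_relations"
  shows "Poly_Mapping.single m 1 * r \<in> bilinear_relations"
  using assms
  by (cases m, induction rule: bilinear_relations.induct)
     (auto simp: right_diff_distrib distrib_left mult_single malg_scale_single
       scaleC_mult_right intro: bilinear_relations_intros')

lemma bilinear_relations_mult_right:
  assumes "r \<in> bilinear_relations"
  shows "r * Poly_Mapping.single m 1 \<in> bilinear_relations"
  using assms
  by (cases m, induction rule: bilinear_relations.induct)
     (auto simp: left_diff_distrib distrib_right mult_single malg_scale_single
       scaleC_mult_left intro: bilinear_relations_intros')

lemma bilinear_relations_star:
  "r \<in> bilinear_relations \<Longrightarrow> malg_star r \<in> bilinear_relations"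
  by (induction rule: bilinear_relations.induct)
     (auto simp: malg_star_minus malg_star_add malg_star_single malg_scale_single star_add
       star_scaleC intro: bilinear_relations_intros')

lemma star_ideal_bilinear_span: "star_ideal bilinear_span"
proof -
  have left: "Poly_Mapping.single m d * x \<in> bilinear_span"
    and right: "x * Poly_Mapping.single m d \<in> bilinear_span"
    if "x \<in> bilinear_span" for m d and x :: "('a, 'b) elem_tensor \<Rightarrow>\<^sub>0 complex"
  proof -
    have d: "Poly_Mapping.single m d = malg_scale d (Poly_Mapping.single m 1)"
      by (simp add: malg_scale_single)
    from that show "Poly_Mapping.single m d * x \<in> bilinear_span"
    proof (induction x rule: bilinear_span.induct)
      case (step x r c)
      have "malg_scale (d * c) (Poly_Mapping.single m 1 * r) \<in> bilinear_span"
        using step by (intro bilinear_span_scale bilinear_span_relation bilinear_relations_mult_left)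
      with step show ?case
        unfolding d
        by (simp add: distrib_left malg_scale_add malg_scale_mult_left malg_scale_mult_right malg_scale_scale
            mult.commute[of c d] bilinear_span_add del: map_single)
    qed (simp add: bilinear_span.zero)
    from that show "x * Poly_Mapping.single m d \<in> bilinear_span"
    proof (induction x rule: bilinear_span.induct)
      case (step x r c)
      have "malg_scale (d * c) (r * Poly_Mapping.single m 1) \<in> bilinear_span"
        using step by (intro bilinear_span_scale bilinear_span_relation bilinear_relations_mult_right)
      with step show ?case
        unfolding d
        by (simp add: distrib_right malg_scale_add malg_scale_mult_left malg_scale_mult_right malg_scale_scale
            mult.commute[of c d] bilinear_span_add del: map_single)
    qed (simp add: bilinear_span.zero)
  qed
  have "a * x \<in> bilinear_span" if "x \<in> bilinear_span"
    for a x :: "('a, 'b) elem_tensor \<Rightarrow>\<^sub>0 complex"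
    by (induction a rule: pm_induct)
       (auto simp: distrib_right bilinear_span.zero intro!: bilinear_span_add left that)
  moreover have "x * a \<in> bilinear_span" if "x \<in> bilinear_span"
    for a x :: "('a, 'b) elem_tensor \<Rightarrow>\<^sub>0 complex"
    by (induction a rule: pm_induct)
       (auto simp: distrib_left bilinear_span.zero intro!: bilinear_span_add right that)
  moreover have "malg_star x \<in> bilinear_span" if "x \<in> bilinear_span"
    for x :: "('a, 'b) elem_tensor \<Rightarrow>\<^sub>0 complex"
    using that
    by (induction rule: bilinear_span.induct)
       (auto simp: malg_star_zero malg_star_add malg_star_scale
         intro!: bilinear_span.intros bilinear_relations_star)
  ultimately show ?thesis
    unfolding star_ideal_def using bilinear_span.zero bilinear_span_add by auto
qed

quotient_type (overloaded) ('a, 'b) tensor =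
  "('a::complex_star_algebra, 'b::complex_star_algebra) elem_tensor \<Rightarrow>\<^sub>0 complex"
  / "\<lambda>x y. x - y \<in> bilinear_span"
  by (rule star_ideal_equivp[OF star_ideal_bilinear_span])

lift_definition tensor_of ::
  "'a::complex_star_algebra \<Rightarrow> 'b::complex_star_algebra \<Rightarrow> ('a, 'b) tensor" (infixr "\<otimes>\<^sub>t" 72)
  is elem_tensor_symbol .

instantiation tensor :: (complex_star_algebra, complex_star_algebra) complex_star_algebra
begin

lift_definition zero_tensor :: "('a, 'b) tensor" is 0 .
lift_definition one_tensor :: "('a, 'b) tensor" is 1 .
lift_definition plus_tensor :: "('a, 'b) tensor \<Rightarrow> ('a, 'b) tensor \<Rightarrow> ('a, 'b) tensor" is "(+)"
  by (rule star_ideal_cong[OF star_ideal_bilinear_span])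
lift_definition minus_tensor :: "('a, 'b) tensor \<Rightarrow> ('a, 'b) tensor \<Rightarrow> ('a, 'b) tensor" is "(-)"
  by (rule star_ideal_cong[OF star_ideal_bilinear_span])
lift_definition uminus_tensor :: "('a, 'b) tensor \<Rightarrow> ('a, 'b) tensor" is uminus
  by (rule star_ideal_cong[OF star_ideal_bilinear_span])
lift_definition times_tensor :: "('a, 'b) tensor \<Rightarrow> ('a, 'b) tensor \<Rightarrow> ('a, 'b) tensor" is "(*)"
  by (rule star_ideal_cong[OF star_ideal_bilinear_span])
lift_definition scaleC_tensor :: "complex \<Rightarrow> ('a, 'b) tensor \<Rightarrow> ('a, 'b) tensor" is malg_scale
  by (rule star_ideal_cong[OF star_ideal_bilinear_span])
lift_definition star_tensor :: "('a, 'b) tensor \<Rightarrow> ('a, 'b) tensor" is malg_star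
  by (rule star_ideal_cong[OF star_ideal_bilinear_span])

instance
  by standard
     (transfer, rule star_ideal_eqI[OF star_ideal_bilinear_span], rule malg_star_algebra_laws)+

end

lemma tensor_of_add_left: "(a + a') \<otimes>\<^sub>t b = a \<otimes>\<^sub>t b + a' \<otimes>\<^sub>t b"
  by transfer (rule bilinear_span_relation[OF bilinear_relations.add_left])

lemma tensor_of_add_right: "a \<otimes>\<^sub>t (b + b') = a \<otimes>\<^sub>t b + a \<otimes>\<^sub>t b'"
  by transfer (rule bilinear_span_relation[OF bilinear_relations.add_right])

lemma tensor_of_scale_left: "(c *\<^sub>C a) \<otimes>\<^sub>t b = c *\<^sub>C (a \<otimes>\<^sub>t b)"
  by transfer (rule bilinear_span_relation[OF bilinear_relations.scale_left])

lemma tensor_of_scale_right: "a \<otimes>\<^sub>t (c *\<^sub>C b) = c *\<^sub>C (a \<otimes>\<^sub>t b)"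
  by transfer (rule bilinear_span_relation[OF bilinear_relations.scale_right])

lemma tensor_of_mult: "(a \<otimes>\<^sub>t b) * (c \<otimes>\<^sub>t d) = (a * c) \<otimes>\<^sub>t (b * d)"
  by transfer (simp add: mult_single bilinear_span.zero)

lemma tensor_of_one: "1 \<otimes>\<^sub>t 1 = 1"
  by transfer (simp add: bilinear_span.zero flip: single_one zero_elem_tensor_def)

lemma star_tensor_of: "star (a \<otimes>\<^sub>t b) = star a \<otimes>\<^sub>t star b"
  by transfer (simp add: malg_star_single bilinear_span.zero)

lemma tensor_of_zero_left: "0 \<otimes>\<^sub>t b = 0"
  using tensor_of_add_left[of 0 0 b] by simp

lemma tensor_of_zero_right: "a \<otimes>\<^sub>t 0 = 0"
  using tensor_of_add_right[of a 0 0] by simp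

text \<open>Bilinear maps factor through the tensor product.\<close>

lemma tensor_universal:
  fixes B :: "'a::complex_star_algebra \<Rightarrow> 'b::complex_star_algebra \<Rightarrow> 'c::complex_star_algebra"
  assumes "\<And>b. clinear_map (\<lambda>a. B a b)" and "\<And>a. clinear_map (B a)"
  shows "\<exists>!f. clinear_map f \<and> (\<forall>a b. f (a \<otimes>\<^sub>t b) = B a b)"
proof -
  define g where "g = malg_extend (\<lambda>m. case m of ElemTensor a b \<Rightarrow> B a b)"
  have rel: "g r = 0" if "r \<in> bilinear_relations" for r
    using that assms unfolding clinear_map_def
    by induction (auto simp: g_def malg_extend_minus malg_extend_add malg_extend_scale
        malg_extend_single scaleC_one)
  have null: "g x = 0" if "x \<in> bilinear_span" for x
    using that
    by induction (auto simp: g_def malg_extend_zero malg_extend_add malg_extend_scale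
        scaleC_zero_right rel[unfolded g_def])
  define f where "f t = g (rep_tensor t)" for t
  have f_abs: "f (abs_tensor x) = g x" for x
  proof -
    have "rep_tensor (abs_tensor x) - x \<in> bilinear_span"
      using Quotient_rep_abs[OF Quotient_tensor, of x]
      by (simp add: bilinear_span.zero)
    from null[OF this] show ?thesis by (simp add: f_def g_def malg_extend_minus)
  qed
  show ?thesis
  proof (rule ex1I[of _ f])
    have "f (x + y) = f x + f y" for x y
      by (induct x rule: tensor.abs_induct, induct y rule: tensor.abs_induct) (simp add: plus_tensor.abs_eq f_abs g_def malg_extend_add)
    moreover have "f (c *\<^sub>C x) = c *\<^sub>C f x" for c x
      by (induct x rule: tensor.abs_induct) (simp add: scaleC_tensor.abs_eq f_abs g_def malg_extend_scale)
    moreover have "f (a \<otimes>\<^sub>t b) = B a b" for a b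
      by (simp add: tensor_of.abs_eq f_abs g_def malg_extend_single scaleC_one)
    ultimately show "clinear_map f \<and> (\<forall>a b. f (a \<otimes>\<^sub>t b) = B a b)"
      by (simp add: clinear_map_def)
  next
    fix f' assume f': "clinear_map f' \<and> (\<forall>a b. f' (a \<otimes>\<^sub>t b) = B a b)"
    have "f' (abs_tensor x) = g x" for x
    proof (induction x rule: pm_induct)
      case zero
      have "f' (0 + 0) = f' 0 + f' 0" using f' unfolding clinear_map_def by blast
      then show ?case by (simp add: g_def malg_extend_zero flip: zero_tensor.abs_eq)
    next
      case (add x k v)
      obtain a b where k: "k = ElemTensor a b" by (cases k)
      have "abs_tensor (Poly_Mapping.single k v) = v *\<^sub>C (a \<otimes>\<^sub>t b)"
        by (simp add: k tensor_of.abs_eq scaleC_tensor.abs_eq malg_scale_single)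
      then have "abs_tensor (x + Poly_Mapping.single k v) = abs_tensor x + v *\<^sub>C (a \<otimes>\<^sub>t b)"
        by (simp flip: plus_tensor.abs_eq)
      then show ?case
        using add f' by (simp add: clinear_map_def g_def malg_extend_add malg_extend_single k)
    qed
    then have "f' x = f x" for x
      by (induct x rule: tensor.abs_induct) (simp add: f_abs)
    then show "f' = f" by (rule ext)
  qed
qed

section \<open>The algebra of the free orthogonal quantum group\<close>

datatype 'g free_monoid = Word (letters: "'g list")

instantiation free_monoid :: (type) involutive_monoid_add
begin

definition zero_free_monoid :: "'a free_monoid" where "0 = Word []"
definition plus_free_monoid :: "'a free_monoid \<Rightarrow> 'a free_monoid \<Rightarrow> 'a free_monoid" where
  "v + w = Word (letters v @ letters w)"
definition minv_free_monoid :: "'a free_monoid \<Rightarrow> 'a free_monoid" where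
  "minv w = Word (rev (letters w))"

instance
  by standard (auto simp: zero_free_monoid_def plus_free_monoid_def minv_free_monoid_def)

end

text \<open>\<open>'g free_monoid \<Rightarrow>\<^sub>0 complex\<close> is the free unital star-algebra on self-adjoint generators
  indexed by \<open>'g\<close>.\<close>

abbreviation free_gen :: "'g \<Rightarrow> 'g free_monoid \<Rightarrow>\<^sub>0 complex" where
  "free_gen g \<equiv> Poly_Mapping.single (Word [g]) 1"

inductive_set generated_ideal :: "('m::monoid_add \<Rightarrow>\<^sub>0 complex) set \<Rightarrow> ('m \<Rightarrow>\<^sub>0 complex) set"
  for R where
  zero: "0 \<in> generated_ideal R"
| step: "x \<in> generated_ideal R \<Longrightarrow> r \<in> R \<Longrightarrow> x + a * r * b \<in> generated_ideal R"

lemma generated_ideal_add: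
  assumes "x \<in> generated_ideal R" "y \<in> generated_ideal R"
  shows "x + y \<in> generated_ideal R"
  using assms(2,1)
proof (induction y rule: generated_ideal.induct)
  case (step y r a b)
  then show ?case using generated_ideal.step[of "x + y" R r a b] by (simp add: add.assoc)
qed simp

lemma generated_ideal_relation: "r \<in> R \<Longrightarrow> r \<in> generated_ideal R"
  using generated_ideal.step[OF generated_ideal.zero, of r R 1 1] by simp

lemma star_ideal_generated:
  assumes "\<And>r. r \<in> R \<Longrightarrow> malg_star r \<in> R"
  shows "star_ideal (generated_ideal R)"
proof -
  have "a * x \<in> generated_ideal R" if "x \<in> generated_ideal R" for a x
    using that
  proof induction
    case (step x r c d)
    then show ?case using generated_ideal.step[of "a * x" R r "a * c" d]
      by (simp add: distrib_left mult.assoc)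
  qed (simp add: generated_ideal.zero)
  moreover have "x * a \<in> generated_ideal R" if "x \<in> generated_ideal R" for a x
    using that
  proof induction
    case (step x r c d)
    then show ?case using generated_ideal.step[of "x * a" R r c "d * a"]
      by (simp add: distrib_right mult.assoc)
  qed (simp add: generated_ideal.zero)
  moreover have "malg_star x \<in> generated_ideal R" if "x \<in> generated_ideal R" for x
    using that
  proof induction
    case (step x r c d)
    then show ?case
      using generated_ideal.step[of "malg_star x" R "malg_star r" "malg_star d" "malg_star c"] assms
      by (simp add: malg_star_add malg_star_mult mult.assoc)
  qed (simp add: malg_star_zero generated_ideal.zero)
  ultimately show ?thesis
    unfolding star_ideal_def using generated_ideal.zero generated_ideal_add by auto
qed

definition orthogonality_relations :: "(('n::finite \<times> 'n) free_monoid \<Rightarrow>\<^sub>0 complex) set" where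
  "orthogonality_relations =
     {(\<Sum>k\<in>UNIV. free_gen (i, k) * free_gen (j, k)) - (if i = j then 1 else 0) | i j. True} \<union>
     {(\<Sum>k\<in>UNIV. free_gen (k, i) * free_gen (k, j)) - (if i = j then 1 else 0) | i j. True}"

lemma orthogonality_relations_star:
  fixes r :: "('n::finite \<times> 'n) free_monoid \<Rightarrow>\<^sub>0 complex"
  assumes "r \<in> orthogonality_relations"
  shows "malg_star r \<in> orthogonality_relations"
proof -
  have rel1: "malg_star ((\<Sum>k\<in>UNIV. free_gen (i, k) * free_gen (j, k)) - (if i = j then 1 else 0))
      = (\<Sum>k\<in>UNIV. free_gen (j, k) * free_gen (i, k)) - (if j = i then 1 else 0)"
    and rel2: "malg_star ((\<Sum>k\<in>UNIV. free_gen (k, i) * free_gen (k, j)) - (if i = j then 1 else 0))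
      = (\<Sum>k\<in>UNIV. free_gen (k, j) * free_gen (k, i)) - (if j = i then 1 else 0)" for i j :: 'n
    unfolding malg_star_minus malg_star_sum malg_star_mult
    by (auto simp: malg_star_one malg_star_zero malg_star_single minv_free_monoid_def)
  from assms consider
      i j where "r = (\<Sum>k\<in>UNIV. free_gen (i, k) * free_gen (j, k)) - (if i = j then 1 else 0)"
    | i j where "r = (\<Sum>k\<in>UNIV. free_gen (k, i) * free_gen (k, j)) - (if i = j then 1 else 0)"
    unfolding orthogonality_relations_def by blast
  then show ?thesis
  proof cases
    case 1
    then show ?thesis unfolding orthogonality_relations_def \<open>r = _\<close> rel1 by blast
  next
    case 2
    then show ?thesis unfolding orthogonality_relations_def \<open>r = _\<close> rel2 by blast
  qed
qed

lemma star_ideal_orthogonality: "star_ideal (generated_ideal orthogonality_relations)"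
  by (rule star_ideal_generated) (rule orthogonality_relations_star)

text \<open>The size \<open>N\<close> is \<open>card (UNIV :: 'n set)\<close>, the generators being indexed by \<open>'n \<times> 'n\<close>.\<close>

quotient_type (overloaded) 'n pol_O = "('n::finite \<times> 'n) free_monoid \<Rightarrow>\<^sub>0 complex"
  / "\<lambda>x y. x - y \<in> generated_ideal orthogonality_relations"
  by (rule star_ideal_equivp[OF star_ideal_orthogonality])

lift_definition u :: "'n \<Rightarrow> 'n \<Rightarrow> 'n::finite pol_O" is "\<lambda>i j. free_gen (i, j)" .

instantiation pol_O :: (finite) complex_star_algebra
begin

lift_definition zero_pol_O :: "'a pol_O" is 0 .
lift_definition one_pol_O :: "'a pol_O" is 1 .
lift_definition plus_pol_O :: "'a pol_O \<Rightarrow> 'a pol_O \<Rightarrow> 'a pol_O" is "(+)"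
  by (rule star_ideal_cong[OF star_ideal_orthogonality])
lift_definition minus_pol_O :: "'a pol_O \<Rightarrow> 'a pol_O \<Rightarrow> 'a pol_O" is "(-)"
  by (rule star_ideal_cong[OF star_ideal_orthogonality])
lift_definition uminus_pol_O :: "'a pol_O \<Rightarrow> 'a pol_O" is uminus
  by (rule star_ideal_cong[OF star_ideal_orthogonality])
lift_definition times_pol_O :: "'a pol_O \<Rightarrow> 'a pol_O \<Rightarrow> 'a pol_O" is "(*)"
  by (rule star_ideal_cong[OF star_ideal_orthogonality])
lift_definition scaleC_pol_O :: "complex \<Rightarrow> 'a pol_O \<Rightarrow> 'a pol_O" is malg_scale
  by (rule star_ideal_cong[OF star_ideal_orthogonality])
lift_definition star_pol_O :: "'a pol_O \<Rightarrow> 'a pol_O" is malg_star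
  by (rule star_ideal_cong[OF star_ideal_orthogonality])

instance
  by standard
     (transfer, rule star_ideal_eqI[OF star_ideal_orthogonality], rule malg_star_algebra_laws)+

end

lemma abs_pol_O_sum: "abs_pol_O (\<Sum>i\<in>A. f i) = (\<Sum>i\<in>A. abs_pol_O (f i))"
  by (induction A rule: infinite_finite_induct)
     (auto simp: zero_pol_O.abs_eq plus_pol_O.abs_eq[symmetric])

lemma star_u: "star (u i j) = u i j"
  by transfer (simp add: malg_star_single minv_free_monoid_def generated_ideal.zero)

lemma abs_pol_O_relation: "r \<in> orthogonality_relations \<Longrightarrow> abs_pol_O r = 0"
  by (simp add: zero_pol_O.abs_eq pol_O.abs_eq_iff generated_ideal_relation)

lemma u_row_orthogonal:
  fixes i j :: "'n::finite"
  shows "(\<Sum>k\<in>UNIV. u i k * u j k) = (if i = j then 1 else 0)"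
proof -
  have "abs_pol_O ((\<Sum>k\<in>UNIV. free_gen (i, k) * free_gen (j, k)) - (if i = j then 1 else 0)) = 0"
    by (rule abs_pol_O_relation) (auto simp: orthogonality_relations_def)
  then show ?thesis
    by (simp add: minus_pol_O.abs_eq[symmetric] abs_pol_O_sum times_pol_O.abs_eq[symmetric]
        u.abs_eq[symmetric] one_pol_O.abs_eq[symmetric] zero_pol_O.abs_eq[symmetric] split: if_splits)
qed

lemma u_col_orthogonal:
  fixes i j :: "'n::finite"
  shows "(\<Sum>k\<in>UNIV. u k i * u k j) = (if i = j then 1 else 0)"
proof -
  have "abs_pol_O ((\<Sum>k\<in>UNIV. free_gen (k, i) * free_gen (k, j)) - (if i = j then 1 else 0)) = 0"
    by (rule abs_pol_O_relation) (auto simp: orthogonality_relations_def)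
  then show ?thesis
    by (simp add: minus_pol_O.abs_eq[symmetric] abs_pol_O_sum times_pol_O.abs_eq[symmetric]
        u.abs_eq[symmetric] one_pol_O.abs_eq[symmetric] zero_pol_O.abs_eq[symmetric] split: if_splits)
qed

theorem pol_O_universal:
  fixes v :: "'n::finite \<Rightarrow> 'n \<Rightarrow> 'b::complex_star_algebra"
  assumes sa: "\<And>i j. star (v i j) = v i j"
    and row: "\<And>i j. (\<Sum>k\<in>UNIV. v i k * v j k) = (if i = j then 1 else 0)"
    and col: "\<And>i j. (\<Sum>k\<in>UNIV. v k i * v k j) = (if i = j then 1 else 0)"
  shows "\<exists>!f. unital_star_hom f \<and> (\<forall>i j. f (u i j) = v i j)"
proof -
  define p where "p w = prod_list (map (\<lambda>(i, j). v i j) (letters w))" for w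
  define g where "g = malg_extend p"
  have p_add: "p (a + b) = p a * p b" for a b
    by (simp add: p_def plus_free_monoid_def)
  have p_star: "p (minv a) = star (p a)" for a
  proof -
    have "prod_list (map (\<lambda>(i, j). v i j) (rev l)) = star (prod_list (map (\<lambda>(i, j). v i j) l))" for l
      by (induction l) (auto simp: star_one star_mult sa)
    then show ?thesis by (simp add: p_def minv_free_monoid_def)
  qed
  have p0: "p 0 = 1" by (simp add: p_def zero_free_monoid_def)
  have g_mult: "g (x * y) = g x * g y" for x y
    unfolding g_def by (rule malg_extend_mult) (rule p_add)
  have g_star: "g (malg_star x) = star (g x)" for x
    unfolding g_def by (rule malg_extend_star) (rule p_star)
  have g_gen: "g (free_gen (i, j)) = v i j" for i j
    by (simp add: g_def malg_extend_single p_def scaleC_one)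
  have g_one: "g 1 = 1" by (simp add: g_def malg_extend_one p0)
  have g_zero: "g 0 = 0" by (simp add: g_def malg_extend_zero)
  have g_add: "g (x + y) = g x + g y" for x y by (simp add: g_def malg_extend_add)
  have g_minus: "g (x - y) = g x - g y" for x y by (simp add: g_def malg_extend_minus)
  have g_scale: "g (malg_scale c x) = c *\<^sub>C g x" for c x by (simp add: g_def malg_extend_scale)
  have g_sum: "g (sum F A) = (\<Sum>k\<in>A. g (F k))" for F and A :: "'n set"
    by (simp add: g_def malg_extend_sum)
  have rel: "g r = 0" if "r \<in> orthogonality_relations" for r
  proof -
    have "g (if i = j then 1 else 0) = (if i = j then 1 else 0)" for i j :: 'n
      by (simp add: g_one g_zero)
    with that show ?thesis
      unfolding orthogonality_relations_def
      by (auto simp only: Un_iff mem_Collect_eq g_minus g_sum g_mult g_gen row col diff_self)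
  qed
  have null: "g x = 0" if "x \<in> generated_ideal orthogonality_relations" for x
    using that by induction (auto simp: g_zero g_add g_mult rel)
  define f where "f t = g (rep_pol_O t)" for t
  have f_abs: "f (abs_pol_O x) = g x" for x
  proof -
    have "rep_pol_O (abs_pol_O x) - x \<in> generated_ideal orthogonality_relations"
      using Quotient_rep_abs[OF Quotient_pol_O, of x] by (simp add: generated_ideal.zero)
    from null[OF this] show ?thesis by (simp add: f_def g_minus)
  qed
  show ?thesis
  proof (rule ex1I[of _ f])
    have "f (x + y) = f x + f y" for x y
      by (induct x rule: pol_O.abs_induct, induct y rule: pol_O.abs_induct) (simp add: plus_pol_O.abs_eq f_abs g_add)
    moreover have "f (x * y) = f x * f y" for x y
      by (induct x rule: pol_O.abs_induct, induct y rule: pol_O.abs_induct) (simp add: times_pol_O.abs_eq f_abs g_mult)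
    moreover have "f (c *\<^sub>C x) = c *\<^sub>C f x" for c x
      by (induct x rule: pol_O.abs_induct) (simp add: scaleC_pol_O.abs_eq f_abs g_scale)
    moreover have "f (star x) = star (f x)" for x
      by (induct x rule: pol_O.abs_induct) (simp add: star_pol_O.abs_eq f_abs g_star)
    moreover have "f 1 = 1" by (simp add: one_pol_O.abs_eq f_abs g_one)
    moreover have "f (u i j) = v i j" for i j
      by (simp add: u.abs_eq f_abs g_gen)
    ultimately show "unital_star_hom f \<and> (\<forall>i j. f (u i j) = v i j)"
      by (simp add: unital_star_hom_def clinear_map_def)
  next
    fix f' assume f': "unital_star_hom f' \<and> (\<forall>i j. f' (u i j) = v i j)"
    have word: "f' (abs_pol_O (Poly_Mapping.single (Word l) 1)) = p (Word l)" for l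
    proof (induction l)
      case Nil
      show ?case using f' p0
        by (simp add: unital_star_hom_def one_pol_O.abs_eq flip: single_one zero_free_monoid_def)
    next
      case (Cons a l)
      obtain i j where a: "a = (i, j)" by (cases a)
      have "Poly_Mapping.single (Word (a # l)) 1 = free_gen a * Poly_Mapping.single (Word l) 1"
        by (simp add: mult_single plus_free_monoid_def)
      then have "abs_pol_O (Poly_Mapping.single (Word (a # l)) 1)
          = u i j * abs_pol_O (Poly_Mapping.single (Word l) 1)"
        by (simp add: a u.abs_eq times_pol_O.abs_eq)
      then show ?case using f' Cons by (simp add: unital_star_hom_def p_def a)
    qed
    have "f' (abs_pol_O x) = g x" for x
    proof (induction x rule: pm_induct)
      case zero
      have "f' (0 + 0) = f' 0 + f' 0"
        using f' unfolding unital_star_hom_def clinear_map_def by blast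
      then show ?case by (simp add: g_zero flip: zero_pol_O.abs_eq)
    next
      case (add x k c)
      obtain l where k: "k = Word l" by (cases k)
      have "Poly_Mapping.single k c = malg_scale c (Poly_Mapping.single (Word l) 1)"
        by (simp add: k malg_scale_single)
      then have "abs_pol_O (x + Poly_Mapping.single k c)
          = abs_pol_O x + c *\<^sub>C abs_pol_O (Poly_Mapping.single (Word l) 1)"
        by (simp add: plus_pol_O.abs_eq scaleC_pol_O.abs_eq)
      then show ?case
        using add f' word
        by (simp add: unital_star_hom_def clinear_map_def g_add)
           (simp add: g_def malg_extend_single k)
    qed
    then have "f' x = f x" for x
      by (induct x rule: pol_O.abs_induct) (simp add: f_abs)
    then show "f' = f" by (rule ext)
  qed
qed

definition counit :: "'n::finite pol_O \<Rightarrow> complex" where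
  "counit = (THE f. unital_star_hom f \<and> (\<forall>i j. f (u i j) = (if i = j then 1 else 0)))"

definition eps_alt :: "'n::finite pol_O \<Rightarrow> complex" where
  "eps_alt = (THE f. unital_star_hom f \<and> (\<forall>i j. f (u i j) = (if i = j then - 1 else 0)))"

definition comult :: "'n::finite pol_O \<Rightarrow> ('n pol_O, 'n pol_O) tensor" where
  "comult = (THE f. unital_star_hom f \<and> (\<forall>i j. f (u i j) = (\<Sum>k\<in>UNIV. u i k \<otimes>\<^sub>t u k j)))"

lemma scalar_hom:
  fixes d :: complex
  assumes "d * d = 1" "cnj d = d"
  shows "\<exists>!f :: 'n::finite pol_O \<Rightarrow> complex.
      unital_star_hom f \<and> (\<forall>i j. f (u i j) = (if i = j then d else 0))"
proof (rule pol_O_universal)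
  fix i j :: 'n
  show "star (if i = j then d else 0) = (if i = j then d else 0)"
    using assms by (simp add: star_complex_def)
  have "(if i = k then d else 0) * (if j = k then d else 0)
      = (if k = i then if i = j then 1 else 0 else 0)"
    "(if k = i then d else 0) * (if k = j then d else 0)
      = (if k = i then if i = j then 1 else 0 else 0)" for k
    using assms by auto
  then show "(\<Sum>k\<in>UNIV. (if i = k then d else 0) * (if j = k then d else 0))
      = (if i = j then 1 else 0)"
    "(\<Sum>k\<in>UNIV. (if k = i then d else 0) * (if k = j then d else 0))
      = (if i = j then 1 else 0)"
    by (simp_all only: sum.delta finite UNIV_I if_True)
qed

lemma counit:
  shows "unital_star_hom (counit :: 'n::finite pol_O \<Rightarrow> complex)"
    and "counit (u i j :: 'n pol_O) = (if i = j then 1 else 0)"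
  using theI'[OF scalar_hom[where 'n = 'n and d = 1], folded counit_def] by simp_all

lemma eps_alt:
  shows "unital_star_hom (eps_alt :: 'n::finite pol_O \<Rightarrow> complex)"
    and "eps_alt (u i j :: 'n pol_O) = (if i = j then - 1 else 0)"
  using theI'[OF scalar_hom[where 'n = 'n and d = "- 1"], folded eps_alt_def] by simp_all

lemma tensor_of_sum_left: "(\<Sum>k\<in>A. f k) \<otimes>\<^sub>t b = (\<Sum>k\<in>A. f k \<otimes>\<^sub>t b)"
  by (induction A rule: infinite_finite_induct) (auto simp: tensor_of_zero_left tensor_of_add_left)

lemma tensor_of_sum_right: "a \<otimes>\<^sub>t (\<Sum>k\<in>A. f k) = (\<Sum>k\<in>A. a \<otimes>\<^sub>t f k)"
  by (induction A rule: infinite_finite_induct) (auto simp: tensor_of_zero_right tensor_of_add_right)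

lemma comult:
  shows "unital_star_hom (comult :: 'n::finite pol_O \<Rightarrow> _)"
    and "comult (u i j :: 'n pol_O) = (\<Sum>k\<in>UNIV. u i k \<otimes>\<^sub>t u k j)"
proof -
  define v :: "'n \<Rightarrow> 'n \<Rightarrow> ('n pol_O, 'n pol_O) tensor"
    where "v i j = (\<Sum>k\<in>UNIV. u i k \<otimes>\<^sub>t u k j)" for i j
  have sa: "star (v i j) = v i j" for i j
    by (simp add: v_def star_sum star_tensor_of star_u)
  have if_tensor: "(if P then 1 else 0) \<otimes>\<^sub>t (b :: 'n pol_O) = (if P then 1 \<otimes>\<^sub>t b else 0)"
    "(b :: 'n pol_O) \<otimes>\<^sub>t (if P then 1 else 0) = (if P then b \<otimes>\<^sub>t 1 else 0)"
    for P and b by (auto simp: tensor_of_zero_left tensor_of_zero_right)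
  have row: "(\<Sum>k\<in>UNIV. v i k * v j k) = (if i = j then 1 else 0)" for i j
  proof -
    have "(\<Sum>k\<in>UNIV. v i k * v j k)
        = (\<Sum>k\<in>UNIV. \<Sum>l\<in>UNIV. \<Sum>m\<in>UNIV. (u i l * u j m) \<otimes>\<^sub>t (u l k * u m k))"
      by (simp add: v_def sum_product tensor_of_mult)
    also have "\<dots> = (\<Sum>l\<in>UNIV. \<Sum>k\<in>UNIV. \<Sum>m\<in>UNIV. (u i l * u j m) \<otimes>\<^sub>t (u l k * u m k))"
      by (rule sum.swap)
    also have "\<dots> = (\<Sum>l\<in>UNIV. \<Sum>m\<in>UNIV. \<Sum>k\<in>UNIV. (u i l * u j m) \<otimes>\<^sub>t (u l k * u m k))"
      by (rule sum.cong[OF refl], rule sum.swap)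
    also have "\<dots> = (\<Sum>l\<in>UNIV. (u i l * u j l) \<otimes>\<^sub>t 1)"
      by (simp add: u_row_orthogonal if_tensor flip: tensor_of_sum_right)
    also have "\<dots> = (if i = j then 1 else 0)"
      by (simp add: u_row_orthogonal tensor_of_one tensor_of_zero_left flip: tensor_of_sum_left)
    finally show ?thesis .
  qed
  have col: "(\<Sum>k\<in>UNIV. v k i * v k j) = (if i = j then 1 else 0)" for i j
  proof -
    have "(\<Sum>k\<in>UNIV. v k i * v k j)
        = (\<Sum>k\<in>UNIV. \<Sum>l\<in>UNIV. \<Sum>m\<in>UNIV. (u k l * u k m) \<otimes>\<^sub>t (u l i * u m j))"
      by (simp add: v_def sum_product tensor_of_mult)
    also have "\<dots> = (\<Sum>l\<in>UNIV. \<Sum>k\<in>UNIV. \<Sum>m\<in>UNIV. (u k l * u k m) \<otimes>\<^sub>t (u l i * u m j))"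
      by (rule sum.swap)
    also have "\<dots> = (\<Sum>l\<in>UNIV. \<Sum>m\<in>UNIV. \<Sum>k\<in>UNIV. (u k l * u k m) \<otimes>\<^sub>t (u l i * u m j))"
      by (rule sum.cong[OF refl], rule sum.swap)
    also have "\<dots> = (\<Sum>l\<in>UNIV. 1 \<otimes>\<^sub>t (u l i * u l j))"
      by (simp add: u_col_orthogonal if_tensor flip: tensor_of_sum_left)
    also have "\<dots> = (if i = j then 1 else 0)"
      by (simp add: u_col_orthogonal tensor_of_one tensor_of_zero_right flip: tensor_of_sum_right)
    finally show ?thesis .
  qed
  have "\<exists>!f. unital_star_hom f \<and> (\<forall>i j. f (u i j) = v i j)"
    by (rule pol_O_universal) (fact sa row col)+
  from theI'[OF this, unfolded v_def, folded comult_def]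
  show "unital_star_hom (comult :: 'n pol_O \<Rightarrow> _)" "comult (u i j) = (\<Sum>k\<in>UNIV. u i k \<otimes>\<^sub>t u k j)"
    by auto
qed

instance pol_O :: (finite) ring_1
proof
  have "counit (1 :: 'a pol_O) = 1"
    and "\<And>x y :: 'a pol_O. counit (x + y) = counit x + counit y"
    using counit(1)[where 'n = 'a] unfolding unital_star_hom_def clinear_map_def by blast+
  from this(1) this(2)[of 0 0]
  show "(0 :: 'a pol_O) \<noteq> 1" by auto
qed

section \<open>Finite-dimensional representations\<close>

text \<open>A representation \<open>U\<close> is irreducible if its only self-intertwiners are the scalars. A system
  of representatives is a set of matrices (of varying sizes) over the algebra.\<close>

definition representation :: "'n::finite pol_O mat \<Rightarrow> bool" where
  "representation U \<longleftrightarrow> 0 < dim_row U \<and> dim_col U = dim_row U \<and>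
     (\<forall>i<dim_row U. \<forall>j<dim_row U.
        comult (U $$ (i, j)) = (\<Sum>k<dim_row U. (U $$ (i, k)) \<otimes>\<^sub>t (U $$ (k, j))))"

definition mat_star :: "'n::finite pol_O mat \<Rightarrow> 'n pol_O mat" where
  "mat_star U = mat (dim_col U) (dim_row U) (\<lambda>(i, j). star (U $$ (j, i)))"

definition unitary_representation :: "'n::finite pol_O mat \<Rightarrow> bool" where
  "unitary_representation U \<longleftrightarrow> representation U \<and>
     U * mat_star U = 1\<^sub>m (dim_row U) \<and> mat_star U * U = 1\<^sub>m (dim_row U)"

abbreviation scalar_mat :: "complex mat \<Rightarrow> 'n::finite pol_O mat" where
  "scalar_mat T \<equiv> map_mat (\<lambda>c. c *\<^sub>C 1) T"

definition intertwiners :: "'n::finite pol_O mat \<Rightarrow> 'n pol_O mat \<Rightarrow> complex mat set" where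
  "intertwiners U V =
     {T \<in> carrier_mat (dim_row V) (dim_row U). scalar_mat T * U = V * scalar_mat T}"

definition irreducible_representation :: "'n::finite pol_O mat \<Rightarrow> bool" where
  "irreducible_representation U \<longleftrightarrow> representation U \<and>
     intertwiners U U = {c \<cdot>\<^sub>m 1\<^sub>m (dim_row U) | c. True}"

definition equivalent_representations :: "'n::finite pol_O mat \<Rightarrow> 'n pol_O mat \<Rightarrow> bool" where
  "equivalent_representations U V \<longleftrightarrow> (\<exists>T\<in>intertwiners U V. invertible_mat T)"

text \<open>\<open>irr_representatives \<U>\<close>: the set \<open>\<U>\<close> consists of one unitary representative
  \<open>U\<^sup>\<alpha>\<close> for each equivalence class \<open>\<alpha>\<close> of irreducible unitary representations.\<close>

definition irr_representatives :: "'n::finite pol_O mat set \<Rightarrow> bool" where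
  "irr_representatives \<U> \<longleftrightarrow>
     (\<forall>U\<in>\<U>. unitary_representation U \<and> irreducible_representation U) \<and>
     (\<forall>V. unitary_representation V \<and> irreducible_representation V \<longrightarrow>
        (\<exists>!U. U \<in> \<U> \<and> equivalent_representations U V))"

section \<open>States\<close>

definition state :: "('a::complex_star_algebra \<Rightarrow> complex) \<Rightarrow> bool" where
  "state \<phi> \<longleftrightarrow> clinear_map \<phi> \<and> \<phi> 1 = 1 \<and> (\<forall>x. \<phi> (star x * x) \<in> \<real>\<^sub>\<ge>\<^sub>0)"

definition tracial :: "('a::complex_star_algebra \<Rightarrow> complex) \<Rightarrow> bool" where
  "tracial \<phi> \<longleftrightarrow> (\<forall>a b. \<phi> (a * b) = \<phi> (b * a))"

definition central :: "'n::finite pol_O mat set \<Rightarrow> ('n pol_O \<Rightarrow> complex) \<Rightarrow> bool" where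
  "central \<U> \<phi> \<longleftrightarrow> (\<forall>U\<in>\<U>. \<exists>c. \<forall>i<dim_row U. \<forall>j<dim_row U.
     \<phi> (U $$ (i, j)) = (if i = j then c else 0))"

text \<open>The trivial representation is the \<open>1 \<times> 1\<close> matrix with entry \<open>1\<close>. Since the coefficients of
  the representatives form a linear basis of the algebra, the following determines \<open>h\<close>.\<close>

definition haar_state :: "'n::finite pol_O mat set \<Rightarrow> ('n pol_O \<Rightarrow> complex) \<Rightarrow> bool" where
  "haar_state \<U> h \<longleftrightarrow> state h \<and>
     (\<forall>U\<in>\<U>. \<not> equivalent_representations U (1\<^sub>m 1) \<longrightarrow>
        (\<forall>i<dim_row U. \<forall>j<dim_row U. h (U $$ (i, j)) = 0))"

end

theory Submission
  imports Defs
begin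

text \<open>
  The Jones--Wenzl projection onto the tensors killed by all contractions of neighbouring legs has an
  explicit recursive kernel, built from creation operators. Its range carries a unitary
  representation, and this representation is irreducible because every matrix unit is
  a functional on the algebra: these functionals come from a Fock-type module, a copy of the
  regular representation. A central functional therefore acts on the contraction-free tensors of
  degree \<open>n\<close> as a scalar \<open>c\<^sub>n\<close>, and the sequence of scalars determines the functional. Comparing
  the alternating word \<open>x r x\<close> with its rotation \<open>x x r\<close>, whose contraction is \<open>r\<close>, a trace must satisfy
  \<open>c\<^sub>n\<^sub>+\<^sub>2 = c\<^sub>n\<close> for \<open>n \<ge> 1\<close>. This leaves the three parameters of the claim, since the scalars are
  \<open>1\<close> for the counit, \<open>(-1)\<^sup>n\<close> for the alternating character and \<open>0\<close> for the Haar state when \<open>n \<ge> 1\<close>.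
  Positivity of the first two coefficients follows by testing on products \<open>x\<close> of diagonal generators
  along alternating words, for which \<open>h (x\<^sup>* x)\<close> decays geometrically, and of the third by testing
  on an off-diagonal generator.
\<close>

section \<open>Scalar arithmetic in star-algebras\<close>

lemma scaleC_complex_eq [simp]: "c *\<^sub>C (x::complex) = c * x"
  by (simp add: scaleC_complex_def)

lemma star_complex_eq [simp]: "star (x::complex) = cnj x"
  by (simp add: star_complex_def)

context complex_star_algebra
begin

lemma scaleC_minus_right: "c *\<^sub>C (- x) = - (c *\<^sub>C x)"
  using scaleC_add_right[of c x "- x"] scaleC_zero_right[of c]
  by (simp add: eq_neg_iff_add_eq_0 add.commute)

lemma scaleC_diff_right: "c *\<^sub>C (x - y) = c *\<^sub>C x - c *\<^sub>C y"
  using scaleC_add_right[of c x "- y"] by (simp add: scaleC_minus_right)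

lemma scaleC_diff_left: "(c - d) *\<^sub>C x = c *\<^sub>C x - d *\<^sub>C x"
  using scaleC_add_left[of c "- d" x] by (simp add: scaleC_minus_left)

lemma scaleC_sum_left: "(\<Sum>i\<in>A. f i) *\<^sub>C x = (\<Sum>i\<in>A. f i *\<^sub>C x)"
  by (induction A rule: infinite_finite_induct) (auto simp: scaleC_zero_left scaleC_add_left)

end

subsection \<open>Words and contractions\<close>

definition words :: "nat \<Rightarrow> 'n list set" where
  "words n = {w. length w = n}"

lemma in_words [simp]: "w \<in> words n \<longleftrightarrow> length w = n"
  by (simp add: words_def)

lemma finite_words [simp]: "finite (words n :: 'n::finite list set)"
  using finite_lists_length_eq[of "UNIV :: 'n set" n] by (simp add: words_def)

lemma words_0: "words 0 = {[]}"
  by (auto simp: words_def)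

lemma sum_words_Suc:
  fixes f :: "'n::finite list \<Rightarrow> 'a::comm_monoid_add"
  shows "(\<Sum>w\<in>words (Suc n). f w) = (\<Sum>k\<in>UNIV. \<Sum>w\<in>words n. f (k # w))"
proof -
  have "(\<Sum>w\<in>words (Suc n). f w) = (\<Sum>(k, w)\<in>UNIV \<times> words n. f (k # w))"
    by (rule sum.reindex_bij_witness[where i = "\<lambda>(k, w). k # w" and j = "\<lambda>w. (hd w, tl w)"])
       (auto simp: length_Suc_conv)
  then show ?thesis by (simp add: sum.cartesian_product)
qed

text \<open>Words of all lengths are treated at once, so \<open>F\<close> may carry tensors of
  several degrees. The values need not be scalars: algebra-valued tensors such as
  \<open>vcol c\<close> below are included.\<close>

definition capfree :: "('n::finite list \<Rightarrow> 'a::ab_group_add) \<Rightarrow> bool" where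
  "capfree F \<longleftrightarrow> (\<forall>v w. (\<Sum>k\<in>UNIV. F (v @ k # k # w)) = 0)"

lemma capfreeD: "capfree F \<Longrightarrow> (\<Sum>k\<in>UNIV. F (v @ k # k # w)) = 0"
  by (simp add: capfree_def)

lemma capfreeD_Nil: "capfree F \<Longrightarrow> (\<Sum>k\<in>UNIV. F (k # k # w)) = 0"
  using capfreeD[of F "[]" w] by simp

lemma capfree_Cons: "capfree F \<Longrightarrow> capfree (\<lambda>w. F (k # w))"
  using capfreeD[of F "k # _"] by (simp add: capfree_def)

lemma capfree_sum: "(\<And>i. i \<in> A \<Longrightarrow> capfree (F i)) \<Longrightarrow> capfree (\<lambda>w. \<Sum>i\<in>A. F i w)"
  unfolding capfree_def by (subst sum.swap) simp

lemma capfree_add: "capfree F \<Longrightarrow> capfree G \<Longrightarrow> capfree (\<lambda>w. F w + G w)"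
  unfolding capfree_def by (simp add: sum.distrib)

lemma capfree_mult_left: "capfree (F :: _ \<Rightarrow> 'a::ring) \<Longrightarrow> capfree (\<lambda>w. c * F w)"
  unfolding capfree_def by (simp flip: sum_distrib_left)

lemma capfree_mult_right: "capfree (F :: _ \<Rightarrow> 'a::ring) \<Longrightarrow> capfree (\<lambda>w. F w * c)"
  unfolding capfree_def by (simp flip: sum_distrib_right)

subsection \<open>Creation operators\<close>

text \<open>The coefficients of the Jones--Wenzl recursion; \<open>jw N n\<close> is the ratio of the quantum
  dimensions of levels \<open>n - 1\<close> and \<open>n\<close>.\<close>

fun jw :: "nat \<Rightarrow> nat \<Rightarrow> real" where
  "jw N 0 = 0"
| "jw N (Suc n) = 1 / (real N - jw N n)"

lemma jw_bounds: "2 \<le> N \<Longrightarrow> 0 \<le> jw N n \<and> jw N n < 1"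
proof (induction n)
  case (Suc n)
  then have "1 < real N - jw N n" by linarith
  then show ?case by simp
qed simp

lemma jw_Suc: "2 \<le> N \<Longrightarrow> jw N (Suc n) * (real N - jw N n) = 1"
  using jw_bounds[of N n] by simp

declare jw.simps(2) [simp del]

text \<open>Compression of \<open>e\<^sub>j \<otimes> F\<close> to the contraction-free tensors. Writing \<open>A\<^sub>i\<close> for the contraction
  of the first leg with \<open>e\<^sub>i\<close>, the recursion reads \<open>A\<^sub>i C\<^sub>j + \<lambda> C\<^sub>i A\<^sub>j = \<delta>\<^sub>i\<^sub>j\<close>.\<close>

fun creation :: "'n::finite \<Rightarrow> ('n list \<Rightarrow> 'a::complex_star_algebra) \<Rightarrow> 'n list \<Rightarrow> 'a" where
  "creation j F [] = 0"
| "creation j F (i # w) = (if i = j then F w else 0)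
     - of_real (jw (card (UNIV :: 'n set)) (length w)) *\<^sub>C creation i (\<lambda>v. F (j # v)) w"

lemma creation_cong:
  "(\<And>v. Suc (length v) = length w \<Longrightarrow> F v = G v) \<Longrightarrow> creation j F w = creation j G w"
proof (induction w arbitrary: j F G)
  case (Cons i w)
  have "creation i (\<lambda>v. F (j # v)) w = creation i (\<lambda>v. G (j # v)) w"
    by (rule Cons.IH) (simp add: Cons.prems)
  then show ?case by (simp add: Cons.prems)
qed simp

lemma creation_zero: "creation j (\<lambda>_. 0) w = 0"
  by (induction w arbitrary: j) (auto simp: scaleC_zero_right)

lemma creation_zeroI: "(\<And>v. Suc (length v) = length w \<Longrightarrow> F v = 0) \<Longrightarrow> creation j F w = 0"
  using creation_cong[of w F "\<lambda>_. 0"] by (simp add: creation_zero)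

lemma creation_add: "creation j (\<lambda>v. F v + G v) w = creation j F w + creation j G w"
  by (induction w arbitrary: j F G) (auto simp: scaleC_add_right)

lemma creation_scale: "creation j (\<lambda>v. c *\<^sub>C F v) w = c *\<^sub>C creation j F w"
  by (induction w arbitrary: j F)
     (auto simp: scaleC_zero_right scaleC_minus_right scaleC_diff_right scaleC_scaleC mult.commute)

lemma creation_sum: "creation j (\<lambda>v. \<Sum>i\<in>A. F i v) w = (\<Sum>i\<in>A. creation j (F i) w)"
  by (induction A rule: infinite_finite_induct) (auto simp: creation_zero creation_add)

lemma creation_vec: "creation j (\<lambda>v. g v *\<^sub>C x) w = creation j g w *\<^sub>C x"
  by (induction w arbitrary: j g)
     (auto simp: scaleC_zero_left scaleC_diff_left scaleC_minus_left scaleC_scaleC)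

text \<open>For \<open>act\<close>, which creates a leg in each of two words: operators on different
  variables commute, since each is linear in its argument.\<close>

lemma creation_commute:
  fixes i j :: "'n::finite"
  shows "creation i (\<lambda>v. creation j (G v) w) v = creation j (\<lambda>w. creation i (\<lambda>v. G v w) v) w"
proof (induction v arbitrary: i G)
  case (Cons k v)
  let ?l = "- complex_of_real (jw (card (UNIV :: 'n set)) (length v))"
  have "creation j (\<lambda>w. creation i (\<lambda>v. G v w) (k # v)) w
      = creation j (\<lambda>w. (if k = i then G v w else 0) + ?l *\<^sub>C creation k (\<lambda>v. G (i # v) w) v) w"
    by (simp add: scaleC_minus_left)
  also have "\<dots> = (if k = i then creation j (G v) w else 0)
      + ?l *\<^sub>C creation k (\<lambda>v. creation j (G (i # v)) w) v"
    unfolding creation_add creation_scale Cons.IH by (simp add: creation_zero)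
  also have "\<dots> = creation i (\<lambda>v. creation j (G v) w) (k # v)"
    by (simp add: scaleC_minus_left)
  finally show ?case by simp
qed (simp add: creation_zero)

lemma creation_cnj: "cnj (creation j F w) = creation j (\<lambda>v. cnj (F v)) w"
  by (induction w arbitrary: j F) auto

text \<open>At a word starting with \<open>i\<close> the delta terms give \<open>F w\<close>, and
  the corrections add up to \<open>creation i\<close> of the contraction of the first two legs,
  which is zero. Thus the sum over k of \<open>C\<^sub>k A\<^sub>k\<close> is the identity in
  positive degree.\<close>

lemma sum_creation_contract:
  assumes "capfree F" "w \<noteq> []"
  shows "(\<Sum>k\<in>UNIV. creation k (\<lambda>v. F (k # v)) w) = F w"
proof -
  obtain i w' where w: "w = i # w'" using assms(2) by (cases w) auto
  have "(\<Sum>k\<in>UNIV. creation i (\<lambda>v. F (k # k # v)) w') = 0"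
    using assms(1) by (simp flip: creation_sum add: capfreeD_Nil creation_zero)
  then show ?thesis
    by (simp add: w sum_subtractf flip: scaleC_sum_right) (simp add: scaleC_zero_right)
qed

text \<open>Sum \<open>A\<^sub>k C\<^sub>k + \<lambda> C\<^sub>k A\<^sub>k = 1\<close> over k and
  apply the previous identity. That identity fails in degree 0, but there the coefficient
  \<open>jw N 0\<close> is 0.\<close>

lemma sum_annihilate_create:
  fixes F :: "'n::finite list \<Rightarrow> 'a::complex_star_algebra"
  assumes F: "capfree F"
  shows "(\<Sum>k\<in>UNIV. creation k F (k # w)) =
    of_real (real (card (UNIV :: 'n set)) - jw (card (UNIV :: 'n set)) (length w)) *\<^sub>C F w"
proof -
  let ?a = "complex_of_real (jw (card (UNIV :: 'n set)) (length w))"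
  have 1: "?a *\<^sub>C (\<Sum>k\<in>UNIV. creation k (\<lambda>v. F (k # v)) w) = ?a *\<^sub>C F w"
    using sum_creation_contract[OF F, of w] by (cases w) (simp_all add: scaleC_zero_left)
  have "(\<Sum>k\<in>UNIV. creation k F (k # w)) = (\<Sum>k\<in>(UNIV :: 'n set). 1 *\<^sub>C F w) - ?a *\<^sub>C F w"
    by (simp add: sum_subtractf scaleC_one 1 flip: scaleC_sum_right)
  also have "\<dots> = (of_nat (card (UNIV :: 'n set)) - ?a) *\<^sub>C F w"
    unfolding scaleC_sum_left[symmetric] by (simp add: scaleC_diff_left)
  finally show ?thesis unfolding of_real_diff of_real_of_nat_eq .
qed

text \<open>Contracting the first two legs of \<open>C\<^sub>j F\<close> leaves
  \<open>A\<^sub>j F\<close> with the factor 1 - \<open>jw N (Suc n) * (N - jw N n)\<close>, which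
  vanishes by the recursion for \<open>jw\<close>; this is what dictates the coefficients.
  Contractions further right follow by induction on the prefix.\<close>

lemma capfree_creation:
  fixes F :: "'n::finite list \<Rightarrow> 'a::complex_star_algebra"
  assumes N: "2 \<le> card (UNIV :: 'n set)" and F: "capfree F"
  shows "capfree (creation j F)"
proof -
  let ?N = "card (UNIV :: 'n set)"
  have "(\<Sum>k\<in>UNIV. creation j F (v @ k # k # w)) = 0" for v w
    using F
  proof (induction v arbitrary: j F)
    case Nil
    let ?G = "\<lambda>v. F (j # v)" and ?b = "complex_of_real (jw ?N (Suc (length w)))"
    have G: "capfree ?G" using Nil by (rule capfree_Cons)
    have "?b *\<^sub>C (\<Sum>k\<in>UNIV. creation k ?G (k # w))
        = of_real (jw ?N (Suc (length w)) * (real ?N - jw ?N (length w))) *\<^sub>C ?G w"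
      unfolding sum_annihilate_create[OF G] by (simp only: scaleC_scaleC of_real_mult)
    then have "?b *\<^sub>C (\<Sum>k\<in>UNIV. creation k ?G (k # w)) = ?G w"
      by (simp only: jw_Suc[OF N] of_real_1 scaleC_one)
    moreover have "(\<Sum>k\<in>UNIV. creation j F (k # k # w))
        = (\<Sum>k\<in>UNIV. (if k = j then F (k # w) else 0) - ?b *\<^sub>C creation k ?G (k # w))"
      by (rule sum.cong[OF refl]) (simp only: creation.simps(2)[of j F] list.size add_0_right add_Suc_right)
    then have "(\<Sum>k\<in>UNIV. creation j F (k # k # w))
        = ?G w - ?b *\<^sub>C (\<Sum>k\<in>UNIV. creation k ?G (k # w))"
      by (simp only: sum_subtractf scaleC_sum_right sum.delta finite UNIV_I if_True)
    ultimately show ?case by (simp only: append_Nil diff_self)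
  next
    case (Cons i v)
    show ?case
      using capfreeD[OF Cons.prems, of v w] Cons.IH[OF capfree_Cons[OF Cons.prems]]
      by (cases "i = j") (simp_all add: sum_subtractf sum_negf scaleC_zero_right flip: scaleC_sum_right)
  qed
  then show ?thesis by (simp add: capfree_def)
qed

text \<open>Dual to the preceding lemma: applying \<open>A\<^sub>i\<close> leaves
  \<open>C\<^sub>i F\<close> with the same kind of vanishing factor, one degree lower.\<close>

lemma sum_creation_creation:
  fixes F :: "'n::finite list \<Rightarrow> 'a::complex_star_algebra"
  assumes N: "2 \<le> card (UNIV :: 'n set)" and F: "capfree F"
  shows "(\<Sum>k\<in>UNIV. creation k (creation k F) w) = 0"
proof (cases w)
  case (Cons i w')
  let ?N = "card (UNIV :: 'n set)"
  let ?b = "complex_of_real (jw ?N (length w'))"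
  have "(\<Sum>k\<in>UNIV. creation k (creation k F) (i # w'))
      = (\<Sum>k\<in>UNIV. (if i = k then creation k F w' else 0)
          - ?b *\<^sub>C creation i (\<lambda>v. creation k F (k # v)) w')"
    by (rule sum.cong[OF refl], rule creation.simps(2))
  also have "\<dots> = creation i F w' - ?b *\<^sub>C creation i (\<lambda>v. \<Sum>k\<in>UNIV. creation k F (k # v)) w'"
    by (simp only: sum_subtractf creation_sum scaleC_sum_right sum.delta' finite UNIV_I if_True)
  \<comment> \<open>For empty \<open>w'\<close> the truncated subtraction does no harm, as
    \<open>creation i\<close> vanishes at the empty word.\<close>
  also have "creation i (\<lambda>v. \<Sum>k\<in>UNIV. creation k F (k # v)) w'
      = of_real (real ?N - jw ?N (length w' - 1)) *\<^sub>C creation i F w'"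
    unfolding creation_scale[symmetric] sum_annihilate_create[OF F]
  proof (rule creation_cong)
    fix v :: "'n list"
    assume "Suc (length v) = length w'"
    then have "length w' - 1 = length v" by linarith
    then show "of_real (real ?N - jw ?N (length v)) *\<^sub>C F v
        = of_real (real ?N - jw ?N (length w' - 1)) *\<^sub>C F v" by (simp only:)
  qed
  also have "creation i F w' - ?b *\<^sub>C \<dots> = 0"
  proof (cases w')
    case (Cons j x)
    have "complex_of_real (jw ?N (Suc (length x))) * of_real (real ?N - jw ?N (length x)) = 1"
      unfolding of_real_mult[symmetric] by (simp only: jw_Suc[OF N] of_real_1)
    then show ?thesis by (simp add: Cons scaleC_scaleC scaleC_one del: of_real_diff creation.simps)
  qed (simp add: scaleC_zero_right)
  finally show ?thesis using Cons by simp
qed simp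

subsection \<open>The Jones--Wenzl projections\<close>

definition vac :: "'n list \<Rightarrow> complex" where
  "vac w = (if w = [] then 1 else 0)"

text \<open>The kernel of the Jones-Wenzl projection. Column \<open>j\<close> is obtained from the
  vacuum by creating the letters of \<open>j\<close>, the last one first.\<close>

definition jwp :: "'n::finite list \<Rightarrow> 'n list \<Rightarrow> complex" where
  "jwp i j = foldr creation j vac i"

lemma jwp_Nil: "jwp i [] = (if i = [] then 1 else 0)"
  by (simp add: jwp_def vac_def)

lemma jwp_Cons: "jwp i (k # j) = creation k (\<lambda>x. jwp x j) i"
  by (simp add: jwp_def)

lemma capfree_vac: "capfree vac"
  by (simp add: capfree_def vac_def)

lemma capfree_jwp_left:
  assumes "2 \<le> card (UNIV :: 'n::finite set)"
  shows "capfree (\<lambda>i :: 'n list. jwp i j)"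
proof (induction j)
  case Nil
  show ?case using capfree_vac by (simp add: jwp_def)
next
  case (Cons k j)
  then show ?case unfolding jwp_Cons by (rule capfree_creation[OF assms])
qed

lemma foldr_creation_sum:
  "foldr creation v (\<lambda>x. \<Sum>k\<in>A. F k x) i = (\<Sum>k\<in>A. foldr creation v (F k) i)"
proof (induction v arbitrary: i)
  case (Cons a v)
  have "foldr creation v (\<lambda>x. \<Sum>k\<in>A. F k x) = (\<lambda>x. \<Sum>k\<in>A. foldr creation v (F k) x)"
    by (rule ext) (rule Cons.IH)
  then show ?case by (simp add: creation_sum)
qed simp

lemma foldr_creation_zero: "foldr creation v (\<lambda>_. 0) i = 0"
  using foldr_creation_sum[of v "\<lambda>_ _. 0" "{}" i] by simp

text \<open>Contracting two letters of the column index inserts the sum over k of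
  \<open>C\<^sub>k C\<^sub>k\<close> between the creations for \<open>v\<close> and those for
  \<open>w\<close>, and this sum kills contraction-free tensors.\<close>

lemma capfree_jwp_right:
  assumes "2 \<le> card (UNIV :: 'n::finite set)"
  shows "capfree (\<lambda>j :: 'n list. jwp i j)"
  unfolding capfree_def
proof (intro allI)
  fix v w :: "'n list"
  have "capfree (foldr creation w vac)"
    using capfree_jwp_left[OF assms, of w] by (simp add: jwp_def)
  then have "(\<lambda>x. \<Sum>k\<in>UNIV. creation k (creation k (foldr creation w vac)) x) = (\<lambda>_. 0)"
    using sum_creation_creation[OF assms] by blast
  then show "(\<Sum>k\<in>UNIV. jwp i (v @ k # k # w)) = 0"
    by (simp add: jwp_def foldr_creation_zero flip: foldr_creation_sum)
qed

lemma jwp_length: "length i \<noteq> length j \<Longrightarrow> jwp i j = 0"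
proof (induction j arbitrary: i)
  case (Cons k j)
  then show ?case unfolding jwp_Cons by (intro creation_zeroI) auto
qed (auto simp: jwp_Nil)

lemma jwp_cnj: "cnj (jwp i j) = jwp i j"
  by (induction j arbitrary: i) (simp_all add: jwp_Nil jwp_Cons creation_cnj)

text \<open>The kernel fixes every contraction-free tensor. Peeling off the first letter of
  \<open>j\<close>, the induction hypothesis turns the sum into that of
  \<open>C\<^sub>k A\<^sub>k F\<close> over k, which is \<open>F\<close>.\<close>

lemma jwp_expand:
  assumes "capfree F" "length i = n"
  shows "(\<Sum>j\<in>words n. jwp i j *\<^sub>C F j) = F i"
  using assms
proof (induction n arbitrary: F i)
  case 0
  then show ?case by (simp add: words_0 jwp_Nil scaleC_one)
next
  case (Suc n)
  have "(\<Sum>j\<in>words (Suc n). jwp i j *\<^sub>C F j)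
      = (\<Sum>k\<in>UNIV. creation k (\<lambda>x. \<Sum>w\<in>words n. jwp x w *\<^sub>C F (k # w)) i)"
    by (simp add: sum_words_Suc jwp_Cons creation_sum creation_vec)
  also have "\<dots> = (\<Sum>k\<in>UNIV. creation k (\<lambda>x. F (k # x)) i)"
    using Suc.prems(2)
    by (intro sum.cong refl creation_cong Suc.IH capfree_Cons Suc.prems(1)) simp
  also have "\<dots> = F i"
    using Suc.prems by (intro sum_creation_contract) auto
  finally show ?case .
qed

lemma jwp_idem:
  assumes "2 \<le> card (UNIV :: 'n::finite set)"
  shows "(\<Sum>k\<in>words (length i). jwp i k * jwp k j) = jwp (i :: 'n list) j"
  using jwp_expand[OF capfree_jwp_left[OF assms] refl, of i j] by simp

text \<open>The rows are contraction-free, hence fixed: writing P for the kernel, P times its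
  transpose equals the transpose of P. The product is symmetric.\<close>

lemma jwp_sym:
  assumes "2 \<le> card (UNIV :: 'n::finite set)"
  shows "jwp (i :: 'n list) j = jwp j i"
proof (cases "length i = length j")
  case True
  have "(\<Sum>k\<in>words (length i). jwp i k * jwp j k) = jwp j i"
    "(\<Sum>k\<in>words (length j). jwp j k * jwp i k) = jwp i j"
    using jwp_expand[OF capfree_jwp_right[OF assms] refl] by simp_all
  then show ?thesis using True by (simp add: mult.commute)
qed (simp add: jwp_length)

text \<open>No contraction meets a word without equal neighbours. This is the source of explicit
  test tensors below.\<close>

lemma capfree_vector:
  assumes "2 \<le> card (UNIV :: 'n::finite set)" "distinct_adj (w :: 'n list)"
  shows "capfree (\<lambda>i. if i = w then 1 else 0 :: complex)"
proof -
  have "v @ k # k # x \<noteq> w" for v k x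
    using assms(2) by (auto simp: distinct_adj_append_iff)
  then show ?thesis by (simp add: capfree_def)
qed

section \<open>An orthonormal basis for the range of a real symmetric idempotent\<close>

text \<open>Induction on the number of nonzero diagonal entries: a normalised nonzero column is
  split off as a rank-one projection.\<close>

lemma symmetric_projection_onb:
  fixes q :: "'i \<Rightarrow> 'i \<Rightarrow> real"
  assumes "finite I" and "\<And>i j. i \<in> I \<Longrightarrow> j \<in> I \<Longrightarrow> q i j = q j i"
    and "\<And>i j. i \<in> I \<Longrightarrow> j \<in> I \<Longrightarrow> (\<Sum>k\<in>I. q i k * q k j) = q i j"
  shows "\<exists>d b. (\<forall>a<d. \<forall>c<d. (\<Sum>i\<in>I. b a i * b c i) = (if a = c then 1 else 0))
    \<and> (\<forall>i\<in>I. \<forall>j\<in>I. q i j = (\<Sum>a<(d::nat). b a i * b a j))"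
  using assms(2,3)
proof (induction "card {i\<in>I. q i i \<noteq> 0}" arbitrary: q rule: less_induct)
  case less
  note sym = less.prems(1) and idem = less.prems(2)
  \<comment> \<open>Diagonal entries are squared row norms, so a zero on the diagonal kills its
    row.\<close>
  have sq: "q i i = (\<Sum>j\<in>I. (q i j)\<^sup>2)" if "i \<in> I" for i
    using idem[OF that that] sym[OF that] by (simp add: power2_eq_square)
  have row0: "q i j = 0" if "i \<in> I" "j \<in> I" "q i i = 0" for i j
    using sq[OF that(1)] that assms(1) by (simp add: sum_nonneg_eq_0_iff)
  show ?case
  proof (cases "\<forall>i\<in>I. q i i = 0")
    case True
    then show ?thesis using row0 by (intro exI[of _ 0]) auto
  next
    case False
    then obtain m where m: "m \<in> I" "q m m \<noteq> 0" by blast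
    have "0 \<le> q m m" using sq[OF m(1)] by (simp add: sum_nonneg)
    with m(2) have pos: "0 < q m m" by simp
    \<comment> \<open>Column \<open>m\<close> has squared norm \<open>q m m\<close>, so \<beta> is a
      unit vector in the range of \<open>q\<close>.\<close>
    define \<beta> where "\<beta> i = q i m / sqrt (q m m)" for i
    define q' where "q' i j = q i j - \<beta> i * \<beta> j" for i j
    have q\<beta>: "(\<Sum>k\<in>I. q i k * \<beta> k) = \<beta> i" if "i \<in> I" for i
      using idem[OF that m(1)] by (simp add: \<beta>_def flip: sum_divide_distrib)
    have \<beta>q: "(\<Sum>k\<in>I. \<beta> k * q k i) = \<beta> i" if "i \<in> I" for i
      using q\<beta>[OF that] sym[OF that] by (simp add: mult.commute)
    have \<beta>\<beta>: "(\<Sum>k\<in>I. \<beta> k * \<beta> k) = 1"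
      using sq[OF m(1)] sym[OF _ m(1)] pos
      by (simp add: \<beta>_def power2_eq_square flip: sum_divide_distrib)
    have sym': "q' i j = q' j i" if "i \<in> I" "j \<in> I" for i j
      using sym[OF that] by (simp add: q'_def)
    have idem': "(\<Sum>k\<in>I. q' i k * q' k j) = q' i j" if "i \<in> I" "j \<in> I" for i j
    proof -
      have "(\<Sum>k\<in>I. q' i k * q' k j) = (\<Sum>k\<in>I. q i k * q k j) - \<beta> j * (\<Sum>k\<in>I. q i k * \<beta> k)
          - \<beta> i * (\<Sum>k\<in>I. \<beta> k * q k j) + \<beta> i * \<beta> j * (\<Sum>k\<in>I. \<beta> k * \<beta> k)"
        unfolding sum_distrib_left sum.distrib[symmetric] sum_subtractf[symmetric]
        by (rule sum.cong) (auto simp: q'_def algebra_simps)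
      then show ?thesis using that by (simp add: idem q\<beta> \<beta>q \<beta>\<beta> q'_def)
    qed
    \<comment> \<open>\<beta> vanishes wherever the diagonal of \<open>q\<close> does, so no
      diagonal entry becomes nonzero, and the entry at \<open>m\<close> is cleared.\<close>
    have "{i\<in>I. q' i i \<noteq> 0} \<subset> {i\<in>I. q i i \<noteq> 0}"
    proof
      show "{i\<in>I. q' i i \<noteq> 0} \<subseteq> {i\<in>I. q i i \<noteq> 0}"
        using row0[OF _ m(1)] by (auto simp: q'_def \<beta>_def)
      have "q' m m = 0" using pos by (simp add: q'_def \<beta>_def)
      then show "{i\<in>I. q' i i \<noteq> 0} \<noteq> {i\<in>I. q i i \<noteq> 0}" using m by blast
    qed
    then have "card {i\<in>I. q' i i \<noteq> 0} < card {i\<in>I. q i i \<noteq> 0}"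
      using assms(1) by (intro psubset_card_mono) auto
    then have "\<exists>d b. (\<forall>a<d. \<forall>c<d. (\<Sum>i\<in>I. b a i * b c i) = (if a = c then 1 else 0))
        \<and> (\<forall>i\<in>I. \<forall>j\<in>I. q' i j = (\<Sum>a<(d::nat). b a i * b a j))"
      by (rule less.hyps) (rule sym' idem'; assumption)+
    then obtain d and b :: "nat \<Rightarrow> 'i \<Rightarrow> real" where
      on: "\<And>a c. a < d \<Longrightarrow> c < d \<Longrightarrow> (\<Sum>i\<in>I. b a i * b c i) = (if a = c then 1 else 0)" and
      q': "\<And>i j. i \<in> I \<Longrightarrow> j \<in> I \<Longrightarrow> q' i j = (\<Sum>a<d. b a i * b a j)"
      by blast
    \<comment> \<open>\<open>b a\<close> lies in the range of \<open>q'\<close>, while \<beta> lies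
      in its kernel.\<close>
    have orth: "(\<Sum>i\<in>I. b a i * \<beta> i) = 0" if a: "a < d" for a
    proof -
      have 1: "b a i = (\<Sum>j\<in>I. q' i j * b a j)" if "i \<in> I" for i
      proof -
        have "(\<Sum>j\<in>I. q' i j * b a j) = (\<Sum>j\<in>I. \<Sum>c<d. b c i * (b c j * b a j))"
          using that by (intro sum.cong) (auto simp: q' sum_distrib_right mult.assoc)
        also have "\<dots> = (\<Sum>c<d. b c i * (\<Sum>j\<in>I. b c j * b a j))"
          by (subst sum.swap) (simp add: sum_distrib_left)
        also have "\<dots> = b a i" using a by (simp add: on if_distrib cong: if_cong)
        finally show ?thesis by simp
      qed
      have 2: "(\<Sum>i\<in>I. q' i j * \<beta> i) = 0" if "j \<in> I" for j
      proof -
        have "(\<Sum>i\<in>I. q' i j * \<beta> i) = (\<Sum>i\<in>I. \<beta> i * q i j) - \<beta> j * (\<Sum>i\<in>I. \<beta> i * \<beta> i)"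
          unfolding sum_distrib_left sum_subtractf[symmetric]
          by (rule sum.cong) (auto simp: q'_def algebra_simps)
        then show ?thesis using that by (simp add: \<beta>q \<beta>\<beta>)
      qed
      have "(\<Sum>i\<in>I. b a i * \<beta> i) = (\<Sum>i\<in>I. \<Sum>j\<in>I. b a j * (q' i j * \<beta> i))"
        by (intro sum.cong refl, subst 1) (auto simp: sum_distrib_right sum_distrib_left mult_ac)
      also have "\<dots> = (\<Sum>j\<in>I. b a j * (\<Sum>i\<in>I. q' i j * \<beta> i))"
        by (subst sum.swap) (simp add: sum_distrib_left)
      also have "\<dots> = 0" using 2 by simp
      finally show ?thesis .
    qed
    let ?b = "\<lambda>a. if a = d then \<beta> else b a"
    have "(\<Sum>i\<in>I. ?b a i * ?b c i) = (if a = c then 1 else 0)" if "a < Suc d" "c < Suc d" for a c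
      using that on[of a c] orth[of a] orth[of c] \<beta>\<beta>
      by (auto simp: less_Suc_eq mult.commute)
    moreover have "q i j = (\<Sum>a<Suc d. ?b a i * ?b a j)" if "i \<in> I" "j \<in> I" for i j
    proof -
      have "(\<Sum>a<d. ?b a i * ?b a j) = q' i j" using that by (simp add: q')
      then show ?thesis by (simp add: q'_def)
    qed
    ultimately show ?thesis by (intro exI[of _ "Suc d"] exI[of _ ?b] conjI ballI allI impI)
  qed
qed

subsection \<open>Linear maps\<close>

lemma clinear_mapD:
  assumes "clinear_map f"
  shows "f (x + y) = f x + f y" "f (c *\<^sub>C x) = c *\<^sub>C f x"
  using assms by (auto simp: clinear_map_def)

lemma clinear_map_0: "clinear_map f \<Longrightarrow> f 0 = 0"
  using clinear_mapD(1)[of f 0 0] by simp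

lemma clinear_map_minus: "clinear_map f \<Longrightarrow> f (- x) = - f x"
  using clinear_mapD(1)[of f x "- x"] clinear_map_0[of f] by (simp add: eq_neg_iff_add_eq_0 add.commute)

lemma clinear_map_diff: "clinear_map f \<Longrightarrow> f (x - y) = f x - f y"
  using clinear_mapD(1)[of f x "- y"] clinear_map_minus[of f y] by simp

lemma clinear_map_sum: "clinear_map f \<Longrightarrow> f (\<Sum>i\<in>A. F i) = (\<Sum>i\<in>A. f (F i))"
  by (induction A rule: infinite_finite_induct) (auto simp: clinear_map_0 clinear_mapD(1))

lemma unital_star_homD:
  assumes "unital_star_hom f"
  shows "clinear_map f" "f 1 = 1" "f (x * y) = f x * f y" "f (star x) = star (f x)"
  using assms by (auto simp: unital_star_hom_def)

subsection \<open>Words in the generators\<close>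

text \<open>The value 0 at words of different lengths lets \<open>capfree\<close>, which quantifies
  over all words, apply to combinations of these entries.\<close>

definition uw :: "'n::finite list \<Rightarrow> 'n list \<Rightarrow> 'n pol_O" where
  "uw i j = (if length i = length j then prod_list (map2 u i j) else 0)"

lemma uw_Nil: "uw [] [] = 1"
  by (simp add: uw_def)

lemma uw_Cons: "uw (a # i) (b # j) = u a b * uw i j"
  by (simp add: uw_def)

lemma uw_length: "length i \<noteq> length j \<Longrightarrow> uw i j = 0"
  by (simp add: uw_def)

lemma uw_append:
  "length i = length j \<Longrightarrow> uw (i @ i') (j @ j') = uw i j * uw i' j'"
  by (simp add: uw_def)

lemma star_uw: "length i = length j \<Longrightarrow> star (uw i j) = uw (rev i) (rev j)"
proof (induction i j rule: list_induct2)
  case (Cons a i b j)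
  then show ?case
    by (simp add: uw_Cons star_mult star_u uw_append uw_Nil)
qed (simp add: uw_Nil star_one)

lemma abs_pol_O_word:
  "abs_pol_O (Poly_Mapping.single (Word l) 1) = uw (map fst l) (map snd l)"
proof (induction l)
  case Nil
  then show ?case
    by (simp add: uw_Nil one_pol_O.abs_eq flip: single_one zero_free_monoid_def)
next
  case (Cons a l)
  have "Poly_Mapping.single (Word (a # l)) (1 :: complex) = free_gen a * Poly_Mapping.single (Word l) 1"
    by (simp add: mult_single plus_free_monoid_def)
  then have "abs_pol_O (Poly_Mapping.single (Word (a # l)) 1)
      = u (fst a) (snd a) * abs_pol_O (Poly_Mapping.single (Word l) 1)"
    by (simp add: u.abs_eq times_pol_O.abs_eq)
  then show ?case using Cons by (simp add: uw_Cons)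
qed

text \<open>Every word in the generators is some \<open>uw i j\<close>, so these elements span the
  algebra.\<close>

lemma clinear_map_eq_0_uw:
  assumes f: "clinear_map f" and 0: "\<And>i j :: 'n::finite list. length i = length j \<Longrightarrow> f (uw i j) = 0"
  shows "f x = 0"
proof -
  have "f (abs_pol_O p) = 0" for p
  proof (induction p rule: pm_induct)
    case zero
    then show ?case using clinear_map_0[OF f] by (simp add: zero_pol_O.abs_eq)
  next
    case (add p k c)
    obtain l where k: "k = Word l" by (cases k)
    have "Poly_Mapping.single k c = malg_scale c (Poly_Mapping.single (Word l) 1)"
      by (simp add: k malg_scale_single)
    then have "abs_pol_O (p + Poly_Mapping.single k c)
        = abs_pol_O p + c *\<^sub>C uw (map fst l) (map snd l)"
      by (simp add: plus_pol_O.abs_eq scaleC_pol_O.abs_eq flip: abs_pol_O_word)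
    then show ?case using add 0 by (simp add: clinear_mapD[OF f] scaleC_zero_right)
  qed
  then show ?thesis by (induct x rule: pol_O.abs_induct)
qed

lemma uw_contract_cols:
  assumes "length i = length v" "length i' = length w"
  shows "(\<Sum>k\<in>UNIV. uw (i @ a # b # i') (v @ k # k # w)) = (if a = b then uw (i @ i') (v @ w) else 0)"
proof -
  have "(\<Sum>k\<in>UNIV. uw (i @ a # b # i') (v @ k # k # w))
      = uw i v * (\<Sum>k\<in>UNIV. u a k * u b k) * uw i' w"
    by (simp add: uw_append[OF assms(1)] uw_Cons sum_distrib_left sum_distrib_right mult.assoc)
  then show ?thesis by (simp add: u_row_orthogonal uw_append[OF assms(1)])
qed

lemma uw_contract_rows:
  assumes "length i = length v" "length i' = length w"
  shows "(\<Sum>k\<in>UNIV. uw (v @ k # k # w) (i @ a # b # i')) = (if a = b then uw (v @ w) (i @ i') else 0)"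
proof -
  have "(\<Sum>k\<in>UNIV. uw (v @ k # k # w) (i @ a # b # i'))
      = uw v i * (\<Sum>k\<in>UNIV. u k a * u k b) * uw w i'"
    by (simp add: uw_append assms uw_Cons sum_distrib_left sum_distrib_right mult.assoc)
  then show ?thesis by (simp add: u_col_orthogonal uw_append assms)
qed

lemma sum_words_append:
  fixes f :: "'n::finite list \<Rightarrow> 'a::comm_monoid_add"
  shows "(\<Sum>w\<in>words (m + n). f w) = (\<Sum>x\<in>words m. \<Sum>y\<in>words n. f (x @ y))"
  by (induction m arbitrary: f) (simp_all add: words_0 sum_words_Suc)

text \<open>Invariance of the contraction-free subspace under tensor powers of the fundamental
  representation: a contraction of row letters moves over to the column letters, where it meets
  \<xi>. The kernel \<open>G\<close> is abstract so as to cover both \<open>uw\<close> and its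
  transpose.\<close>

lemma capfree_transform:
  fixes G :: "'n::finite list \<Rightarrow> 'n list \<Rightarrow> 'a::complex_star_algebra"
  assumes len: "\<And>i j. length i \<noteq> length j \<Longrightarrow> G i j = 0"
    and contract: "\<And>i i' v w a b. length i = length v \<Longrightarrow> length i' = length w \<Longrightarrow>
      (\<Sum>k\<in>UNIV. G (v @ k # k # w) (i @ a # b # i')) = (if a = b then G (v @ w) (i @ i') else 0)"
    and \<xi>: "capfree \<xi>"
  shows "capfree (\<lambda>k. \<Sum>j\<in>words n. \<xi> j *\<^sub>C G k j)"
  unfolding capfree_def
proof (intro allI)
  fix v w :: "'n list"
  show "(\<Sum>k\<in>UNIV. \<Sum>j\<in>words n. \<xi> j *\<^sub>C G (v @ k # k # w) j) = 0"
  proof (cases "n = length v + Suc (Suc (length w))")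
    case True
    have "(\<Sum>k\<in>UNIV. \<Sum>j\<in>words n. \<xi> j *\<^sub>C G (v @ k # k # w) j)
        = (\<Sum>j\<in>words n. \<xi> j *\<^sub>C (\<Sum>k\<in>UNIV. G (v @ k # k # w) j))"
      by (subst sum.swap) (simp add: scaleC_sum_right)
    also have "\<dots> = (\<Sum>x\<in>words (length v). \<Sum>a\<in>UNIV. \<Sum>b\<in>UNIV. \<Sum>y\<in>words (length w).
        \<xi> (x @ a # b # y) *\<^sub>C (if a = b then G (v @ w) (x @ y) else 0))"
      unfolding True sum_words_append sum_words_Suc
      by (intro sum.cong refl) (simp add: contract)
    also have "\<dots> = (\<Sum>x\<in>words (length v). \<Sum>a\<in>UNIV. \<Sum>y\<in>words (length w). \<Sum>b\<in>UNIV.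
        \<xi> (x @ a # b # y) *\<^sub>C (if a = b then G (v @ w) (x @ y) else 0))"
      by (intro sum.cong refl) (rule sum.swap)
    also have "\<dots> = (\<Sum>x\<in>words (length v). \<Sum>a\<in>UNIV. \<Sum>y\<in>words (length w).
        \<xi> (x @ a # a # y) *\<^sub>C G (v @ w) (x @ y))"
      by (simp add: if_distrib[where f = "scaleC _"] scaleC_zero_right sum.delta' cong: if_cong)
    also have "\<dots> = (\<Sum>x\<in>words (length v). \<Sum>y\<in>words (length w).
        (\<Sum>a\<in>UNIV. \<xi> (x @ a # a # y)) *\<^sub>C G (v @ w) (x @ y))"
      unfolding scaleC_sum_left by (intro sum.cong refl) (rule sum.swap)
    also have "\<dots> = 0" by (simp add: capfreeD[OF \<xi>] scaleC_zero_left)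
    finally show ?thesis .
  next
    case False
    then have "G (v @ k # k # w) j = 0" if "j \<in> words n" for k j
      using that by (intro len) auto
    then show ?thesis by (simp add: scaleC_zero_right)
  qed
qed

lemmas capfree_uw_rows = capfree_transform[of uw, OF uw_length uw_contract_rows]
lemmas capfree_uw_cols =
  capfree_transform[of "\<lambda>i j. uw j i", OF uw_length[OF not_sym] uw_contract_cols]

section \<open>Coproduct and unitarity for tensor powers of the fundamental representation\<close>

lemma comult_uw:
  "length i = length j \<Longrightarrow> comult (uw i j) = (\<Sum>k\<in>words (length i). uw i k \<otimes>\<^sub>t uw k j)"
proof (induction i j rule: list_induct2)
  case Nil
  then show ?case using unital_star_homD(2)[OF comult(1)] by (simp add: uw_Nil words_0 tensor_of_one)
next
  case (Cons a i b j)
  have "comult (uw (a # i) (b # j)) = comult (u a b) * comult (uw i j)"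
    by (simp add: uw_Cons unital_star_homD(3)[OF comult(1)])
  then show ?case
    by (simp add: comult(2) Cons.IH sum_words_Suc uw_Cons sum_product tensor_of_mult)
qed

text \<open>The star reverses products, so the leading letters stay outermost: the induction
  hypothesis collapses the inside first, then row orthogonality applies.\<close>

lemma sum_uw_star_uw:
  "length i = length i' \<Longrightarrow>
    (\<Sum>j\<in>words (length i). uw i j * star (uw i' j)) = (if i = i' then 1 else 0)"
proof (induction i i' rule: list_induct2)
  case (Cons a i b i')
  have "(\<Sum>j\<in>words (length (a # i)). uw (a # i) j * star (uw (b # i') j))
      = (\<Sum>k\<in>UNIV. u a k * (\<Sum>j\<in>words (length i). uw i j * star (uw i' j)) * u b k)"
    by (simp add: sum_words_Suc uw_Cons star_mult star_u sum_distrib_left sum_distrib_right mult.assoc)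
  then show ?case by (simp add: Cons.IH u_row_orthogonal)
qed (simp add: words_0 uw_Nil star_one)

text \<open>Here the leading letters meet in the middle, so column orthogonality comes first and the
  induction hypothesis last.\<close>

lemma sum_star_uw_uw:
  "length i = length i' \<Longrightarrow>
    (\<Sum>j\<in>words (length i). star (uw j i) * uw j i') = (if i = i' then 1 else 0)"
proof (induction i i' rule: list_induct2)
  case (Cons a i b i')
  have "(\<Sum>j\<in>words (length (a # i)). star (uw j (a # i)) * uw j (b # i'))
      = (\<Sum>j\<in>words (length i). star (uw j i) * (\<Sum>k\<in>UNIV. u k a * u k b) * uw j i')"
    by (simp add: sum_words_Suc uw_Cons star_mult star_u sum_distrib_left sum_distrib_right mult.assoc)
       (rule sum.swap)
  also have "\<dots> = (if a = b then \<Sum>j\<in>words (length i). star (uw j i) * uw j i' else 0)"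
    by (simp add: u_col_orthogonal)
  also have "\<dots> = (if a # i = b # i' then 1 else 0)"
    by (simp only: Cons.IH list.inject) simp
  finally show ?case .
qed (simp add: words_0 uw_Nil star_one)

subsection \<open>Alternating words\<close>

fun altw :: "'n \<Rightarrow> 'n \<Rightarrow> nat \<Rightarrow> 'n list" where
  "altw a b 0 = []"
| "altw a b (Suc n) = a # altw b a n"

lemma length_altw [simp]: "length (altw a b n) = n"
  by (induction n arbitrary: a b) auto

lemma set_altw: "set (altw a b n) \<subseteq> {a, b}"
  by (induction n arbitrary: a b) fastforce+

lemma distinct_adj_altw [simp]: "a \<noteq> b \<Longrightarrow> distinct_adj (altw a b n)"
proof (induction n arbitrary: a b)
  case (Suc n)
  then show ?case by (cases n) (auto simp: distinct_adj_Cons)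
qed simp

lemma ex_two_letters: "2 \<le> card (UNIV :: 'n set) \<Longrightarrow> \<exists>a b :: 'n. a \<noteq> b"
  by (erule obtain_subset_with_card_n) (auto simp: card_2_iff)

lemma ex_three_letters:
  "3 \<le> card (UNIV :: 'n set) \<Longrightarrow> \<exists>a b c :: 'n. a \<noteq> b \<and> a \<noteq> c \<and> b \<noteq> c"
  by (erule obtain_subset_with_card_n) (auto simp: card_3_iff)

subsection \<open>The representation on a contraction-free subspace\<close>

text \<open>A real orthonormal basis of the contraction-free tensors of degree \<open>n\<close>;
  completeness is the factorisation \<open>jwp_B\<close> of the projection. As the entries are real,
  the bilinear pairing in \<open>orth\<close> is the inner product.\<close>

locale jw_onb =
  fixes n d :: nat and B :: "nat \<Rightarrow> 'n::finite list \<Rightarrow> complex"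
  assumes N: "2 \<le> card (UNIV :: 'n set)"
    and capfree_B: "c < d \<Longrightarrow> capfree (B c)"
    and orth: "a < d \<Longrightarrow> c < d \<Longrightarrow> (\<Sum>i\<in>words n. B a i * B c i) = (if a = c then 1 else 0)"
    and jwp_B: "length i = n \<Longrightarrow> length j = n \<Longrightarrow> jwp i j = (\<Sum>a<d. B a i * B a j)"
    and cnj_B: "cnj (B a i) = B a i"

lemma jw_onb_exists:
  assumes N: "2 \<le> card (UNIV :: 'n::finite set)"
  shows "\<exists>d (B :: nat \<Rightarrow> 'n list \<Rightarrow> complex). jw_onb n d B"
proof -
  define q :: "'n list \<Rightarrow> 'n list \<Rightarrow> real" where "q i j = Re (jwp i j)" for i j
  have q: "complex_of_real (q i j) = jwp i j" for i j
    using jwp_cnj[of i j] by (simp add: q_def complex_eq_iff)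
  have "\<exists>d b. (\<forall>a<d. \<forall>c<d. (\<Sum>i\<in>words n. b a i * b c i) = (if a = c then 1 else 0))
    \<and> (\<forall>i\<in>words n. \<forall>j\<in>words n. q i j = (\<Sum>a<(d::nat). b a i * b a j))"
  proof (rule symmetric_projection_onb)
    show "finite (words n :: 'n list set)" by simp
    show "q i j = q j i" for i j by (simp add: q_def jwp_sym[OF N, of i j])
    show "(\<Sum>k\<in>words n. q i k * q k j) = q i j" if "i \<in> words n" for i j
    proof -
      have "complex_of_real (\<Sum>k\<in>words n. q i k * q k j) = of_real (q i j)"
        using jwp_idem[OF N, of i j] that by (simp add: q)
      then show ?thesis by (simp only: of_real_eq_iff)
    qed
  qed
  then obtain d and b :: "nat \<Rightarrow> 'n list \<Rightarrow> real" where
    on: "\<And>a c. a < d \<Longrightarrow> c < d \<Longrightarrow> (\<Sum>i\<in>words n. b a i * b c i) = (if a = c then 1 else 0)" and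
    qb: "\<And>i j. length i = n \<Longrightarrow> length j = n \<Longrightarrow> q i j = (\<Sum>a<d. b a i * b a j)"
    unfolding Ball_def in_words by iprover
  \<comment> \<open>Extension by 0 to other lengths, so that \<open>capfree\<close> can hold at all
    words.\<close>
  define B where "B a i = (if length i = n then complex_of_real (b a i) else 0)" for a i
  have "jw_onb n d B"
  proof
    show "2 \<le> card (UNIV :: 'n set)" by (rule N)
    show orth: "(\<Sum>i\<in>words n. B a i * B c i) = (if a = c then 1 else 0)" if "a < d" "c < d" for a c
    proof -
      have "(\<Sum>i\<in>words n. B a i * B c i) = of_real (\<Sum>i\<in>words n. b a i * b c i)"
        by (simp add: B_def)
      then show ?thesis by (simp add: on that)
    qed
    show jwp: "jwp i j = (\<Sum>a<d. B a i * B a j)" if "length i = n" "length j = n" for i j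
      using arg_cong[OF qb[OF that], of complex_of_real] that by (simp add: q B_def)
    show "cnj (B a i) = B a i" for a i by (simp add: B_def)
    show "capfree (B c)" if "c < d" for c
    proof -
      \<comment> \<open>The basis vector is fixed by the projection and hence a combination of its
        contraction-free columns.\<close>
      have "B c i = (\<Sum>j\<in>words n. B c j * jwp i j)" for i
      proof (cases "length i = n")
        case True
        have "(\<Sum>j\<in>words n. B c j * jwp i j) = (\<Sum>j\<in>words n. \<Sum>a<d. B a i * (B c j * B a j))"
          using True by (intro sum.cong) (auto simp: jwp sum_distrib_left mult_ac)
        also have "\<dots> = (\<Sum>a<d. B a i * (\<Sum>j\<in>words n. B c j * B a j))"
          by (subst sum.swap) (simp add: sum_distrib_left)
        also have "\<dots> = B c i" using that by (simp add: orth if_distrib cong: if_cong)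
        finally show ?thesis by simp
      qed (simp add: B_def jwp_length)
      then have eq: "B c = (\<lambda>i. \<Sum>j\<in>words n. B c j * jwp i j)" by (rule ext)
      show ?thesis by (subst eq) (intro capfree_sum capfree_mult_left capfree_jwp_left[OF N])
    qed
  qed
  then show ?thesis by blast
qed

context jw_onb
begin

text \<open>The compression of the \<open>n\<close>-th tensor power of the fundamental
  representation to the contraction-free tensors, in the basis \<open>B\<close>.\<close>

definition V :: "'n pol_O mat" where
  "V = mat d d (\<lambda>(a, c). \<Sum>i\<in>words n. \<Sum>j\<in>words n. (B a i * B c j) *\<^sub>C uw i j)"

text \<open>In \<open>vcol\<close> and \<open>vrow\<close> only one side of the tensor power is
  paired with the basis; the other side keeps its words.\<close>

definition vcol :: "nat \<Rightarrow> 'n list \<Rightarrow> 'n pol_O" where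
  "vcol c i = (\<Sum>j\<in>words n. B c j *\<^sub>C uw i j)"

definition vrow :: "nat \<Rightarrow> 'n list \<Rightarrow> 'n pol_O" where
  "vrow a j = (\<Sum>i\<in>words n. B a i *\<^sub>C uw i j)"

lemma V_dims [simp]: "dim_row V = d" "dim_col V = d" "V \<in> carrier_mat d d"
  by (simp_all add: V_def)

lemma V_vcol: "a < d \<Longrightarrow> c < d \<Longrightarrow> V $$ (a, c) = (\<Sum>i\<in>words n. B a i *\<^sub>C vcol c i)"
  by (simp add: V_def vcol_def scaleC_sum_right scaleC_scaleC)

lemma V_vrow: "a < d \<Longrightarrow> c < d \<Longrightarrow> V $$ (a, c) = (\<Sum>j\<in>words n. B c j *\<^sub>C vrow a j)"
  by (simp add: V_def vrow_def scaleC_sum_right scaleC_scaleC mult.commute) (rule sum.swap)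

text \<open>By invariance \<open>vcol c\<close> is contraction-free, so the projection
  \<open>jwp\<close>, which the sum over the basis assembles, fixes it.\<close>

lemma sum_B_V_vcol:
  assumes "c < d" "length i = n"
  shows "(\<Sum>a<d. B a i *\<^sub>C V $$ (a, c)) = vcol c i"
proof -
  have "(\<Sum>a<d. B a i *\<^sub>C V $$ (a, c)) = (\<Sum>a<d. \<Sum>k\<in>words n. (B a i * B a k) *\<^sub>C vcol c k)"
    using assms by (simp add: V_vcol scaleC_sum_right scaleC_scaleC)
  also have "\<dots> = (\<Sum>k\<in>words n. jwp i k *\<^sub>C vcol c k)"
    using assms by (subst sum.swap) (simp add: jwp_B scaleC_sum_left)
  also have "\<dots> = vcol c i"
    unfolding vcol_def using assms by (intro jwp_expand capfree_uw_rows capfree_B)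
  finally show ?thesis .
qed

lemma sum_B_V_vrow:
  assumes "a < d" "length j = n"
  shows "(\<Sum>c<d. B c j *\<^sub>C V $$ (a, c)) = vrow a j"
proof -
  have "(\<Sum>c<d. B c j *\<^sub>C V $$ (a, c)) = (\<Sum>c<d. \<Sum>k\<in>words n. (B c j * B c k) *\<^sub>C vrow a k)"
    using assms by (simp add: V_vrow scaleC_sum_right scaleC_scaleC)
  also have "\<dots> = (\<Sum>k\<in>words n. jwp j k *\<^sub>C vrow a k)"
    using assms by (subst sum.swap) (simp add: jwp_B scaleC_sum_left)
  also have "\<dots> = vrow a j"
    unfolding vrow_def using assms by (intro jwp_expand capfree_uw_cols capfree_B)
  finally show ?thesis .
qed

text \<open>If \<open>d\<close> were 0 the projection would vanish in degree \<open>n\<close>, but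
  it fixes the basis vector of an alternating word.\<close>

lemma dim_pos: "0 < d"
proof (rule ccontr)
  assume "\<not> 0 < d"
  then have 0: "jwp i j = 0" if "length i = n" "length j = n" for i j :: "'n list"
    using jwp_B[OF that] by simp
  obtain a b :: 'n where "a \<noteq> b" using ex_two_letters[OF N] by blast
  then have w: "length (altw a b n) = n" "distinct_adj (altw a b n)" by simp_all
  define w where "w = altw a b n"
  note w = w[folded w_def]
  have "(\<Sum>j\<in>words n. jwp w j *\<^sub>C (if j = w then 1 else 0 :: complex)) = 1"
    using jwp_expand[OF capfree_vector[OF N w(2)] w(1)] by simp
  then show False using w 0 by (simp add: if_distrib cong: if_cong)
qed

text \<open>The coproduct of the tensor power gives a sum of
  \<open>vrow a k \<otimes>\<^sub>t vcol c k\<close> over words; expanding \<open>vcol\<close> in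
  the basis turns it into a sum over basis indices.\<close>

lemma comult_V:
  assumes "a < d" "c < d"
  shows "comult (V $$ (a, c)) = (\<Sum>e<d. V $$ (a, e) \<otimes>\<^sub>t V $$ (e, c))"
proof -
  note lin = unital_star_homD(1)[OF comult(1)]
  have "comult (V $$ (a, c))
      = (\<Sum>i\<in>words n. \<Sum>j\<in>words n. \<Sum>k\<in>words n. (B a i *\<^sub>C uw i k) \<otimes>\<^sub>t (B c j *\<^sub>C uw k j))"
    using assms
    by (simp add: V_def clinear_map_sum[OF lin] clinear_mapD(2)[OF lin] comult_uw scaleC_sum_right
        tensor_of_scale_left tensor_of_scale_right scaleC_scaleC mult.commute)
  also have "\<dots> = (\<Sum>i\<in>words n. \<Sum>k\<in>words n. \<Sum>j\<in>words n. (B a i *\<^sub>C uw i k) \<otimes>\<^sub>t (B c j *\<^sub>C uw k j))"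
    by (rule sum.cong[OF refl], rule sum.swap)
  also have "\<dots> = (\<Sum>k\<in>words n. vrow a k \<otimes>\<^sub>t vcol c k)"
    by (subst sum.swap)
       (simp only: vrow_def vcol_def tensor_of_sum_left, simp only: tensor_of_sum_right)
  also have "\<dots> = (\<Sum>k\<in>words n. \<Sum>e<d. B e k *\<^sub>C (vrow a k \<otimes>\<^sub>t V $$ (e, c)))"
    using assms
    by (simp flip: sum_B_V_vcol add: tensor_of_sum_right tensor_of_scale_right)
  also have "\<dots> = (\<Sum>e<d. V $$ (a, e) \<otimes>\<^sub>t V $$ (e, c))"
    using assms
    by (subst sum.swap) (simp add: V_vrow tensor_of_sum_left tensor_of_scale_left)
  finally show ?thesis .
qed

text \<open>Summing over the basis index restores \<open>vrow\<close> or \<open>vcol\<close>, after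
  which unitarity of the tensor power and orthonormality of \<open>B\<close> finish.\<close>

lemma V_star_V:
  assumes "a < d" "c < d"
  shows "(\<Sum>e<d. V $$ (a, e) * star (V $$ (c, e))) = (if a = c then 1 else 0)"
    and "(\<Sum>e<d. star (V $$ (e, a)) * V $$ (e, c)) = (if a = c then 1 else 0)"
proof -
  have "(\<Sum>e<d. V $$ (a, e) * star (V $$ (c, e)))
      = (\<Sum>j\<in>words n. (\<Sum>e<d. B e j *\<^sub>C V $$ (a, e)) * star (vrow c j))"
    using assms
    by (subst sum_distrib_right, subst sum.swap)
       (simp add: V_vrow[of c] star_sum star_scaleC cnj_B sum_distrib_left scaleC_mult_left scaleC_mult_right)
  also have "\<dots> = (\<Sum>j\<in>words n. vrow a j * star (vrow c j))"
    using assms by (simp add: sum_B_V_vrow)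
  also have "\<dots> = (\<Sum>i\<in>words n. \<Sum>i'\<in>words n. (B a i * B c i') *\<^sub>C (\<Sum>j\<in>words n. uw i j * star (uw i' j)))"
    unfolding vrow_def
    by (simp add: star_sum star_scaleC cnj_B sum_product scaleC_mult_left scaleC_mult_right scaleC_scaleC
        scaleC_sum_right mult.commute[of "B c _"])
       (rule trans[OF sum.swap], rule sum.cong[OF refl], rule sum.swap)
  also have "\<dots> = (\<Sum>i\<in>words n. \<Sum>i'\<in>words n. (if i = i' then (B a i * B c i') *\<^sub>C 1 else 0))"
    by (intro sum.cong refl) (auto simp: sum_uw_star_uw[of _ _, simplified] scaleC_zero_right)
  also have "\<dots> = (if a = c then 1 else 0)"
    using assms by (simp add: sum.delta' orth scaleC_zero_left scaleC_one flip: scaleC_sum_left)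
  finally show "(\<Sum>e<d. V $$ (a, e) * star (V $$ (c, e))) = (if a = c then 1 else 0)" .
  have "(\<Sum>e<d. star (V $$ (e, a)) * V $$ (e, c))
      = (\<Sum>i\<in>words n. star (vcol a i) * (\<Sum>e<d. B e i *\<^sub>C V $$ (e, c)))"
    using assms
    by (subst sum_distrib_left, subst sum.swap)
       (simp add: V_vcol[of _ a] star_sum star_scaleC cnj_B sum_distrib_right scaleC_mult_left scaleC_mult_right)
  also have "\<dots> = (\<Sum>i\<in>words n. star (vcol a i) * vcol c i)"
    using assms by (simp add: sum_B_V_vcol)
  also have "\<dots> = (\<Sum>i\<in>words n. \<Sum>i'\<in>words n. (B a i * B c i') *\<^sub>C (\<Sum>j\<in>words n. star (uw j i) * uw j i'))"
    unfolding vcol_def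
    by (simp add: star_sum star_scaleC cnj_B sum_product scaleC_mult_left scaleC_mult_right scaleC_scaleC
        scaleC_sum_right mult.commute[of "B c _"])
       (rule trans[OF sum.swap], rule sum.cong[OF refl], rule sum.swap)
  also have "\<dots> = (\<Sum>i\<in>words n. \<Sum>i'\<in>words n. (if i = i' then (B a i * B c i') *\<^sub>C 1 else 0))"
    by (intro sum.cong refl) (auto simp: sum_star_uw_uw[of _ _, simplified] scaleC_zero_right)
  also have "\<dots> = (if a = c then 1 else 0)"
    using assms by (simp add: sum.delta' orth scaleC_zero_left scaleC_one flip: scaleC_sum_left)
  finally show "(\<Sum>e<d. star (V $$ (e, a)) * V $$ (e, c)) = (if a = c then 1 else 0)" .
qed

lemma unitary_representation_V: "unitary_representation V"
  unfolding unitary_representation_def representation_def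
proof (intro conjI allI impI)
  show "V * mat_star V = 1\<^sub>m (dim_row V)"
    by (rule eq_matI) (auto simp: mat_star_def scalar_prod_def V_star_V atLeast0LessThan)
  show "mat_star V * V = 1\<^sub>m (dim_row V)"
    by (rule eq_matI) (auto simp: mat_star_def scalar_prod_def V_star_V atLeast0LessThan)
qed (simp_all add: dim_pos comult_V)

end

subsection \<open>A Fock module\<close>

lemma creation_mult_left: "creation j (\<lambda>v. c * F v) w = c * (creation j F w :: complex)"
  using creation_scale[of j c F w] by simp

lemma creation_mult_right: "creation j (\<lambda>v. g v * c) w = creation j g w * (c :: complex)"
  using creation_vec[of j g c w] by simp

text \<open>The regular representation: \<open>u i j\<close> acts on pairs of contraction-free tensors by creating or
  annihilating one leg on both sides.\<close>

definition act :: "'n::finite \<times> 'n \<Rightarrow> ('n list \<Rightarrow> 'n list \<Rightarrow> complex) \<Rightarrow> 'n list \<Rightarrow> 'n list \<Rightarrow> complex" where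
  "act p G v w = creation (fst p) (\<lambda>v'. creation (snd p) (G v') w) v
     + of_real (jw (card (UNIV :: 'n set)) (Suc (length v))) * G (fst p # v) (snd p # w)"

text \<open>The carrier of the module: families of elements of H_n tensor H_n over all degrees n,
  with H_n the contraction-free tensors of degree n.\<close>

definition bicapfree :: "('n::finite list \<Rightarrow> 'n list \<Rightarrow> complex) \<Rightarrow> bool" where
  "bicapfree G \<longleftrightarrow> (\<forall>w. capfree (\<lambda>v. G v w)) \<and> (\<forall>v. capfree (G v))
     \<and> (\<forall>v w. length v \<noteq> length w \<longrightarrow> G v w = 0)"

definition vac2 :: "'n list \<Rightarrow> 'n list \<Rightarrow> complex" where
  "vac2 v w = vac v * vac w"

lemma bicapfree_vac2: "bicapfree vac2"
  by (auto simp: bicapfree_def vac2_def[abs_def] intro!: capfree_mult_left capfree_mult_right capfree_vac)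
     (auto simp: vac_def)

lemma bicapfree_flip: "bicapfree G \<Longrightarrow> bicapfree (\<lambda>v w. G w v)"
  by (auto simp: bicapfree_def)

text \<open>Exchanging the words exchanges the indices of the generator. The coefficient in
  \<open>act\<close> depends on the first word only, which agrees on both sides for equal lengths;
  otherwise the terms carrying it vanish.\<close>

lemma act_flip:
  assumes "bicapfree G"
  shows "act (i, j) G v w = act (j, i) (\<lambda>a b. G b a) w v"
proof (cases "length v = length w")
  case True
  then show ?thesis by (simp add: act_def creation_commute[of i])
next
  case False
  then show ?thesis using assms by (simp add: act_def creation_commute[of i] bicapfree_def)
qed

lemma capfree_creation_param:
  "(\<And>w. capfree (\<lambda>v. G v w)) \<Longrightarrow> capfree (\<lambda>v. creation j (G v) w)"
  unfolding capfree_def by (simp add: creation_zero flip: creation_sum)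

lemma capfree_act:
  fixes G :: "'n::finite list \<Rightarrow> 'n list \<Rightarrow> complex"
  assumes N: "2 \<le> card (UNIV :: 'n set)" and G: "bicapfree G"
  shows "capfree (\<lambda>v. act p G v w)"
proof -
  have "capfree (creation (fst p) (\<lambda>v'. creation (snd p) (G v') w))"
    using G by (intro capfree_creation[OF N] capfree_creation_param) (simp add: bicapfree_def)
  moreover have "capfree (\<lambda>v. of_real (jw (card (UNIV :: 'n set)) (Suc (length v)))
      * G (fst p # v) (snd p # w) :: complex)"
  proof -
    have "capfree (\<lambda>v. G (fst p # v) (snd p # w))"
      using G by (intro capfree_Cons) (simp add: bicapfree_def)
    then show ?thesis unfolding capfree_def by (simp flip: sum_distrib_left)
  qed
  ultimately show ?thesis unfolding act_def by (rule capfree_add)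
qed

lemma bicapfree_act:
  fixes G :: "'n::finite list \<Rightarrow> 'n list \<Rightarrow> complex"
  assumes N: "2 \<le> card (UNIV :: 'n set)" and G: "bicapfree G"
  shows "bicapfree (act p G)"
  unfolding bicapfree_def
proof (intro conjI allI impI)
  show "capfree (\<lambda>v. act p G v w)" for w by (rule capfree_act[OF assms])
  \<comment> \<open>The second variable is reduced to the first by the flip.\<close>
  show "capfree (act p G v)" for v
  proof -
    obtain i j where p: "p = (i, j)" by (cases p)
    have "act p G v = (\<lambda>w. act (j, i) (\<lambda>a b. G b a) w v)"
      unfolding p by (rule ext, rule act_flip, rule G)
    moreover have "bicapfree (\<lambda>a b. G b a)"
      using G by (rule bicapfree_flip)
    from capfree_act[OF N this] have "capfree (\<lambda>w. act (j, i) (\<lambda>a b. G b a) w v)" .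
    ultimately show ?thesis by (simp only:)
  qed
  fix v w :: "'n list"
  assume "length v \<noteq> length w"
  then show "act p G v w = 0"
    using G by (auto simp: act_def bicapfree_def intro!: creation_zeroI)
qed

lemma bicapfree_foldr_act:
  fixes G :: "'n::finite list \<Rightarrow> 'n list \<Rightarrow> complex"
  assumes N: "2 \<le> card (UNIV :: 'n set)" and G: "bicapfree G"
  shows "bicapfree (foldr act l G)"
  by (induction l) (simp_all add: G bicapfree_act[OF N])

text \<open>Expand into four terms. In the second word, \<open>T1\<close> contains the sum of
  \<open>C\<^sub>k C\<^sub>k\<close> and \<open>T4\<close> a contraction, so both vanish;
  \<open>T2\<close> contains the sum of \<open>C\<^sub>k A\<^sub>k\<close> and \<open>T3\<close>
  that of \<open>A\<^sub>k C\<^sub>k\<close>, both scalars. What remains on the first word is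
  \<open>A\<^sub>i C\<^sub>j + \<lambda> C\<^sub>i A\<^sub>j\<close>, a delta by the recursion of
  \<open>creation\<close>.\<close>

lemma act_row_relation:
  fixes G :: "'n::finite list \<Rightarrow> 'n list \<Rightarrow> complex"
  assumes N: "2 \<le> card (UNIV :: 'n set)" and G: "bicapfree G"
  shows "(\<Sum>k\<in>UNIV. act (i, k) (act (j, k) G) v w) = (if i = j then G v w else 0)"
proof (cases "length v = length w")
  case False
  moreover have "act (i, k) (act (j, k) G) v w = 0" for k
    using bicapfree_act[OF N bicapfree_act[OF N G]] False unfolding bicapfree_def by blast
  ultimately show ?thesis using G by (simp add: bicapfree_def)
next
  case True
  let ?N = "card (UNIV :: 'n set)"
  let ?l = "\<lambda>n. complex_of_real (jw ?N n)"
  have Gr: "capfree (G x)" for x using G by (simp add: bicapfree_def)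
  define T1 where "T1 k = creation i (\<lambda>v'. creation k (\<lambda>w'. creation j (\<lambda>x. creation k (G x) w') v') w) v" for k
  define T2 where "T2 k = creation i (\<lambda>v'. creation k (\<lambda>w'. ?l (Suc (length v')) * G (j # v') (k # w')) w) v" for k
  define T3 where "T3 k = ?l (Suc (length v)) * creation j (\<lambda>x. creation k (G x) (k # w)) (i # v)" for k
  define T4 where "T4 k = ?l (Suc (length v)) * (?l (Suc (Suc (length v))) * G (j # i # v) (k # k # w))" for k
  have "act (i, k) (act (j, k) G) v w = T1 k + T2 k + T3 k + T4 k" for k
    unfolding act_def[abs_def] T1_def T2_def T3_def T4_def
    by (simp add: creation_add distrib_left del: creation.simps)
  then have "(\<Sum>k\<in>UNIV. act (i, k) (act (j, k) G) v w)
      = (\<Sum>k\<in>UNIV. T1 k) + (\<Sum>k\<in>UNIV. T2 k) + (\<Sum>k\<in>UNIV. T3 k) + (\<Sum>k\<in>UNIV. T4 k)"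
    by (simp add: sum.distrib)
  moreover have "(\<Sum>k\<in>UNIV. T1 k) = 0"
  proof -
    have "T1 k = creation i (\<lambda>v'. creation j (\<lambda>x. creation k (creation k (G x)) w) v') v" for k
      unfolding T1_def by (intro arg_cong[of _ _ "\<lambda>F. creation i F v"] ext creation_commute[symmetric])
    then show ?thesis
      by (simp add: creation_zero sum_creation_creation[OF N Gr] flip: creation_sum)
  qed
  moreover have "(\<Sum>k\<in>UNIV. T2 k) = ?l (length v) * creation i (\<lambda>x. G (j # x) w) v"
  proof (cases w)
    case Nil
    then show ?thesis using True by (simp add: T2_def)
  next
    case (Cons b w')
    \<comment> \<open>\<open>creation i\<close> at \<open>v\<close> evaluates its argument only at
      words one letter shorter, where \<open>Suc (length v')\<close> is
      \<open>length v\<close>.\<close>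
    have "T2 k = creation i (\<lambda>v'. creation k (\<lambda>w'. ?l (length v) * G (j # v') (k # w')) w) v" for k
      unfolding T2_def by (rule creation_cong) simp
    then have "(\<Sum>k\<in>UNIV. T2 k)
        = ?l (length v) * creation i (\<lambda>v'. \<Sum>k\<in>UNIV. creation k (\<lambda>w'. G (j # v') (k # w')) w) v"
      by (simp only: creation_mult_left creation_sum sum_distrib_left)
    moreover have "w \<noteq> []" using Cons by simp
    ultimately show ?thesis by (simp add: sum_creation_contract[OF Gr] del: creation.simps)
  qed
  moreover have "(\<Sum>k\<in>UNIV. T3 k) = creation j (\<lambda>x. G x w) (i # v)"
  proof -
    have "(\<Sum>k\<in>UNIV. T3 k)
        = ?l (Suc (length v)) * creation j (\<lambda>x. \<Sum>k\<in>UNIV. creation k (G x) (k # w)) (i # v)"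
      unfolding T3_def creation_sum sum_distrib_left ..
    also have "\<dots> = of_real (jw ?N (Suc (length v)) * (real ?N - jw ?N (length v)))
        * creation j (\<lambda>x. G x w) (i # v)"
      unfolding sum_annihilate_create[OF Gr] scaleC_complex_eq creation_mult_left True of_real_mult mult.assoc ..
    finally show ?thesis by (simp only: jw_Suc[OF N] of_real_1 mult_1_left)
  qed
  moreover have "(\<Sum>k\<in>UNIV. T4 k) = 0"
    unfolding T4_def by (simp add: capfreeD_Nil[OF Gr] flip: sum_distrib_left)
  ultimately show ?thesis by simp
qed

lemma act_col_relation:
  fixes G :: "'n::finite list \<Rightarrow> 'n list \<Rightarrow> complex"
  assumes N: "2 \<le> card (UNIV :: 'n set)" and G: "bicapfree G"
  shows "(\<Sum>k\<in>UNIV. act (k, i) (act (k, j) G) v w) = (if i = j then G v w else 0)"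
proof -
  have "act (k, i) (act (k, j) G) v w = act (i, k) (act (j, k) (\<lambda>a b. G b a)) w v" for k
  proof -
    have "(\<lambda>a b. act (k, j) G b a) = act (j, k) (\<lambda>a b. G b a)"
      by (intro ext act_flip[OF G])
    with act_flip[OF bicapfree_act[OF N G], of k i "(k, j)"] show ?thesis by (rule trans[OF _ arg_cong])
  qed
  then show ?thesis
    using act_row_relation[OF N bicapfree_flip[OF G], of i j w v] by (simp only:)
qed

lemma act_add: "act p (\<lambda>x y. F x y + G x y) v w = act p F v w + act p G v w"
  by (simp add: act_def creation_add distrib_left)

lemma act_scale: "act p (\<lambda>x y. c * F x y) v w = c * act p F v w"
  by (simp add: act_def distrib_left creation_mult_left)

lemma foldr_act_add: "foldr act l (\<lambda>x y. F x y + G x y) v w = foldr act l F v w + foldr act l G v w"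
proof (induction l arbitrary: v w)
  case (Cons p l)
  have "foldr act l (\<lambda>x y. F x y + G x y) = (\<lambda>x y. foldr act l F x y + foldr act l G x y)"
    by (intro ext Cons.IH)
  then show ?case by (simp add: act_add)
qed simp

lemma foldr_act_scale: "foldr act l (\<lambda>x y. c * F x y) v w = c * foldr act l F v w"
proof (induction l arbitrary: v w)
  case (Cons p l)
  have "foldr act l (\<lambda>x y. c * F x y) = (\<lambda>x y. c * foldr act l F x y)"
    by (intro ext Cons.IH)
  then show ?case by (simp add: act_scale)
qed simp

lemma foldr_act_0: "foldr act l (\<lambda>_ _. 0) v w = 0"
  using foldr_act_scale[of l 0 "\<lambda>_ _. 0" v w] by simp

section \<open>The module over the free algebra and its descent to the quotient\<close>

text \<open>Extended separately at each pair of words, since \<open>malg_extend\<close> takes values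
  in a star-algebra.\<close>

definition free_act :: "(('n::finite \<times> 'n) free_monoid \<Rightarrow>\<^sub>0 complex) \<Rightarrow>
    ('n list \<Rightarrow> 'n list \<Rightarrow> complex) \<Rightarrow> 'n list \<Rightarrow> 'n list \<Rightarrow> complex" where
  "free_act X G v w = malg_extend (\<lambda>m. foldr act (letters m) G v w) X"

lemma free_act_0: "free_act 0 G v w = 0"
  by (simp add: free_act_def malg_extend_zero)

lemma free_act_add: "free_act (X + Y) G v w = free_act X G v w + free_act Y G v w"
  by (simp add: free_act_def malg_extend_add)

lemma free_act_diff: "free_act (X - Y) G v w = free_act X G v w - free_act Y G v w"
  by (simp add: free_act_def malg_extend_minus)

lemma free_act_sum: "free_act (\<Sum>i\<in>A. X i) G v w = (\<Sum>i\<in>A. free_act (X i) G v w)"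
  by (simp add: free_act_def malg_extend_sum)

lemma free_act_scale: "free_act (malg_scale c X) G v w = c * free_act X G v w"
  by (simp add: free_act_def malg_extend_scale)

lemma free_act_single: "free_act (Poly_Mapping.single m c) G v w = c * foldr act (letters m) G v w"
  by (simp add: free_act_def malg_extend_single)

lemma free_act_mult: "free_act (X * Y) G v w = free_act X (free_act Y G) v w"
proof (induction X rule: pm_induct)
  case (add X m c)
  have "free_act (Poly_Mapping.single m c * Y) G v w = c * foldr act (letters m) (free_act Y G) v w"
  proof (induction Y rule: pm_induct)
    case zero
    then show ?case by (simp add: free_act_0[abs_def] foldr_act_0)
  next
    case (add Y k e)
    have "free_act (Y + Poly_Mapping.single k e) G
        = (\<lambda>x y. free_act Y G x y + e * foldr act (letters k) G x y)"
      by (intro ext) (simp add: free_act_add free_act_single)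
    with add show ?case
      by (simp add: distrib_left free_act_add free_act_single mult_single foldr_act_add foldr_act_scale
          plus_free_monoid_def)
  qed
  with add show ?case by (simp add: distrib_right free_act_add free_act_single)
qed (simp add: free_act_0)

lemma bicapfree_free_act:
  fixes G :: "'n::finite list \<Rightarrow> 'n list \<Rightarrow> complex"
  assumes N: "2 \<le> card (UNIV :: 'n set)" and G: "bicapfree G"
  shows "bicapfree (free_act X G)"
proof -
  have eq: "free_act X G v w = (\<Sum>m\<in>Poly_Mapping.keys X. Poly_Mapping.lookup X m * foldr act (letters m) G v w)"
    for v w by (simp add: free_act_def malg_extend_def)
  have *: "bicapfree (foldr act (letters m) G)" for m by (rule bicapfree_foldr_act[OF assms])
  show ?thesis
    using * unfolding bicapfree_def eq by (auto intro!: capfree_sum capfree_mult_left)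
qed

lemma free_act_relation:
  fixes G :: "'n::finite list \<Rightarrow> 'n list \<Rightarrow> complex"
  assumes N: "2 \<le> card (UNIV :: 'n set)" and G: "bicapfree G" and r: "r \<in> orthogonality_relations"
  shows "free_act r G v w = 0"
proof -
  have "free_act 1 G v w = G v w"
    using free_act_single[of 0 1 G v w] by (simp only: single_one) (simp add: zero_free_monoid_def)
  then have "free_act (if i = j then 1 else 0) G v w = (if i = j then G v w else 0)" for i j :: 'n
    by (simp add: free_act_0)
  moreover have "free_act (free_gen p * free_gen q) G v w = act p (act q G) v w" for p q
    by (simp add: mult_single free_act_single plus_free_monoid_def)
  ultimately show ?thesis
    using r act_row_relation[OF N G] act_col_relation[OF N G] unfolding orthogonality_relations_def
    by (auto simp only: Un_iff mem_Collect_eq free_act_diff free_act_sum diff_self)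
qed

text \<open>\<open>b\<close> keeps \<open>G\<close> in the module, where the relation
  \<open>r\<close> then acts as zero, and \<open>a\<close> maps zero to zero.\<close>

lemma free_act_ideal:
  fixes G :: "'n::finite list \<Rightarrow> 'n list \<Rightarrow> complex"
  assumes N: "2 \<le> card (UNIV :: 'n set)" and G: "bicapfree G"
    and X: "X \<in> generated_ideal orthogonality_relations"
  shows "free_act X G v w = 0"
  using X
proof induction
  case (step X r a b)
  have "free_act (r * b) G = (\<lambda>_ _. 0)"
    by (intro ext) (simp add: free_act_mult free_act_relation[OF N bicapfree_free_act[OF N G] step.hyps(2)])
  moreover have "free_act a (\<lambda>_ _. 0) v w = 0"
    using free_act_mult[of a 0 G v w] by (simp add: free_act_0[abs_def])
  ultimately show ?case using step.IH by (simp add: free_act_add mult.assoc free_act_mult)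
qed (simp add: free_act_0)

section \<open>Top-degree matrix coefficients at the vacuum\<close>

text \<open>Each generator raises the degree by at most one.\<close>

lemma foldr_act_vac2_zero:
  "length l < length v \<Longrightarrow> foldr act l vac2 v w = 0"
proof (induction l arbitrary: v w)
  case (Cons p l)
  have "foldr act l vac2 (fst p # v) (snd p # w) = 0" using Cons by simp
  moreover have "creation (snd p) (foldr act l vac2 v') w = 0" if "Suc (length v') = length v" for v'
    using Cons that by (intro creation_zeroI Cons.IH) auto
  then have "creation (fst p) (\<lambda>v'. creation (snd p) (foldr act l vac2 v') w) v = 0"
    by (rule creation_zeroI)
  ultimately show ?case using act_def[of p "foldr act l vac2" v w] by simp
qed (auto simp: vac2_def vac_def)

text \<open>In the highest degree reached only the creation parts survive, and they build one
  Jones-Wenzl column in each word.\<close>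

lemma foldr_act_vac2_top:
  "length i = length j \<Longrightarrow> length v = length i \<Longrightarrow> length w = length i \<Longrightarrow>
    foldr act (zip i j) vac2 v w = jwp v i * jwp w j"
proof (induction i j arbitrary: v w rule: list_induct2)
  case Nil
  then show ?case by (simp add: jwp_Nil vac2_def vac_def)
next
  case (Cons a i b j)
  have "foldr act (zip i j) vac2 (a # v) (b # w) = 0"
    using Cons by (intro foldr_act_vac2_zero) simp
  moreover have "creation a (\<lambda>v'. creation b (foldr act (zip i j) vac2 v') w) v
      = creation a (\<lambda>v'. creation b (\<lambda>w'. jwp v' i * jwp w' j) w) v"
    using Cons by (intro creation_cong) simp
  moreover have "\<dots> = jwp v (a # i) * jwp w (b # j)"
    by (simp add: creation_mult_left creation_mult_right jwp_Cons)
  ultimately show ?case using act_def[of "(a, b)" "foldr act (zip i j) vac2" v w] by simp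
qed

text \<open>The functional takes the value at \<open>(v, w)\<close> of an algebra element acting on
  the vacuum; it is well defined because the ideal acts as zero.\<close>

lemma ex_top_functional:
  fixes v w :: "'n::finite list"
  assumes N: "2 \<le> card (UNIV :: 'n set)" and "length v = n" "length w = n"
  shows "\<exists>f :: 'n pol_O \<Rightarrow> complex. clinear_map f \<and>
    (\<forall>i\<in>words n. \<forall>j\<in>words n. f (uw i j) = jwp v i * jwp w j)"
proof (intro exI conjI ballI)
  define f :: "'n pol_O \<Rightarrow> complex" where "f t = free_act (rep_pol_O t) vac2 v w" for t
  have f_abs: "f (abs_pol_O X) = free_act X vac2 v w" for X
  proof -
    have "rep_pol_O (abs_pol_O X) - X \<in> generated_ideal orthogonality_relations"
      using Quotient_rep_abs[OF Quotient_pol_O, of X] by (simp add: generated_ideal.zero)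
    from free_act_ideal[OF N bicapfree_vac2 this] show ?thesis by (simp add: f_def free_act_diff)
  qed
  have "f (x + y) = f x + f y" for x y
    by (induct x rule: pol_O.abs_induct, induct y rule: pol_O.abs_induct)
       (simp add: plus_pol_O.abs_eq f_abs free_act_add)
  moreover have "f (c *\<^sub>C x) = c *\<^sub>C f x" for c x
    by (induct x rule: pol_O.abs_induct) (simp add: scaleC_pol_O.abs_eq f_abs free_act_scale)
  ultimately show "clinear_map f" by (simp add: clinear_map_def)
  fix i j :: "'n list"
  assume "i \<in> words n" "j \<in> words n"
  then have len: "length i = length j" "length v = length i" "length w = length i"
    using assms by simp_all
  have "uw i j = abs_pol_O (Poly_Mapping.single (Word (zip i j)) 1)"
    using len by (simp add: abs_pol_O_word)
  then show "f (uw i j) = jwp v i * jwp w j"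
    using len by (simp add: f_abs free_act_single foldr_act_vac2_top)
qed

subsection \<open>Irreducibility\<close>

lemma intertwiners_entry:
  assumes T: "T \<in> intertwiners U W" and a: "a < dim_row W" and c: "c < dim_row U"
    and sq: "dim_col U = dim_row U" "dim_col W = dim_row W"
  shows "(\<Sum>e<dim_row U. T $$ (a, e) *\<^sub>C U $$ (e, c)) = (\<Sum>e<dim_row W. T $$ (e, c) *\<^sub>C W $$ (a, e))"
proof -
  have dims: "dim_row T = dim_row W" "dim_col T = dim_row U"
    and eq: "scalar_mat T * U = W * scalar_mat T"
    using T by (auto simp: intertwiners_def)
  have "(scalar_mat T * U) $$ (a, c) = (\<Sum>e<dim_row U. T $$ (a, e) *\<^sub>C U $$ (e, c))"
    using a c sq dims by (simp add: scalar_prod_def atLeast0LessThan scaleC_mult_left)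
  moreover have "(W * scalar_mat T) $$ (a, c) = (\<Sum>e<dim_row W. T $$ (e, c) *\<^sub>C W $$ (a, e))"
    using a c sq dims by (simp add: scalar_prod_def atLeast0LessThan scaleC_mult_right)
  ultimately show ?thesis using eq by simp
qed

context jw_onb
begin

lemma sum_jwp_B: "a < d \<Longrightarrow> length x = n \<Longrightarrow> (\<Sum>i\<in>words n. jwp x i * B a i) = B a x"
  using jwp_expand[OF capfree_B, of a x n] by simp

text \<open>A top functional at \<open>(x, y)\<close> maps \<open>V $$ (a, c)\<close> to
  \<open>B a x * B c y\<close>, so pairing the family with \<open>B p\<close> and \<open>B q\<close>
  isolates one entry by orthonormality.\<close>

lemma ex_matrix_unit_functional:
  assumes p: "p < d" and q: "q < d"
  shows "\<exists>f :: 'n pol_O \<Rightarrow> complex. clinear_map f \<and>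
    (\<forall>a<d. \<forall>c<d. f (V $$ (a, c)) = (if a = p \<and> c = q then 1 else 0))"
proof -
  \<comment> \<open>The length conditions sit inside the existential so that choice applies to all
    words.\<close>
  have "\<forall>x y :: 'n list. \<exists>f :: 'n pol_O \<Rightarrow> complex. length x = n \<longrightarrow> length y = n \<longrightarrow> clinear_map f \<and>
      (\<forall>i\<in>words n. \<forall>j\<in>words n. f (uw i j) = jwp x i * jwp y j)"
    using ex_top_functional[OF N] by blast
  then obtain f :: "'n list \<Rightarrow> 'n list \<Rightarrow> 'n pol_O \<Rightarrow> complex" where
    f: "\<forall>x y. length x = n \<longrightarrow> length y = n \<longrightarrow> clinear_map (f x y) \<and>
      (\<forall>i\<in>words n. \<forall>j\<in>words n. f x y (uw i j) = jwp x i * jwp y j)"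
    unfolding choice_iff by (rule exE)
  then have lin: "clinear_map (f x y)" if "length x = n" "length y = n" for x y
    using that by blast
  have top: "f x y (uw i j) = jwp x i * jwp y j"
    if "length x = n" "length y = n" "length i = n" "length j = n" for x y i j
    using f that by simp
  have fV: "f x y (V $$ (a, c)) = B a x * B c y"
    if "length x = n" "length y = n" "a < d" "c < d" for x y a c
  proof -
    have "f x y (V $$ (a, c)) = (\<Sum>i\<in>words n. \<Sum>j\<in>words n. (jwp x i * B a i) * (jwp y j * B c j))"
      using that lin[OF that(1,2)]
      by (simp add: V_def clinear_map_sum clinear_mapD top mult_ac)
    also have "\<dots> = B a x * B c y"
      using that by (simp add: sum_jwp_B flip: sum_product)
    finally show ?thesis .
  qed
  define F where "F t = (\<Sum>x\<in>words n. \<Sum>y\<in>words n. B p x * B q y * f x y t)" for t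
  have "F (s + t) = F s + F t" for s t
    by (simp add: F_def clinear_mapD[OF lin] distrib_left sum.distrib)
  moreover have "F (c *\<^sub>C t) = c *\<^sub>C F t" for c t
    by (simp add: F_def clinear_mapD[OF lin] sum_distrib_left mult_ac)
  moreover have "F (V $$ (a, c)) = (if a = p \<and> c = q then 1 else 0)" if "a < d" "c < d" for a c
  proof -
    have "F (V $$ (a, c)) = (\<Sum>x\<in>words n. \<Sum>y\<in>words n. (B p x * B a x) * (B q y * B c y))"
      using that by (simp add: F_def fV mult_ac)
    also have "\<dots> = (\<Sum>x\<in>words n. B p x * B a x) * (\<Sum>y\<in>words n. B q y * B c y)"
      by (simp add: sum_product)
    finally show ?thesis using that p q by (auto simp: orth)
  qed
  ultimately show ?thesis by (intro exI[of _ F]) (simp add: clinear_map_def)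
qed

text \<open>Matrix unit functionals applied to the entries of the intertwining equation turn it into
  linear equations for the entries of \<open>T\<close>.\<close>

lemma irreducible_representation_V: "irreducible_representation V"
  unfolding irreducible_representation_def
proof
  show "representation V" using unitary_representation_V by (simp add: unitary_representation_def)
  show "intertwiners V V = {c \<cdot>\<^sub>m 1\<^sub>m (dim_row V) |c. True}"
  proof (intro Set.set_eqI iffI)
    fix T assume T: "T \<in> intertwiners V V"
    then have dims: "dim_row T = d" "dim_col T = d" by (auto simp: intertwiners_def)
    have entry: "T $$ (a, p) * (if c = q then 1 else 0) = T $$ (q, c) * (if a = p then 1 else 0)"
      if "a < d" "c < d" "p < d" "q < d" for a c p q
    proof -
      obtain f :: "'n pol_O \<Rightarrow> complex" where f: "clinear_map f" and
        fV: "\<And>a c. a < d \<Longrightarrow> c < d \<Longrightarrow> f (V $$ (a, c)) = (if a = p \<and> c = q then 1 else 0)"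
        using ex_matrix_unit_functional[OF \<open>p < d\<close> \<open>q < d\<close>] by auto
      have "(\<Sum>e<d. T $$ (a, e) * f (V $$ (e, c))) = (\<Sum>e<d. T $$ (e, c) * f (V $$ (a, e)))"
        using arg_cong[OF intertwiners_entry[OF T, of a c], of f] that
        by (simp add: clinear_map_sum[OF f] clinear_mapD[OF f])
      moreover have "(\<Sum>e<d. T $$ (a, e) * f (V $$ (e, c)))
          = (\<Sum>e<d. if e = p then T $$ (a, p) * (if c = q then 1 else 0) else 0)"
        using that by (intro sum.cong) (auto simp: fV)
      moreover have "(\<Sum>e<d. T $$ (e, c) * f (V $$ (a, e)))
          = (\<Sum>e<d. if e = q then T $$ (q, c) * (if a = p then 1 else 0) else 0)"
        using that by (intro sum.cong) (auto simp: fV)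
      ultimately show ?thesis using that by simp
    qed
    \<comment> \<open>Instances with \<open>c = q = 0\<close> of \<open>entry\<close> already
      determine all of \<open>T\<close>.\<close>
    have "T = T $$ (0, 0) \<cdot>\<^sub>m 1\<^sub>m d"
    proof (rule eq_matI)
      fix a p assume "a < dim_row (T $$ (0, 0) \<cdot>\<^sub>m 1\<^sub>m d)" "p < dim_col (T $$ (0, 0) \<cdot>\<^sub>m 1\<^sub>m d)"
      then show "T $$ (a, p) = (T $$ (0, 0) \<cdot>\<^sub>m 1\<^sub>m d) $$ (a, p)"
        using entry[of a 0 p 0] dim_pos by auto
    qed (simp_all add: dims)
    then show "T \<in> {c \<cdot>\<^sub>m 1\<^sub>m (dim_row V) |c. True}" by auto
  next
    fix T :: "complex mat"
    assume "T \<in> {c \<cdot>\<^sub>m 1\<^sub>m (dim_row V) |c. True}"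
    then obtain c where T: "T = c \<cdot>\<^sub>m 1\<^sub>m d" by auto
    have "scalar_mat T * V = V * scalar_mat T"
    proof (rule eq_matI)
      fix a b assume "a < dim_row (V * scalar_mat T)" "b < dim_col (V * scalar_mat T)"
      then have ab: "a < d" "b < d" by (simp_all add: T)
      have "(scalar_mat T * V) $$ (a, b) = (\<Sum>e<d. (c * (if a = e then 1 else 0)) *\<^sub>C V $$ (e, b))"
        using ab by (simp add: T scalar_prod_def atLeast0LessThan scaleC_mult_left)
      also have "\<dots> = (\<Sum>e<d. if e = a then c *\<^sub>C V $$ (a, b) else 0)"
        by (intro sum.cong) (auto simp: scaleC_zero_left)
      also have "\<dots> = (\<Sum>e<d. if e = b then c *\<^sub>C V $$ (a, b) else 0)"
        using ab by simp
      also have "\<dots> = (\<Sum>e<d. (c * (if e = b then 1 else 0)) *\<^sub>C V $$ (a, e))"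
        by (intro sum.cong) (auto simp: scaleC_zero_left)
      also have "\<dots> = (V * scalar_mat T) $$ (a, b)"
        using ab by (simp add: T scalar_prod_def atLeast0LessThan scaleC_mult_right)
      finally show "(scalar_mat T * V) $$ (a, b) = (V * scalar_mat T) $$ (a, b)" .
    qed (simp_all add: T)
    then show "T \<in> intertwiners V V" by (simp add: intertwiners_def T)
  qed
qed

text \<open>Applying \<phi> entrywise to \<open>T U = V T\<close> gives c times T on the left and
  \<phi>(V) times T on the right; multiply by the inverse \<open>S\<close>.\<close>

lemma equivalent_V_scalar:
  assumes eq: "equivalent_representations U V" and U: "representation U" and \<phi>: "clinear_map \<phi>"
    and c: "\<And>i j. i < dim_row U \<Longrightarrow> j < dim_row U \<Longrightarrow> \<phi> (U $$ (i, j)) = (if i = j then c else 0 :: complex)"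
  shows "dim_row U = d" and "a < d \<Longrightarrow> b < d \<Longrightarrow> \<phi> (V $$ (a, b)) = (if a = b then c else 0)"
proof -
  obtain T where T: "T \<in> intertwiners U V" and inv: "invertible_mat T"
    using eq by (auto simp: equivalent_representations_def)
  then have dims: "dim_row T = d" "dim_col T = dim_row U" by (auto simp: intertwiners_def)
  obtain S where TS: "T * S = 1\<^sub>m d" and ST: "S * T = 1\<^sub>m (dim_row S)" and sq: "dim_col T = dim_row T"
    using inv dims by (auto simp: invertible_mat_def inverts_mat_def)
  show dU: "dim_row U = d" using dims sq by simp
  have dS: "dim_col S = d" "dim_row S = d"
    using arg_cong[OF TS, of dim_col] arg_cong[OF ST, of dim_col] dims dU by simp_all
  show "\<phi> (V $$ (a, b)) = (if a = b then c else 0)" if ab: "a < d" "b < d"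
  proof -
    have TS': "(\<Sum>k<d. T $$ (e, k) * S $$ (k, b)) = (if e = b then 1 else 0)" if "e < d" for e
      using arg_cong[OF TS, of "\<lambda>M. M $$ (e, b)"] that ab dims dS dU
      by (simp add: scalar_prod_def atLeast0LessThan)
    have key: "c * T $$ (a, k) = (\<Sum>e<d. T $$ (e, k) * \<phi> (V $$ (a, e)))" if "k < d" for k
    proof -
      have "(\<Sum>e<d. T $$ (a, e) * \<phi> (U $$ (e, k))) = (\<Sum>e<d. T $$ (e, k) * \<phi> (V $$ (a, e)))"
        using arg_cong[OF intertwiners_entry[OF T, of a k], of \<phi>] that ab dU U
        by (simp add: clinear_map_sum[OF \<phi>] clinear_mapD[OF \<phi>] representation_def)
      moreover have "(\<Sum>e<d. T $$ (a, e) * \<phi> (U $$ (e, k)))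
          = (\<Sum>e<d. if e = k then c * T $$ (a, k) else 0)"
        using that dU by (intro sum.cong) (auto simp: c)
      ultimately show ?thesis using that by simp
    qed
    have "c * (if a = b then 1 else 0) = (\<Sum>k<d. c * T $$ (a, k) * S $$ (k, b))"
      using TS'[OF ab(1)] by (simp add: mult.assoc flip: sum_distrib_left)
    also have "\<dots> = (\<Sum>k<d. \<Sum>e<d. \<phi> (V $$ (a, e)) * (T $$ (e, k) * S $$ (k, b)))"
      by (intro sum.cong) (auto simp: key sum_distrib_right sum_distrib_left mult_ac)
    also have "\<dots> = (\<Sum>e<d. \<phi> (V $$ (a, e)) * (\<Sum>k<d. T $$ (e, k) * S $$ (k, b)))"
      by (subst sum.swap) (simp add: sum_distrib_left)
    also have "\<dots> = (\<Sum>e<d. if e = b then \<phi> (V $$ (a, b)) else 0)"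
      by (intro sum.cong) (auto simp: TS')
    also have "\<dots> = \<phi> (V $$ (a, b))" using ab by simp
    finally show ?thesis by auto
  qed
qed

text \<open>\<xi> expands in the basis, and on a basis vector the sum is
  \<open>\<phi> (vcol b i)\<close>, which the entries of \<open>V\<close> determine.\<close>

lemma sum_capfree_V:
  assumes \<phi>: "clinear_map \<phi>" and \<xi>: "capfree \<xi>" and i: "length i = n"
    and c: "\<And>a b. a < d \<Longrightarrow> b < d \<Longrightarrow> \<phi> (V $$ (a, b)) = (if a = b then c else 0 :: complex)"
  shows "(\<Sum>j\<in>words n. \<xi> j * \<phi> (uw i j)) = c * \<xi> i"
proof -
  define \<beta> where "\<beta> b = (\<Sum>k\<in>words n. B b k * \<xi> k)" for b
  have exp: "\<xi> j = (\<Sum>b<d. \<beta> b * B b j)" if "length j = n" for j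
  proof -
    have "\<xi> j = (\<Sum>k\<in>words n. jwp j k * \<xi> k)"
      using jwp_expand[OF \<xi> that] by simp
    also have "\<dots> = (\<Sum>k\<in>words n. \<Sum>b<d. B b k * \<xi> k * B b j)"
      using that by (intro sum.cong) (auto simp: jwp_B sum_distrib_left mult_ac)
    also have "\<dots> = (\<Sum>b<d. \<beta> b * B b j)"
      by (subst sum.swap) (simp add: \<beta>_def sum_distrib_right)
    finally show ?thesis .
  qed
  have vc: "(\<Sum>j\<in>words n. B b j * \<phi> (uw i j)) = c * B b i" if b: "b < d" for b
  proof -
    have "(\<Sum>j\<in>words n. B b j * \<phi> (uw i j)) = \<phi> (vcol b i)"
      by (simp add: vcol_def clinear_map_sum[OF \<phi>] clinear_mapD[OF \<phi>])
    also have "\<dots> = (\<Sum>a<d. B a i * \<phi> (V $$ (a, b)))"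
      by (simp add: clinear_map_sum[OF \<phi>] clinear_mapD[OF \<phi>] flip: sum_B_V_vcol[OF b i])
    also have "\<dots> = (\<Sum>a<d. if a = b then c * B b i else 0)"
      using b by (intro sum.cong) (auto simp: c)
    finally show ?thesis using b by simp
  qed
  have "(\<Sum>j\<in>words n. \<xi> j * \<phi> (uw i j)) = (\<Sum>j\<in>words n. \<Sum>b<d. \<beta> b * (B b j * \<phi> (uw i j)))"
    by (intro sum.cong refl, subst exp) (auto simp: sum_distrib_right mult.assoc)
  also have "\<dots> = (\<Sum>b<d. \<beta> b * (\<Sum>j\<in>words n. B b j * \<phi> (uw i j)))"
    by (subst sum.swap) (simp add: sum_distrib_left)
  also have "\<dots> = c * (\<Sum>b<d. \<beta> b * B b i)"
    by (simp add: vc sum_distrib_left mult_ac)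
  finally show ?thesis by (simp add: exp[OF i])
qed

text \<open>The two alternating words give orthogonal fixed vectors of the projection. This
  separates \<open>V\<close> from the trivial representation in positive degree.\<close>

lemma dim_ne_1:
  assumes "0 < n"
  shows "d \<noteq> 1"
proof
  assume d: "d = 1"
  obtain a b :: 'n where ab: "a \<noteq> b" using ex_two_letters[OF N] by blast
  define v w where "v = altw a b n" and "w = altw b a n"
  have len: "length v = n" "length w = n" by (simp_all add: v_def w_def)
  have adj: "distinct_adj v" "distinct_adj w" using ab by (simp_all add: v_def w_def)
  have ne: "v \<noteq> w" using ab assms by (cases n) (auto simp: v_def w_def)
  have "jwp x y = (if x = y then 1 else 0)" if "distinct_adj y" "length x = n" "length y = n" for x y :: "'n list"
    using jwp_expand[OF capfree_vector[OF N that(1)] that(2)] that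
    by (simp add: if_distrib cong: if_cong)
  then have "jwp v v = 1" "jwp w w = 1" "jwp v w = 0" using len adj ne by auto
  then show False using jwp_B len by (auto simp: d)
qed

end

subsection \<open>Functionals that are scalar on contraction-free tensors\<close>

text \<open>The matrix of values \<open>\<phi> (uw i j)\<close> acts on contraction-free tensors of
  degree \<open>n\<close> as multiplication by \<open>c\<close>. This restates centrality without
  reference to chosen representatives.\<close>

definition scalar_on :: "('n::finite pol_O \<Rightarrow> complex) \<Rightarrow> nat \<Rightarrow> complex \<Rightarrow> bool" where
  "scalar_on \<phi> n c \<longleftrightarrow> (\<forall>\<xi> i. capfree \<xi> \<longrightarrow> length i = n \<longrightarrow>
     (\<Sum>j\<in>words n. \<xi> j * \<phi> (uw i j)) = c * \<xi> i)"

lemma scalar_on_add: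
  "scalar_on \<phi> n c \<Longrightarrow> scalar_on \<psi> n c' \<Longrightarrow> scalar_on (\<lambda>x. \<phi> x + \<psi> x) n (c + c')"
  by (simp add: scalar_on_def distrib_left distrib_right sum.distrib)

lemma scalar_on_mult: "scalar_on \<phi> n c \<Longrightarrow> scalar_on (\<lambda>x. k * \<phi> x) n (k * c)"
  by (simp add: scalar_on_def mult.left_commute mult.assoc flip: sum_distrib_left)

text \<open>Reads off values on monomials, taking for \<xi> the basis vector at
  \<open>w\<close>.\<close>

lemma scalar_on_distinct_adj:
  fixes i w :: "'n::finite list"
  assumes "2 \<le> card (UNIV :: 'n set)" "scalar_on \<phi> n c" "distinct_adj w" "length w = n" "length i = n"
  shows "\<phi> (uw i w) = (if i = w then c else 0)"
proof -
  have "(\<Sum>j\<in>words n. (if j = w then 1 else 0) * \<phi> (uw i j)) = c * (if i = w then 1 else 0)"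
    using assms(2,5) capfree_vector[OF assms(1,3)] by (simp add: scalar_on_def)
  moreover have "(\<Sum>j\<in>words n. (if j = w then 1 else 0) * \<phi> (uw i j))
      = (\<Sum>j\<in>words n. if j = w then \<phi> (uw i w) else 0)"
    by (intro sum.cong) auto
  ultimately show ?thesis using assms(4) by (auto split: if_splits)
qed

lemma scalar_on_0: "\<phi> 1 = 1 \<Longrightarrow> scalar_on \<phi> 0 1"
  by (simp add: scalar_on_def words_0 uw_Nil)

text \<open>The irreducible unitary \<open>V\<close> is equivalent to some member of the system,
  where centrality supplies the scalar.\<close>

lemma central_scalar_on:
  fixes \<U> :: "'n::finite pol_O mat set"
  assumes N: "2 \<le> card (UNIV :: 'n set)" and U: "irr_representatives \<U>"
    and lin: "clinear_map \<phi>" and central: "central \<U> \<phi>"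
  shows "\<exists>c. scalar_on \<phi> n c"
proof -
  obtain d and B :: "nat \<Rightarrow> 'n list \<Rightarrow> complex" where "jw_onb n d B"
    using jw_onb_exists[OF N] by blast
  then interpret jw_onb n d B .
  obtain W where W: "W \<in> \<U>" "equivalent_representations W V"
    using U unitary_representation_V irreducible_representation_V
    unfolding irr_representatives_def by blast
  have rep: "representation W"
    using U W(1) by (auto simp: irr_representatives_def irreducible_representation_def)
  obtain c where c: "\<And>i j. i < dim_row W \<Longrightarrow> j < dim_row W \<Longrightarrow> \<phi> (W $$ (i, j)) = (if i = j then c else 0)"
    using central W(1) unfolding central_def by metis
  have "\<phi> (V $$ (a, b)) = (if a = b then c else 0)" if "a < d" "b < d" for a b
    by (rule equivalent_V_scalar(2)[OF W(2) rep lin c that])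
  then show ?thesis using sum_capfree_V[OF lin] unfolding scalar_on_def by blast
qed

lemma haar_scalar_on:
  fixes \<U> :: "'n::finite pol_O mat set"
  assumes N: "2 \<le> card (UNIV :: 'n set)" and U: "irr_representatives \<U>"
    and h: "haar_state \<U> h" and n: "0 < n"
  shows "scalar_on h n 0"
proof -
  obtain d and B :: "nat \<Rightarrow> 'n list \<Rightarrow> complex" where "jw_onb n d B"
    using jw_onb_exists[OF N] by blast
  then interpret jw_onb n d B .
  obtain W where W: "W \<in> \<U>" "equivalent_representations W V"
    using U unitary_representation_V irreducible_representation_V
    unfolding irr_representatives_def by blast
  have rep: "representation W"
    using U W(1) by (auto simp: irr_representatives_def irreducible_representation_def)
  have lin: "clinear_map h" using h by (simp add: haar_state_def state_def)
  have "\<exists>T :: complex mat \<in> carrier_mat d (dim_row W). invertible_mat T"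
    using W(2) by (auto simp: equivalent_representations_def intertwiners_def)
  then have dW: "dim_row W = d" by (auto simp: invertible_mat_def)
  \<comment> \<open>An invertible intertwiner is square, so equivalence with the trivial
    representation would force dimension 1.\<close>
  have "\<not> equivalent_representations W (1\<^sub>m 1)"
    using dW dim_ne_1[OF n]
    by (auto simp: equivalent_representations_def intertwiners_def invertible_mat_def)
  \<comment> \<open>Both branches are 0 in order to match the scalar pattern of
    \<open>equivalent_V_scalar\<close> with scalar 0.\<close>
  then have "h (W $$ (i, j)) = (if i = j then 0 else 0)" if "i < dim_row W" "j < dim_row W" for i j
    using h W(1) that unfolding haar_state_def by auto
  from equivalent_V_scalar(2)[OF W(2) rep lin this]
  have "h (V $$ (a, b)) = (if a = b then 0 else 0)" if "a < d" "b < d" for a b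
    using that by blast
  then show ?thesis using sum_capfree_V[OF lin, of _ _ 0] unfolding scalar_on_def by blast
qed

lemma hom_uw_diagonal:
  assumes f: "unital_star_hom f" and u: "\<And>i j. f (u i j) = (if i = j then s else 0 :: complex)"
  shows "length i = length j \<Longrightarrow> f (uw i j) = (if i = j then s ^ length i else 0)"
  by (induction i j rule: list_induct2)
     (simp_all add: uw_Nil uw_Cons unital_star_homD[OF f] u)

lemmas counit_uw = hom_uw_diagonal[OF counit(1), of 1, OF counit(2), simplified]
lemmas eps_alt_uw = hom_uw_diagonal[OF eps_alt(1), of "- 1", OF eps_alt(2)]

lemma scalar_on_diagonal:
  assumes "\<And>i j. length i = length j \<Longrightarrow> f (uw i j) = (if i = j then s ^ length i else 0)"
  shows "scalar_on f n (s ^ n)"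
  unfolding scalar_on_def
proof (intro allI impI)
  fix \<xi> :: "'a list \<Rightarrow> complex" and i :: "'a list"
  assume i: "length i = n"
  have "(\<Sum>j\<in>words n. \<xi> j * f (uw i j)) = (\<Sum>j\<in>words n. if j = i then s ^ n * \<xi> i else 0)"
    using i by (intro sum.cong) (auto simp: assms)
  then show "(\<Sum>j\<in>words n. \<xi> j * f (uw i j)) = s ^ n * \<xi> i" using i by simp
qed

section \<open>Determination of a functional by its scalars, and the trace identity\<close>

text \<open>Induction on word length. By row orthogonality a contraction of the tensor
  \<open>j \<mapsto> \<psi> (uw i j)\<close> is 0 or a value on words two letters shorter, so the
  tensor is contraction-free and fixed by \<open>jwp\<close>. The rows of \<open>jwp\<close> are
  contraction-free too, so the hypothesis makes their pairing with it vanish.\<close>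

lemma scalar_on_zero_imp_zero:
  fixes \<psi> :: "'n::finite pol_O \<Rightarrow> complex"
  assumes N: "2 \<le> card (UNIV :: 'n set)" and lin: "clinear_map \<psi>" and 0: "\<And>n. scalar_on \<psi> n 0"
  shows "\<psi> x = 0"
proof (rule clinear_map_eq_0_uw[OF lin])
  fix i j :: "'n list"
  assume "length i = length j"
  then show "\<psi> (uw i j) = 0"
  proof (induction "length i" arbitrary: i j rule: less_induct)
    case less
    have "capfree (\<lambda>j. \<psi> (uw i j))"
      unfolding capfree_def
    proof (intro allI)
      fix v w :: "'n list"
      show "(\<Sum>k\<in>UNIV. \<psi> (uw i (v @ k # k # w))) = 0"
      proof (cases "length i = length v + Suc (Suc (length w))")
        case True
        define i1 where "i1 = take (length v) i"
        obtain a b i2 where "drop (length v) i = a # b # i2" "length i2 = length w"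
          using True by (metis (no_types, opaque_lifting) add_diff_cancel_left' length_Suc_conv length_drop)
        then have i: "i = i1 @ a # b # i2" and len: "length i1 = length v" "length i2 = length w"
          using append_take_drop_id[of "length v" i] True by (simp_all add: i1_def)
        have "\<psi> (uw (i1 @ i2) (v @ w)) = 0"
          using len by (intro less.hyps) (simp_all add: i)
        then show ?thesis
          unfolding clinear_map_sum[OF lin, symmetric] i uw_contract_cols[OF len]
          by (simp add: clinear_map_0[OF lin])
      qed (simp add: uw_length clinear_map_0[OF lin])
    qed
    then have "\<psi> (uw i j) = (\<Sum>k\<in>words (length i). jwp j k * \<psi> (uw i k))"
      using jwp_expand[of "\<lambda>j. \<psi> (uw i j)" j "length i"] less.prems by simp
    also have "\<dots> = 0"
      using 0 capfree_jwp_right[OF N, of j] by (simp add: scalar_on_def)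
    finally show ?case .
  qed
qed

text \<open>Insert the column relation in front of \<open>uw r r\<close> and rotate one factor to
  the back: the column word becomes \<open>x # r @ [x]\<close>, of degree two higher.\<close>

lemma tracial_scalars:
  fixes \<phi> :: "'n::finite pol_O \<Rightarrow> complex"
  assumes N: "3 \<le> card (UNIV :: 'n set)" and lin: "clinear_map \<phi>" and tr: "tracial \<phi>"
    and n: "0 < n" and c: "scalar_on \<phi> n c" and c': "scalar_on \<phi> (Suc (Suc n)) c'"
  shows "c' = c"
proof -
  have N2: "2 \<le> card (UNIV :: 'n set)" using N by simp
  \<comment> \<open>\<open>r\<close> alternates between two letters and the third is kept for the
    ends, so \<open>x # r @ [x]\<close> has no equal neighbours whatever the parity of
    \<open>n\<close>; \<open>0 < n\<close> keeps the two copies of \<open>x\<close> apart.\<close>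
  obtain x y z :: 'n where xyz: "x \<noteq> y" "x \<noteq> z" "y \<noteq> z" using ex_three_letters[OF N] by blast
  define r where "r = altw y z n"
  have r: "length r = n" "distinct_adj r" "r \<noteq> []" "x \<notin> set r"
    using xyz n set_altw[of y z n] by (auto simp: r_def simp flip: length_greater_0_conv)
  then have "last r \<noteq> x" "hd r \<noteq> x" by auto
  then have w: "distinct_adj (x # r @ [x])"
    using r by (simp add: distinct_adj_Cons distinct_adj_append_iff)
  have "c = \<phi> ((\<Sum>k\<in>UNIV. u k x * u k x) * uw r r)"
    using scalar_on_distinct_adj[OF N2 c r(2) r(1) r(1)] by (simp add: u_col_orthogonal)
  also have "\<dots> = (\<Sum>k\<in>UNIV. \<phi> (u k x * (u k x * uw r r)))"
    by (simp add: sum_distrib_right clinear_map_sum[OF lin] mult.assoc)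
  also have "\<dots> = (\<Sum>k\<in>UNIV. \<phi> (u k x * uw r r * u k x))"
    using tr by (intro sum.cong refl) (simp add: tracial_def)
  also have "\<dots> = (\<Sum>k\<in>UNIV. \<phi> (uw (k # r @ [k]) (x # r @ [x])))"
    by (simp add: uw_Cons uw_append uw_Nil mult.assoc)
  also have "\<dots> = (\<Sum>k\<in>UNIV. if k = x then c' else 0)"
    using r by (intro sum.cong refl) (subst scalar_on_distinct_adj[OF N2 c' w], auto)
  also have "\<dots> = c'" by simp
  finally show ?thesis ..
qed

subsection \<open>Decay of the Haar state along alternating words\<close>

text \<open>Neighbours in \<open>k # r\<close> differ, so the two central letters are the only equal
  neighbours. The cases follow the position of the repeated pair relative to the centre.\<close>

lemma palindrome_repeat:
  assumes "distinct_adj (k # r)" "v @ m # m # x = rev r @ k # k # r"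
  shows "v = rev r \<and> m = k \<and> x = r"
proof -
  from assms(2) obtain us where
    "v = rev r @ us \<and> us @ m # m # x = k # k # r \<or> v @ us = rev r \<and> m # m # x = us @ k # k # r"
    by (auto simp: append_eq_append_conv2)
  then show ?thesis
  proof
    assume *: "v = rev r @ us \<and> us @ m # m # x = k # k # r"
    show ?thesis
    proof (cases us rule: list.exhaust[case_names Nil Cons])
      case (Cons p us')
      note us = this
      show ?thesis
      proof (cases us')
        case Nil
        then show ?thesis using * us assms(1) by auto
      next
        case (Cons q us'')
        then have "r = us'' @ m # m # x" using * us by simp
        then show ?thesis using assms(1) by (auto simp: distinct_adj_Cons distinct_adj_append_iff)
      qed
    qed (use * in auto)
  next
    assume *: "v @ us = rev r \<and> m # m # x = us @ k # k # r"
    show ?thesis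
    proof (cases us rule: list.exhaust[case_names Nil Cons])
      case (Cons p us')
      note us = this
      show ?thesis
      proof (cases us')
        case Nil
        then have "m = k" "rev r = v @ [k]" using * us by auto
        then have "r = k # rev v" by (metis rev_rev_ident rev_eq_Cons_iff)
        then show ?thesis using assms(1) by simp
      next
        case (Cons q us'')
        then have "rev r = v @ m # m # us''" using * us by auto
        moreover have "distinct_adj (rev r)" using assms(1) by (auto simp: distinct_adj_Cons)
        ultimately show ?thesis by (simp add: distinct_adj_append_iff)
      qed
    qed (use * in auto)
  qed
qed

text \<open>The only nonzero contraction of either palindrome is the central one, and it gives
  \<open>rev r @ r\<close> whatever the central letter.\<close>

lemma capfree_palindromes:
  fixes r :: "'n::finite list"
  assumes "distinct_adj (k # r)" "distinct_adj (l # r)"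
  shows "capfree (\<lambda>w. (if w = rev r @ k # k # r then 1 else 0) - (if w = rev r @ l # l # r then 1 else 0) :: complex)"
  unfolding capfree_def
proof (intro allI)
  fix v x :: "'n list"
  have "v @ m # m # x = rev r @ p # p # r \<longleftrightarrow> m = p \<and> v = rev r \<and> x = r"
    if "distinct_adj (p # r)" for m p
    using palindrome_repeat[OF that] by blast
  note iff = this[OF assms(1)] this[OF assms(2)]
  show "(\<Sum>m\<in>UNIV. (if v @ m # m # x = rev r @ k # k # r then 1 else 0)
      - (if v @ m # m # x = rev r @ l # l # r then 1 else 0 :: complex)) = 0"
    unfolding iff by (cases "v = rev r \<and> x = r") (auto simp: sum_subtractf)
qed

lemma star_uw_mult_uw:
  "length i = length j \<Longrightarrow> star (uw (a # i) (k # j)) * uw (a # i) (k # j)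
     = uw (rev i @ a # a # i) (rev j @ k # k # j)"
  by (subst star_uw) (simp_all add: uw_append uw_Cons uw_Nil mult.assoc)

text \<open>\<open>h\<close> kills contraction-free tensors of positive degree; the test tensor is
  the difference of two palindromes, whose monomials are the products of an element with its
  star.\<close>

lemma haar_norm_independent:
  fixes h :: "'n::finite pol_O \<Rightarrow> complex" and i :: "'n list"
  assumes h: "\<And>n. 0 < n \<Longrightarrow> scalar_on h n 0"
    and "distinct_adj (k # r)" "distinct_adj (l # r)" and len: "length i = length r"
  shows "h (star (uw (a # i) (k # r)) * uw (a # i) (k # r))
    = h (star (uw (a # i) (l # r)) * uw (a # i) (l # r))"
proof -
  let ?n = "Suc (Suc (length r + length r))" and ?i = "rev i @ a # a # i"
  let ?K = "rev r @ k # k # r" and ?L = "rev r @ l # l # r"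
  have "(\<Sum>j\<in>words ?n. ((if j = ?K then 1 else 0) - (if j = ?L then 1 else 0)) * h (uw ?i j)) = 0"
    using h[of ?n] capfree_palindromes[OF assms(2,3)] len by (simp add: scalar_on_def)
  moreover have "(\<Sum>j\<in>words ?n. ((if j = ?K then 1 else 0) - (if j = ?L then 1 else 0)) * h (uw ?i j))
      = (\<Sum>j\<in>words ?n. if j = ?K then h (uw ?i ?K) else 0) - (\<Sum>j\<in>words ?n. if j = ?L then h (uw ?i ?L) else 0)"
    unfolding sum_subtractf[symmetric] by (intro sum.cong) auto
  ultimately show ?thesis by (simp add: star_uw_mult_uw[OF len])
qed

lemma sum_star_uw_Cons:
  "(\<Sum>k\<in>UNIV. star (uw (a # i) (k # j)) * uw (a # i) (k # j)) = star (uw i j) * uw i j"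
proof -
  have "(\<Sum>k\<in>UNIV. star (uw (a # i) (k # j)) * uw (a # i) (k # j))
      = star (uw i j) * (\<Sum>k\<in>UNIV. u a k * u a k) * uw i j"
    by (simp add: uw_Cons star_mult star_u sum_distrib_left sum_distrib_right mult.assoc)
  then show ?thesis by (simp add: u_row_orthogonal)
qed

lemma stateD:
  assumes "state \<phi>"
  shows "clinear_map \<phi>" "\<phi> 1 = 1" "0 \<le> Re (\<phi> (star x * x))" "Im (\<phi> (star x * x)) = 0"
  using assms by (auto simp: state_def complex_nonneg_Reals_iff)

text \<open>Summing over the leading column letter removes it. All summands are nonnegative and at
  least two of them agree, so each new letter at least halves the value.\<close>

lemma haar_norm_altw:
  fixes h :: "'n::finite pol_O \<Rightarrow> complex"
  assumes N: "3 \<le> card (UNIV :: 'n set)" and h: "\<And>n. 0 < n \<Longrightarrow> scalar_on h n 0" and st: "state h"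
    and ab: "a \<noteq> b"
  shows "Re (h (star (uw (altw a b n) (altw a b n)) * uw (altw a b n) (altw a b n))) \<le> (1/2) ^ n"
  using ab
proof (induction n arbitrary: a b)
  case 0
  then show ?case by (simp add: uw_Nil star_one stateD(2)[OF st])
next
  case (Suc n)
  define r where "r = altw b a n"
  define K where "K k = Re (h (star (uw (a # r) (k # r)) * uw (a # r) (k # r)))" for k
  \<comment> \<open>A third letter: both \<open>a # r\<close> and \<open>l # r\<close> have no equal
    neighbours.\<close>
  obtain l where l: "l \<noteq> a" "l \<noteq> b"
  proof -
    have "card {a, b} < card (UNIV :: 'n set)" using N Suc.prems by simp
    then have "{a, b} \<noteq> UNIV" by (metis less_irrefl)
    then show ?thesis using that by blast
  qed
  have "distinct_adj r" using Suc.prems by (simp add: r_def)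
  then have adj: "distinct_adj (k # r)" if "k \<noteq> b" for k
    using that unfolding r_def by (cases n) simp_all
  note adj = adj[OF Suc.prems] adj[OF l(2)]
  have "2 * K a = K a + K l"
    using haar_norm_independent[OF h adj, of r a] by (simp add: K_def)
  also have "\<dots> = (\<Sum>k\<in>{a, l}. K k)" using l by simp
  also have "\<dots> \<le> (\<Sum>k\<in>UNIV. K k)"
    by (intro sum_mono2) (auto simp: K_def stateD(3)[OF st])
  also have "\<dots> = Re (h (star (uw r r) * uw r r))"
    by (simp add: K_def clinear_map_sum[OF stateD(1)[OF st]] flip: sum_star_uw_Cons[of a r r] Re_sum)
  also have "\<dots> \<le> (1/2) ^ n"
    unfolding r_def using Suc.prems by (intro Suc.IH) simp
  finally show ?case by (simp add: K_def r_def)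
qed

text \<open>The values for all entries of row \<open>x\<close> agree and add up to 1 by row
  orthogonality.\<close>

lemma haar_offdiagonal:
  fixes h :: "'n::finite pol_O \<Rightarrow> complex"
  assumes h: "\<And>n. 0 < n \<Longrightarrow> scalar_on h n 0" and st: "state h"
  shows "0 < Re (h (star (u x y) * u x y))"
proof -
  have uw: "uw [x] [k] = u x k" for k by (simp add: uw_Cons uw_Nil)
  have "h (star (u x y) * u x y) = h (star (u x k) * u x k)" for k
    using haar_norm_independent[OF h, of y "[]" k "[]" x] by (simp add: uw)
  then have "(\<Sum>k\<in>(UNIV :: 'n set). h (star (u x y) * u x y)) = (\<Sum>k\<in>UNIV. h (star (u x k) * u x k))"
    by (intro sum.cong refl)
  also have "\<dots> = 1"
    using stateD(2)[OF st]
    by (simp add: star_u u_row_orthogonal flip: clinear_map_sum[OF stateD(1)[OF st]])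
  finally have "of_nat (card (UNIV :: 'n set)) * h (star (u x y) * u x y) = 1" by simp
  from arg_cong[OF this, of Re]
  have "real (card (UNIV :: 'n set)) * Re (h (star (u x y) * u x y)) = 1" by simp
  then have "0 < real (card (UNIV :: 'n set)) * Re (h (star (u x y) * u x y))" by linarith
  then show ?thesis by (simp add: zero_less_mult_iff)
qed

section \<open>Elementary identities for states\<close>

lemma star_diff: "star (x - y :: 'a::complex_star_algebra) = star x - star y"
  by (metis add_diff_cancel_right' diff_add_cancel star_add)

lemma state_parallelogram:
  assumes st: "state h"
  shows "Re (h (star (x + y) * (x + y))) + Re (h (star (x - y) * (x - y)))
    = 2 * Re (h (star x * x)) + 2 * Re (h (star y * y))"
proof -
  have "star (x + y) * (x + y) + star (x - y) * (x - y)
      = star x * x + star x * x + (star y * y + star y * y)"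
    by (simp add: star_add star_diff algebra_simps)
  from arg_cong[OF this, of "\<lambda>t. Re (h t)"] show ?thesis
    by (simp add: clinear_mapD(1)[OF stateD(1)[OF st]])
qed

text \<open>In the expansion at \<open>1 + x\<close> everything except twice the value at
  \<open>x\<close> is known to be real.\<close>

lemma state_real_selfadjoint:
  assumes st: "state \<phi>" and x: "star x = x"
  shows "Im (\<phi> x) = 0"
proof -
  note lin = clinear_mapD(1)[OF stateD(1)[OF st]]
  have "\<phi> (star (1 + x) * (1 + x)) = 1 + (\<phi> x + \<phi> x + \<phi> (star x * x))"
    by (simp add: star_add star_one x algebra_simps lin stateD(2)[OF st])
  then show ?thesis using stateD(4)[OF st, of "1 + x"] stateD(4)[OF st, of x] by simp
qed

subsection \<open>The decomposition\<close>

text \<open>The step by two starts in degree 1, so degree 0, with scalar 1, stays unrelated to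
  degree 2; the Haar part accounts for that gap.\<close>

lemma tracial_central_scalars:
  fixes \<phi> :: "'n::finite pol_O \<Rightarrow> complex"
  assumes N: "3 \<le> card (UNIV :: 'n set)" and lin: "clinear_map \<phi>" and tr: "tracial \<phi>"
    and ex: "\<And>n. \<exists>c. scalar_on \<phi> n c" and c: "scalar_on \<phi> 1 c1" "scalar_on \<phi> 2 c2"
  shows "0 < n \<Longrightarrow> scalar_on \<phi> n (if even n then c2 else c1)"
proof (induction n rule: less_induct)
  case (less n)
  consider "n = 1" | "n = 2" | m where "n = Suc (Suc m)" "0 < m"
    using less.prems by (metis One_nat_def Suc_1 gr0_conv_Suc not0_implies_Suc)
  then show ?case
  proof cases
    case 3
    obtain c' where c': "scalar_on \<phi> (Suc (Suc m)) c'" using ex by blast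
    have "scalar_on \<phi> m (if even m then c2 else c1)" using 3 by (intro less.IH) auto
    from tracial_scalars[OF N lin tr 3(2) this c'] c' show ?thesis using 3(1) by simp
  qed (use c in simp_all)
qed

theorem theorem4p5:
  fixes \<U> :: "'n::finite pol_O mat set" and h \<phi> :: "'n pol_O \<Rightarrow> complex"
  assumes "card (UNIV :: 'n set) \<ge> 3"
    and "irr_representatives \<U>"
    and "haar_state \<U> h"
    and "state \<phi>" and "tracial \<phi>" and "central \<U> \<phi>"
  shows "\<exists>!w :: real \<times> real \<times> real. case w of (a, b, c) \<Rightarrow>
    0 \<le> a \<and> 0 \<le> b \<and> 0 \<le> c \<and> a + b + c = 1 \<and>
    (\<forall>x. \<phi> x = of_real a * counit x + of_real b * eps_alt x + of_real c * h x)"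
proof -
  note N = assms(1) and st = assms(4) and lin = stateD(1)[OF assms(4)]
  have N2: "2 \<le> card (UNIV :: 'n set)" using N by simp
  have h: "state h" using assms(3) by (simp add: haar_state_def)
  have h0: "scalar_on h n 0" if "0 < n" for n
    by (rule haar_scalar_on[OF N2 assms(2,3) that])
  have ex: "\<exists>c. scalar_on \<phi> n c" for n
    by (rule central_scalar_on[OF N2 assms(2) lin assms(6)])
  obtain c1 c2 where c1: "scalar_on \<phi> 1 c1" and c2: "scalar_on \<phi> 2 c2"
    using ex by metis
  obtain x y :: 'n where xy: "x \<noteq> y" using ex_two_letters[OF N2] by blast
  have adj: "distinct_adj [x]" "distinct_adj [x, y]" using xy by simp_all
  have val1: "f (u x x) = c" if "scalar_on f 1 c" for f c
    using scalar_on_distinct_adj[OF N2 that adj(1), of "[x]"] by (simp add: uw_Cons uw_Nil)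
  have val2: "f (u x x * u y y) = c" if "scalar_on f 2 c" for f c
    using scalar_on_distinct_adj[OF N2 that adj(2), of "[x, y]"] by (simp add: uw_Cons uw_Nil)
  have "Im c1 = 0"
    using state_real_selfadjoint[OF st, of "u x x"] val1[OF c1] by (simp add: star_u)
  moreover have "Im c2 = 0"
  proof -
    \<comment> \<open>The product alone is not known to be self-adjoint; it is symmetrised, and the
      trace property makes both halves equal.\<close>
    have "Im (\<phi> (u x x * u y y + u y y * u x x)) = 0"
      by (rule state_real_selfadjoint[OF st]) (simp add: star_u star_add star_mult add.commute)
    moreover have "\<phi> (u y y * u x x) = \<phi> (u x x * u y y)"
      using assms(5) by (simp add: tracial_def)
    ultimately show ?thesis by (simp add: clinear_mapD[OF lin] val2[OF c2])
  qed
  ultimately obtain r1 r2 where r: "c1 = of_real r1" "c2 = of_real r2"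
    by (metis complex_is_Real_iff Reals_cases)
  \<comment> \<open>Solves \<open>a - b = r1\<close> for odd degrees, \<open>a + b = r2\<close> for
    positive even degrees and \<open>a + b + c = 1\<close> for degree 0.\<close>
  define a b c where "a = (r2 + r1) / 2" and "b = (r2 - r1) / 2" and "c = 1 - r2"
  note abc = a_def b_def c_def
  have scal: "scalar_on (counit :: 'n pol_O \<Rightarrow> complex) n 1"
    "scalar_on (eps_alt :: 'n pol_O \<Rightarrow> complex) n ((- 1) ^ n)" for n
    using scalar_on_diagonal[OF hom_uw_diagonal[OF counit(1) counit(2)], of n]
      scalar_on_diagonal[OF eps_alt_uw, of n]
    by simp_all
  \<comment> \<open>The Haar state contributes in degree 0 only.\<close>
  have combo: "scalar_on (\<lambda>t. p * counit t + q * eps_alt t + s * h t) n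
      (p + q * (- 1) ^ n + (if n = 0 then s else 0))" for p q s n
  proof -
    have "scalar_on h n (if n = 0 then 1 else 0)"
      using h0[of n] scalar_on_0[of h, OF stateD(2)[OF h]] by auto
    from scalar_on_add[OF scalar_on_add[OF scalar_on_mult[OF scal(1), of p] scalar_on_mult[OF scal(2), of q]]
        scalar_on_mult[OF this, of s]]
    show ?thesis by (cases "n = 0") simp_all
  qed
  have decomp: "\<phi> t = of_real a * counit t + of_real b * eps_alt t + of_real c * h t" for t
  proof -
    \<comment> \<open>All scalars of the difference vanish, so the difference itself does.\<close>
    let ?\<psi> = "\<lambda>t. of_real a * counit t + of_real b * eps_alt t + of_real c * h t + (- 1) * \<phi> t"
    have "?\<psi> t = 0"
    proof (rule scalar_on_zero_imp_zero[OF N2])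
      show "clinear_map ?\<psi>"
        by (simp add: clinear_map_def clinear_mapD[OF lin] clinear_mapD[OF stateD(1)[OF h]]
            clinear_mapD[OF unital_star_homD(1)[OF counit(1)]]
            clinear_mapD[OF unital_star_homD(1)[OF eps_alt(1)]] algebra_simps)
      fix n
      have "scalar_on \<phi> n (if n = 0 then 1 else if even n then c2 else c1)"
        using scalar_on_0[of \<phi>, OF stateD(2)[OF st]] tracial_central_scalars[OF N lin assms(5) ex c1 c2, of n]
        by auto
      from scalar_on_add[OF combo[of "of_real a" "of_real b" "of_real c" n] scalar_on_mult[OF this, of "- 1"]]
      have "scalar_on ?\<psi> n (of_real a + of_real b * (- 1) ^ n + (if n = 0 then of_real c else 0)
          + (- 1) * (if n = 0 then 1 else if even n then c2 else c1))" .
      moreover have "of_real a + of_real b * (- 1) ^ n + (if n = 0 then of_real c else 0)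
          + (- 1) * (if n = 0 then 1 else if even n then c2 else c1) = 0"
        by (auto simp: abc r field_simps)
      ultimately show "scalar_on ?\<psi> n 0" by simp
    qed
    then show ?thesis by simp
  qed
  have c: "0 \<le> c"
  proof -
    \<comment> \<open>Both characters vanish at an off-diagonal generator, where the Haar term is
      strictly positive.\<close>
    have "\<phi> (star (u x y) * u x y) = of_real c * h (star (u x y) * u x y)"
      using xy by (simp add: decomp star_u unital_star_homD[OF counit(1)] unital_star_homD[OF eps_alt(1)]
          counit(2) eps_alt(2))
    with stateD(3)[OF st, of "u x y"] have "0 \<le> c * Re (h (star (u x y) * u x y))" by simp
    with haar_offdiagonal[OF h0 h, of x y] show ?thesis by (simp add: zero_le_mult_iff)
  qed
  \<comment> \<open>The counit is 2 at \<open>X n + X (Suc n)\<close> and 0 at the difference;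
    \<open>eps_alt\<close> is 0 at the sum and plus or minus 2 at the difference. Each test element
    thus sees only one of \<open>a\<close> and \<open>b\<close>, with factor 4.\<close>
  define X where "X n = uw (altw x y n) (altw x y n)" for n
  have X: "counit (X n) = 1" "eps_alt (X n) = (- 1) ^ n" for n
    by (simp_all add: X_def counit_uw eps_alt_uw)
  \<comment> \<open>By the parallelogram identity the two nonnegative quantities add up to at most
    the common bound.\<close>
  have bound: "Re (h (star (X n + X (Suc n)) * (X n + X (Suc n)))) \<le> 4 * (1/2) ^ n"
    "Re (h (star (X n - X (Suc n)) * (X n - X (Suc n)))) \<le> 4 * (1/2) ^ n" for n
  proof -
    have K: "Re (h (star (X m) * X m)) \<le> (1/2) ^ m" for m
      unfolding X_def by (rule haar_norm_altw[OF N h0 h xy])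
    have "(1/2 :: real) ^ Suc n \<le> (1/2) ^ n" by simp
    with K[of n] K[of "Suc n"] state_parallelogram[OF h, of "X n" "X (Suc n)"]
      stateD(3)[OF h, of "X n + X (Suc n)"] stateD(3)[OF h, of "X n - X (Suc n)"]
    show "Re (h (star (X n + X (Suc n)) * (X n + X (Suc n)))) \<le> 4 * (1/2) ^ n"
      "Re (h (star (X n - X (Suc n)) * (X n - X (Suc n)))) \<le> 4 * (1/2) ^ n"
      by linarith+
  qed
  \<comment> \<open>The Haar contribution decays, so the limit leaves \<open>s\<close>;
    \<open>0 \<le> c\<close> is needed to bound it from above.\<close>
  have nonneg: "0 \<le> s" if "\<And>n. 0 \<le> 4 * s + c * t n" "\<And>n. t n \<le> 4 * (1/2) ^ n" for s :: real and t :: "nat \<Rightarrow> real"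
  proof (rule LIMSEQ_le_const)
    show "(\<lambda>n. s + c * (1/2) ^ n) \<longlonglongrightarrow> s"
      using tendsto_add[OF tendsto_const tendsto_mult[OF tendsto_const LIMSEQ_realpow_zero[of "1/2"]], of s c] by simp
    have "0 \<le> s + c * (1/2) ^ n" for n
      using that(1)[of n] mult_left_mono[OF that(2)[of n] c] by (simp add: algebra_simps)
    then show "\<exists>M. \<forall>n\<ge>M. 0 \<le> s + c * (1/2) ^ n" by blast
  qed
  have a: "0 \<le> a"
  proof (rule nonneg)
    fix n
    have "\<phi> (star (X n + X (Suc n)) * (X n + X (Suc n)))
        = of_real (4 * a) + of_real c * h (star (X n + X (Suc n)) * (X n + X (Suc n)))"
      unfolding decomp[of "star (X n + X (Suc n)) * (X n + X (Suc n))"]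
      by (simp add: unital_star_homD[OF counit(1)] unital_star_homD[OF eps_alt(1)] X
          clinear_mapD[OF unital_star_homD(1)[OF counit(1)]]
          clinear_mapD[OF unital_star_homD(1)[OF eps_alt(1)]])
    with stateD(3)[OF st, of "X n + X (Suc n)"]
    show "0 \<le> 4 * a + c * Re (h (star (X n + X (Suc n)) * (X n + X (Suc n))))" by simp
  qed (rule bound)
  have b: "0 \<le> b"
  proof (rule nonneg)
    fix n
    have sq: "(- 1) ^ n * (- 1) ^ n = (1 :: complex)" by (simp flip: power_mult_distrib)
    have "\<phi> (star (X n - X (Suc n)) * (X n - X (Suc n)))
        = of_real (4 * b) + of_real c * h (star (X n - X (Suc n)) * (X n - X (Suc n)))"
      unfolding decomp[of "star (X n - X (Suc n)) * (X n - X (Suc n))"]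
      by (simp add: unital_star_homD[OF counit(1)] unital_star_homD[OF eps_alt(1)] X
          clinear_map_diff[OF unital_star_homD(1)[OF counit(1)]]
          clinear_map_diff[OF unital_star_homD(1)[OF eps_alt(1)]] algebra_simps sq)
    with stateD(3)[OF st, of "X n - X (Suc n)"]
    show "0 \<le> 4 * b + c * Re (h (star (X n - X (Suc n)) * (X n - X (Suc n))))" by simp
  qed (rule bound)
  show ?thesis
  proof (rule ex1I[of _ "(a, b, c)"])
    show "case (a, b, c) of (a, b, c) \<Rightarrow> 0 \<le> a \<and> 0 \<le> b \<and> 0 \<le> c \<and> a + b + c = 1 \<and>
        (\<forall>x. \<phi> x = of_real a * counit x + of_real b * eps_alt x + of_real c * h x)"
      using a b c decomp by (simp add: abc field_simps)
  next
    fix w :: "real \<times> real \<times> real"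
    assume w: "case w of (a, b, c) \<Rightarrow> 0 \<le> a \<and> 0 \<le> b \<and> 0 \<le> c \<and> a + b + c = 1 \<and>
        (\<forall>x. \<phi> x = of_real a * counit x + of_real b * eps_alt x + of_real c * h x)"
    obtain p q s where [simp]: "w = (p, q, s)" by (cases w)
    have sum: "p + q + s = 1"
      and \<phi>: "\<phi> = (\<lambda>t. of_real p * counit t + of_real q * eps_alt t + of_real s * h t)"
      using w by (auto simp: fun_eq_iff)
    \<comment> \<open>Uniqueness: degrees 1 and 2 recover \<open>p - q\<close> and
      \<open>p + q\<close>, and the sum condition then gives \<open>s\<close>.\<close>
    have "scalar_on \<phi> n (of_real p + of_real q * (- 1) ^ n)" if "0 < n" for n
      using combo[of "of_real p" "of_real q" "of_real s" n] that unfolding \<phi> by simp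
    from val1[OF this[of 1]] val2[OF this[of 2]]
    have "of_real (p - q) = \<phi> (u x x)" "of_real (p + q) = \<phi> (u x x * u y y)" by simp_all
    then have "of_real (p - q) = complex_of_real r1" "of_real (p + q) = complex_of_real r2"
      using val1[OF c1] val2[OF c2] r by simp_all
    then have "p - q = r1" "p + q = r2" by (simp_all only: of_real_eq_iff)
    then show "w = (a, b, c)" using sum by (auto simp: abc field_simps)
  qed
qed

end
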